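(* Let $T$ be a rooted plane tree of depth $n\ge1$ which is not a path, and let $\mathcal C$ be a collision in $\mathcal K(T)$. Then the corresponding facet $\mathcal K(T)_{\mathcal C}=\{\mathcal B\in\mathcal K(T):\mathcal C\le\mathcal B\}$ of the $n$-associahedron admits a canonical isomorphism of posets $$\mathcal K(T)_{\mathcal C}\cong\mathcal K(T/\mathcal C)\times\mathcal K(T|_{\mathcal C}).$$
   Context: **Trees.** A rooted plane tree $T$ is a finite rooted tree with a total order on the set $\mathrm{ch}(u)$ of children of every vertex $u$. $V^k(T)$ is the set of vertices at distance $k$ from the root; the depth of $T$ is the largest $k$ with $V^k(T)\ne\emptyset$. $T$ has depth $n\ge1$ and is not a path. **Brackets.** For $0\le k\le n$ a $k$-bracket of $T$ is $A=(A^0,\dots,A^k)$ with $A^i\subseteq V^i(T)$, $A^k\neq\emptyset$, such that the parent of every $u\in A^i$ ($i\ge 1$) lies in $A^{i-1}$, and for every $u\in A^{i-1}$ the set $A^i\cap\mathrm{ch}(u)$ is a (possibly empty) set of consecutive elements of $\mathrm{ch}(u)$. For $k$-brackets, $A\subseteq A'$ means $A^i\subseteq A'^i$ for all $i$. For $k\ge1$, $\pi(A)=(A^0,\dots,A^{k-1})$. The singleton $k$-bracket $A(u)$ of $u\in V^k(T)$ has $A(u)^i=\{\text{the depth-}i\text{ vertex on the path from the root to }u\}$; the maximum $k$-bracket is $(V^0(T),\dots,V^k(T))$. A bracket is nontrivial if it is neither singleton nor maximum. **$n$-bracketings.** An $n$-bracketing $\mathcal B$ of $T$ consists of sets $\mathcal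 B^k$ of $k$-brackets ($0\le k\le n$) and a strict partial order $<_{\mathcal B}$ on $\bigsqcup_k\mathcal B^k$ such that, writing $\mathcal B_A=\{A'\in\mathcal B^{k}:\pi(A')=A\}$ for $A\in\mathcal B^{k-1}$: (1) $\mathcal B^k$ contains the maximum and all singleton $k$-brackets; (2) $A\in\mathcal B^k$, $k\ge1$, implies $\pi(A)\in\mathcal B^{k-1}$; (3) if $A_1,A_2\in\mathcal B^k$ and $A_1^k\cap A_2^k\ne\emptyset$ then $A_1\subseteq A_2$ or $A_2\subseteq A_1$; (4a) for $A\in\mathcal B^{k-1}$, $1\le k\le n$: $\bigcup_{A'\in\mathcal B_A}A'^k=\bigcup_{u\in A^{k-1}}\mathrm{ch}(u)$; (4b) if $A_1,A_2\in\mathcal B_A$, $A_2\subsetneq A_1$, then every $u'\in A_1^k$ lies in $A_3^k$ for some $A_3\in\mathcal B_A$ with $A_3\subsetneq A_1$; (5a) distinct elements $A_1,A_2\in\mathcal B^k$ are comparable under $<_{\mathcal B}$ iff $\pi(A_1)=\pi(A_2)$ and $A_1^k\cap A_2^k=\emptyset$ (elements of different levels are incomparable); (5b) if $u_1$ precedes $u_2$ in $\mathrm{ch}(u)$ then $A(u_1)<_{\mathcal B}A(u_2)$; (5c) if $A,\tilde A\in\mathcal B^{k-1}$, $\tilde A\subseteq A$, $A_1\ne A_2\in\mathcal B_A$ are comparable, $\tilde A_1\ne\tilde A_2\in\mathcal B_{\tilde A}$ are comparable, and $\tilde A_i\subseteq A_i$ for $i=1,2$, then $A_1<_{\mathcal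 B}A_2\iff\tilde A_1<_{\mathcal B}\tilde A_2$. The categorical $n$-associahedron $\mathcal K(T)$ is the set of $n$-bracketings of $T$ ordered by: $\mathcal B_1\le\mathcal B_2$ iff $\mathcal B_1^k\subseteq\mathcal B_2^k$ for all $k$ and $<_{\mathcal B_1}$ is the restriction of $<_{\mathcal B_2}$. Its minimum $\mathcal B_{\min}$ has only singleton and maximum brackets. The truncation $\pi(\mathcal B)=(\mathcal B^0,\dots,\mathcal B^{n-1})$ with the restricted order is an $(n-1)$-bracketing of the tree obtained from $T$ by deleting the depth-$n$ vertices. **Collisions.** A collision is an atom of $\mathcal K(T)$ (a minimal element of $\mathcal K(T)\setminus\{\mathcal B_{\min}\}$). The fusion bracket of a collision $\mathcal C$ is the (unique) nonsingleton bracket $E_0$ of $\mathcal C$ such that $\pi(E_0)$ is a singleton bracket and $E_0=\pi^{l}(A')$ for some nontrivial $A'$ in $\mathcal C$ and $l\ge0$. A bracket $E$ of $\mathcal C$ is essential if $E=\pi^l(A')$ for some nontrivial $A'$ in $\mathcal C$, $l\ge0$, and $\pi^j(E)=E_0$ for some $j\ge0$. **Contraction.** Let $E_0\in\mathcal C^{k_0}$, $\pi(E_0)=A(w)$, $W=E_0^{k_0}\subseteq\mathrm{ch}(w)$. The rooted plane tree $T/\mathcal C$ is obtained from $T$ by removing $W$ and all its descendants and inserting a depth-$k$ vertex $v_E$ for each essential $E\in\mathcal C^k$: $v_{E_0}$ is a child of $w$ taking the place of the consecutive set $W$; the children of $v_E$ are the $v_{E'}$ with $E'$ essential, $\pi(E')=E$,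 ordered by $<_{\mathcal C}$. **The iterated fiber product $\mathcal K(T|_{\mathcal C})$.** For a $k$-bracket $A$, let $T|_A$ be the rooted plane subtree of $T$ with vertex set $A^0\cup\dots\cup A^k$. For an essential bracket $A\in \mathcal{C}^n$ put $\mathcal K(T|_{\mathcal C,A})=\mathcal K(T|_A)$; for $A\in\mathcal C^k$ essential with $k<n$, $\mathcal K(T|_{\mathcal C,A})$ is the fiber product over $\mathcal K(T|_A)$ of the posets $\mathcal K(T|_{\mathcal C,A'})$, $A'\in\mathcal C^{k+1}$ essential with $\pi(A')=A$, along the maps $\mathcal K(T|_{\mathcal C,A'})\to\mathcal K(T|_{A'})\xrightarrow{\ \pi\ }\mathcal K(T|_A)$ (an empty fiber product over $\mathcal K(T|_A)$ being $\mathcal K(T|_A)$). $\mathcal K(T|_{\mathcal C})=\mathcal K(T|_{\mathcal C,E_0})$. Equivalently, its elements are families $(\mathcal B_A)_A$ indexed by the essential brackets $A$ of $\mathcal C$ with $\mathcal B_A\in\mathcal K(T|_A)$ and $\pi(\mathcal B_A)=\mathcal B_{\pi(A)}$ for all $A\ne E_0$, ordered componentwise. *)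

theory Defs
  imports Main "HOL-Library.FuncSet"
begin

section \<open>Rooted plane trees\<close>

text \<open>\<open>arcs\<close> consists of the pairs (parent, child); \<open>sib T u\<close> is the strict total order
  ``precedes'' on the children of \<open>u\<close>.\<close>

record 'v plane_tree =
  verts :: "'v set"
  root :: 'v
  arcs :: "'v rel"
  sib :: "'v \<Rightarrow> 'v rel"

definition ch :: "'v plane_tree \<Rightarrow> 'v \<Rightarrow> 'v set" where
  "ch T u = {v. (u, v) \<in> arcs T}"

definition rooted_plane_tree :: "'v plane_tree \<Rightarrow> bool" where
  "rooted_plane_tree T \<longleftrightarrow>
     finite (verts T) \<and> root T \<in> verts T \<and> arcs T \<subseteq> verts T \<times> verts T \<and>
     (\<forall>u. (u, root T) \<notin> arcs T) \<and>
     (\<forall>v \<in> verts T - {root T}. \<exists>!u. (u, v) \<in> arcs T) \<and>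
     (\<forall>v \<in> verts T. (root T, v) \<in> (arcs T)\<^sup>*) \<and>
     (\<forall>u \<in> verts T. sib T u \<subseteq> ch T u \<times> ch T u \<and> strict_linear_order_on (ch T u) (sib T u))"

definition level :: "'v plane_tree \<Rightarrow> nat \<Rightarrow> 'v set" where
  "level T k = {v. (root T, v) \<in> arcs T ^^ k}"

definition depth :: "'v plane_tree \<Rightarrow> nat" where
  "depth T = Max {k. level T k \<noteq> {}}"

definition is_path :: "'v plane_tree \<Rightarrow> bool" where
  "is_path T \<longleftrightarrow> (\<forall>u \<in> verts T. card (ch T u) \<le> 1)"

definition consecutive :: "'v plane_tree \<Rightarrow> 'v \<Rightarrow> 'v set \<Rightarrow> bool" where
  "consecutive T u S \<longleftrightarrow> S \<subseteq> ch T u \<and>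
     (\<forall>x \<in> S. \<forall>z \<in> S. \<forall>y \<in> ch T u. (x, y) \<in> sib T u \<and> (y, z) \<in> sib T u \<longrightarrow> y \<in> S)"


section \<open>Brackets\<close>

text \<open>A \<open>k\<close>-bracket \<open>(A\<^sup>0, \<dots>, A\<^sup>k)\<close> is a list of length \<open>k + 1\<close>. So \<open>A\<^sup>i\<close> is \<open>A ! i\<close>, \<open>A\<^sup>k\<close>
  is \<open>last A\<close>, the truncation \<open>\<pi> A\<close> is \<open>butlast A\<close> and \<open>\<pi>\<^sup>l A\<close> is \<open>(butlast ^^ l) A\<close>.
  The empty list, reached when \<open>\<pi>\<close> is iterated too often, is not a bracket.\<close>

type_synonym 'v bracket = "'v set list"

definition is_bracket :: "'v plane_tree \<Rightarrow> nat \<Rightarrow> 'v bracket \<Rightarrow> bool" where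
  "is_bracket T k A \<longleftrightarrow>
     length A = Suc k \<and> (\<forall>i \<le> k. A ! i \<subseteq> level T i) \<and> A ! k \<noteq> {} \<and>
     (\<forall>i \<in> {1..k}. \<forall>u \<in> A ! i. \<exists>v \<in> A ! (i - 1). u \<in> ch T v) \<and>
     (\<forall>i \<in> {1..k}. \<forall>u \<in> A ! (i - 1). consecutive T u (A ! i \<inter> ch T u))"

definition bsub :: "'v bracket \<Rightarrow> 'v bracket \<Rightarrow> bool"  (infix "\<sqsubseteq>" 50) where
  "A \<sqsubseteq> A' \<longleftrightarrow> list_all2 (\<subseteq>) A A'"

definition bpsub :: "'v bracket \<Rightarrow> 'v bracket \<Rightarrow> bool"  (infix "\<sqsubset>" 50) where
  "A \<sqsubset> A' \<longleftrightarrow> A \<sqsubseteq> A' \<and> A \<noteq> A'"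

text \<open>The depth-\<open>i\<close> vertex on the path from the root to \<open>u\<close> is the ancestor of \<open>u\<close> of depth \<open>i\<close>.\<close>

definition singleton_bracket :: "'v plane_tree \<Rightarrow> nat \<Rightarrow> 'v \<Rightarrow> 'v bracket" where
  "singleton_bracket T k u = map (\<lambda>i. {v \<in> level T i. (v, u) \<in> (arcs T)\<^sup>*}) [0..<Suc k]"

definition max_bracket :: "'v plane_tree \<Rightarrow> nat \<Rightarrow> 'v bracket" where
  "max_bracket T k = map (level T) [0..<Suc k]"

definition is_singleton_bracket :: "'v plane_tree \<Rightarrow> 'v bracket \<Rightarrow> bool" where
  "is_singleton_bracket T A \<longleftrightarrow> (\<exists>k. \<exists>u \<in> level T k. A = singleton_bracket T k u)"

definition is_max_bracket :: "'v plane_tree \<Rightarrow> 'v bracket \<Rightarrow> bool" where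
  "is_max_bracket T A \<longleftrightarrow> (\<exists>k \<le> depth T. A = max_bracket T k)"

definition nontrivial :: "'v plane_tree \<Rightarrow> 'v bracket \<Rightarrow> bool" where
  "nontrivial T A \<longleftrightarrow> \<not> is_singleton_bracket T A \<and> \<not> is_max_bracket T A"


section \<open>Bracketings and the categorical associahedron\<close>

text \<open>Since the length of a bracket determines its level, the disjoint union of the sets
  \<open>\<B>\<^sup>k\<close> is kept as the single set \<open>brs \<B>\<close>, from which \<open>\<B>\<^sup>k\<close> is recovered as \<open>brs_at \<B> k\<close>.\<close>

record 'v bracketing =
  brs :: "'v bracket set"
  less_rel :: "'v bracket rel"

definition brs_at :: "'v bracketing \<Rightarrow> nat \<Rightarrow> 'v bracket set" where
  "brs_at B k = {A \<in> brs B. length A = Suc k}"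

definition brs_over :: "'v bracketing \<Rightarrow> nat \<Rightarrow> 'v bracket \<Rightarrow> 'v bracket set" where
  "brs_over B k A = {A' \<in> brs_at B k. butlast A' = A}"

definition comparable :: "'v bracketing \<Rightarrow> 'v bracket \<Rightarrow> 'v bracket \<Rightarrow> bool" where
  "comparable B A1 A2 \<longleftrightarrow> (A1, A2) \<in> less_rel B \<or> (A2, A1) \<in> less_rel B"

definition is_bracketing :: "'v plane_tree \<Rightarrow> 'v bracketing \<Rightarrow> bool" where
  "is_bracketing T B \<longleftrightarrow>
     (\<forall>A \<in> brs B. \<exists>k \<le> depth T. is_bracket T k A) \<and>
     less_rel B \<subseteq> brs B \<times> brs B \<and> irrefl (less_rel B) \<and> trans (less_rel B) \<and>
     (\<forall>k \<le> depth T. max_bracket T k \<in> brs_at B k \<and>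
        (\<forall>u \<in> level T k. singleton_bracket T k u \<in> brs_at B k)) \<and>
     (\<forall>k \<in> {1..depth T}. \<forall>A \<in> brs_at B k. butlast A \<in> brs_at B (k - 1)) \<and>
     (\<forall>k \<le> depth T. \<forall>A1 \<in> brs_at B k. \<forall>A2 \<in> brs_at B k.
        A1 ! k \<inter> A2 ! k \<noteq> {} \<longrightarrow> A1 \<sqsubseteq> A2 \<or> A2 \<sqsubseteq> A1) \<and>
     (\<forall>k \<in> {1..depth T}. \<forall>A \<in> brs_at B (k - 1).
        (\<Union>A' \<in> brs_over B k A. A' ! k) = (\<Union>u \<in> A ! (k - 1). ch T u)) \<and>
     (\<forall>k \<in> {1..depth T}. \<forall>A \<in> brs_at B (k - 1).
        \<forall>A1 \<in> brs_over B k A. \<forall>A2 \<in> brs_over B k A. A2 \<sqsubset> A1 \<longrightarrow>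
          (\<forall>u \<in> A1 ! k. \<exists>A3 \<in> brs_over B k A. A3 \<sqsubset> A1 \<and> u \<in> A3 ! k)) \<and>
     \<comment> \<open>there is only one 0-bracket, so the value of \<open>butlast\<close> on it is irrelevant\<close>
     (\<forall>k \<le> depth T. \<forall>A1 \<in> brs_at B k. \<forall>A2 \<in> brs_at B k. A1 \<noteq> A2 \<longrightarrow>
        (comparable B A1 A2 \<longleftrightarrow> butlast A1 = butlast A2 \<and> A1 ! k \<inter> A2 ! k = {})) \<and>
     (\<forall>A1 A2. comparable B A1 A2 \<longrightarrow> length A1 = length A2) \<and>
     (\<forall>k \<in> {1..depth T}. \<forall>u \<in> level T (k - 1). \<forall>(u1, u2) \<in> sib T u.
        (singleton_bracket T k u1, singleton_bracket T k u2) \<in> less_rel B) \<and>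
     (\<forall>k \<in> {1..depth T}. \<forall>A \<in> brs_at B (k - 1). \<forall>A' \<in> brs_at B (k - 1). A' \<sqsubseteq> A \<longrightarrow>
        (\<forall>A1 \<in> brs_over B k A. \<forall>A2 \<in> brs_over B k A.
         \<forall>A1' \<in> brs_over B k A'. \<forall>A2' \<in> brs_over B k A'.
           A1 \<noteq> A2 \<and> comparable B A1 A2 \<and> A1' \<noteq> A2' \<and> comparable B A1' A2' \<and>
           A1' \<sqsubseteq> A1 \<and> A2' \<sqsubseteq> A2 \<longrightarrow>
             ((A1, A2) \<in> less_rel B \<longleftrightarrow> (A1', A2') \<in> less_rel B)))"

definition associahedron :: "'v plane_tree \<Rightarrow> 'v bracketing set" where
  "associahedron T = {B. is_bracketing T B}"

definition restrict_brs :: "'v bracketing \<Rightarrow> 'v bracket set \<Rightarrow> 'v bracketing" where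
  "restrict_brs B S = \<lparr>brs = brs B \<inter> S, less_rel = less_rel B \<inter> S \<times> S\<rparr>"

definition bk_le :: "'v bracketing \<Rightarrow> 'v bracketing \<Rightarrow> bool" where
  "bk_le B1 B2 \<longleftrightarrow> brs B1 \<subseteq> brs B2 \<and> less_rel B1 = less_rel B2 \<inter> brs B1 \<times> brs B1"

text \<open>The truncation of an \<open>n\<close>-bracketing keeps the levels \<open>0, \<dots>, n - 1\<close>, that is, the brackets
  of length at most \<open>n\<close>.\<close>

definition truncate_bracketing :: "nat \<Rightarrow> 'v bracketing \<Rightarrow> 'v bracketing" where
  "truncate_bracketing n B = restrict_brs B {A. length A \<le> n}"


section \<open>Collisions\<close>

definition is_min_bracketing :: "'v plane_tree \<Rightarrow> 'v bracketing \<Rightarrow> bool" where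
  "is_min_bracketing T B \<longleftrightarrow> B \<in> associahedron T \<and> (\<forall>B' \<in> associahedron T. bk_le B B')"

definition collision :: "'v plane_tree \<Rightarrow> 'v bracketing \<Rightarrow> bool" where
  "collision T C \<longleftrightarrow> C \<in> associahedron T \<and> \<not> is_min_bracketing T C \<and>
     (\<forall>B \<in> associahedron T. \<not> is_min_bracketing T B \<and> bk_le B C \<longrightarrow> B = C)"

definition below_nontrivial :: "'v plane_tree \<Rightarrow> 'v bracketing \<Rightarrow> 'v bracket \<Rightarrow> bool" where
  "below_nontrivial T C E \<longleftrightarrow> (\<exists>A' \<in> brs C. nontrivial T A' \<and> (\<exists>l. E = (butlast ^^ l) A'))"

definition is_fusion_bracket :: "'v plane_tree \<Rightarrow> 'v bracketing \<Rightarrow> 'v bracket \<Rightarrow> bool" where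
  "is_fusion_bracket T C E \<longleftrightarrow> E \<in> brs C \<and> \<not> is_singleton_bracket T E \<and>
     is_singleton_bracket T (butlast E) \<and> below_nontrivial T C E"

definition fusion_bracket :: "'v plane_tree \<Rightarrow> 'v bracketing \<Rightarrow> 'v bracket" where
  "fusion_bracket T C = (THE E. is_fusion_bracket T C E)"

definition essentials :: "'v plane_tree \<Rightarrow> 'v bracketing \<Rightarrow> 'v bracket set" where
  "essentials T C = {E \<in> brs C. below_nontrivial T C E \<and>
     (\<exists>j. (butlast ^^ j) E = fusion_bracket T C)}"


section \<open>The contracted tree\<close>

definition fused_children :: "'v plane_tree \<Rightarrow> 'v bracketing \<Rightarrow> 'v set" where
  "fused_children T C = last (fusion_bracket T C)"

definition fused_parent :: "'v plane_tree \<Rightarrow> 'v bracketing \<Rightarrow> 'v" where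
  "fused_parent T C = the_elem (last (butlast (fusion_bracket T C)))"

definition removed :: "'v plane_tree \<Rightarrow> 'v bracketing \<Rightarrow> 'v set" where
  "removed T C = {v. \<exists>x \<in> fused_children T C. (x, v) \<in> (arcs T)\<^sup>*}"

text \<open>\<open>Inl u\<close> is a remaining vertex \<open>u\<close> of \<open>T\<close> and \<open>Inr E\<close> is the new vertex \<open>v\<^sub>E\<close>. As the fused
  children \<open>W\<close> are consecutive, \<open>x \<notin> W\<close> precedes one element of \<open>W\<close> iff it precedes all.\<close>

definition contract_sib ::
    "'v plane_tree \<Rightarrow> 'v bracketing \<Rightarrow> 'v + 'v bracket \<Rightarrow> ('v + 'v bracket) rel" where
  "contract_sib T C p = (case p of
      Inl u \<Rightarrow>
        {(Inl x, Inl y) | x y. (x, y) \<in> sib T u \<and> x \<notin> removed T C \<and> y \<notin> removed T C} \<union>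
        (if u = fused_parent T C then
           {(Inl x, Inr (fusion_bracket T C)) | x.
              x \<notin> removed T C \<and> (\<exists>z \<in> fused_children T C. (x, z) \<in> sib T u)} \<union>
           {(Inr (fusion_bracket T C), Inl y) | y.
              y \<notin> removed T C \<and> (\<exists>z \<in> fused_children T C. (z, y) \<in> sib T u)}
         else {})
    | Inr E \<Rightarrow>
        {(Inr E1, Inr E2) | E1 E2. E1 \<in> essentials T C \<and> E2 \<in> essentials T C \<and>
           butlast E1 = E \<and> butlast E2 = E \<and> (E1, E2) \<in> less_rel C})"

definition contract_tree ::
    "'v plane_tree \<Rightarrow> 'v bracketing \<Rightarrow> ('v + 'v bracket) plane_tree" where
  "contract_tree T C =
     \<lparr>verts = Inl ` (verts T - removed T C) \<union> Inr ` essentials T C,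
      root = Inl (root T),
      arcs = {(Inl u, Inl v) | u v. (u, v) \<in> arcs T \<and> u \<notin> removed T C \<and> v \<notin> removed T C} \<union>
             {(Inl (fused_parent T C), Inr (fusion_bracket T C))} \<union>
             {(Inr E, Inr E') | E E'. E \<in> essentials T C \<and> E' \<in> essentials T C \<and> butlast E' = E},
      sib = contract_sib T C\<rparr>"


section \<open>The iterated fiber product\<close>

definition subtree :: "'v plane_tree \<Rightarrow> 'v bracket \<Rightarrow> 'v plane_tree" where
  "subtree T A = (let S = \<Union>(set A) in
     \<lparr>verts = S, root = root T, arcs = arcs T \<inter> S \<times> S, sib = (\<lambda>u. sib T u \<inter> S \<times> S)\<rparr>)"

text \<open>For an essential \<open>k\<close>-bracket \<open>A\<close> the tree \<open>T|\<^sub>A\<close> has depth \<open>k = length A - 1\<close>.\<close>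

definition fiber_product ::
    "'v plane_tree \<Rightarrow> 'v bracketing \<Rightarrow> ('v bracket \<Rightarrow> 'v bracketing) set" where
  "fiber_product T C =
     {F \<in> (\<Pi>\<^sub>E A \<in> essentials T C. associahedron (subtree T A)).
        \<forall>A \<in> essentials T C - {fusion_bracket T C}.
          truncate_bracketing (length A - 1) (F A) = F (butlast A)}"

definition fiber_product_le ::
    "'v plane_tree \<Rightarrow> 'v bracketing \<Rightarrow>
     ('v bracket \<Rightarrow> 'v bracketing) \<Rightarrow> ('v bracket \<Rightarrow> 'v bracketing) \<Rightarrow> bool" where
  "fiber_product_le T C F G \<longleftrightarrow> (\<forall>A \<in> essentials T C. bk_le (F A) (G A))"


section \<open>The facet and its canonical map\<close>

definition facet :: "'v plane_tree \<Rightarrow> 'v bracketing \<Rightarrow> 'v bracketing set" where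
  "facet T C = {B \<in> associahedron T. bk_le C B}"

text \<open>The first component of the canonical map: a bracket of \<open>T\<close> that contains each essential
  bracket of its own level which it meets induces a bracket of \<open>T/C\<close>, in which \<open>v\<^sub>E\<close> stands for the
  vertices of an essential \<open>E\<close>. The other brackets of a bracketing above \<open>C\<close> lie strictly
  inside an essential bracket and are recorded by the second component.\<close>

definition contractible :: "'v plane_tree \<Rightarrow> 'v bracketing \<Rightarrow> 'v bracket set" where
  "contractible T C = {A. \<forall>E \<in> essentials T C.
     length E = length A \<and> last E \<inter> last A \<noteq> {} \<longrightarrow> E \<sqsubseteq> A}"

definition contract_bracket ::
    "'v plane_tree \<Rightarrow> 'v bracketing \<Rightarrow> 'v bracket \<Rightarrow> ('v + 'v bracket) bracket" where
  "contract_bracket T C A = map (\<lambda>i.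
     Inl ` (A ! i - removed T C) \<union>
     Inr ` {E \<in> essentials T C. E \<sqsubseteq> take (Suc i) A}) [0..<length A]"

definition contract_bracketing ::
    "'v plane_tree \<Rightarrow> 'v bracketing \<Rightarrow> 'v bracketing \<Rightarrow> ('v + 'v bracket) bracketing" where
  "contract_bracketing T C B = (let B' = restrict_brs B (contractible T C) in
     \<lparr>brs = contract_bracket T C ` brs B',
      less_rel = map_prod (contract_bracket T C) (contract_bracket T C) ` less_rel B'\<rparr>)"

definition restrict_bracketing :: "'v bracketing \<Rightarrow> 'v bracket \<Rightarrow> 'v bracketing" where
  "restrict_bracketing B A = restrict_brs B {A'. \<exists>j. A' \<sqsubseteq> take j A}"

definition canonical_map ::
    "'v plane_tree \<Rightarrow> 'v bracketing \<Rightarrow> 'v bracketing \<Rightarrow>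
     ('v + 'v bracket) bracketing \<times> ('v bracket \<Rightarrow> 'v bracketing)" where
  "canonical_map T C B =
     (contract_bracketing T C B, \<lambda>A \<in> essentials T C. restrict_bracketing B A)"

definition prod_le ::
    "('a \<Rightarrow> 'a \<Rightarrow> bool) \<Rightarrow> ('b \<Rightarrow> 'b \<Rightarrow> bool) \<Rightarrow> 'a \<times> 'b \<Rightarrow> 'a \<times> 'b \<Rightarrow> bool" where
  "prod_le le1 le2 p q \<longleftrightarrow> le1 (fst p) (fst q) \<and> le2 (snd p) (snd q)"

definition poset_iso ::
    "'a set \<Rightarrow> ('a \<Rightarrow> 'a \<Rightarrow> bool) \<Rightarrow> 'b set \<Rightarrow> ('b \<Rightarrow> 'b \<Rightarrow> bool) \<Rightarrow> ('a \<Rightarrow> 'b) \<Rightarrow> bool" where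
  "poset_iso X leX Y leY f \<longleftrightarrow> bij_betw f X Y \<and>
     (\<forall>x \<in> X. \<forall>y \<in> X. leX x y \<longleftrightarrow> leY (f x) (f y))"

end

theory Submission
  imports Defs
begin

text \<open>By minimality, the essential brackets of a collision \<open>C\<close> form the tower of minimal brackets over
  its fusion bracket, and every other bracket of \<open>C\<close> is trivial. The essential brackets of one level
  are disjoint, so sending the vertices of \<open>last E\<close> to \<open>v\<^sub>E\<close> and fixing the others is a surjection
  \<open>\<rho>\<close> from \<open>T\<close> to \<open>T/C\<close> that respects levels, parents and, weakly, the order of siblings. A
  bracketing above \<open>C\<close> is one that contains the preimages under \<open>\<rho>\<close> of all singleton brackets of
  \<open>T/C\<close>, ordered as in \<open>T/C\<close>. Because brackets are nested or disjoint, each of its brackets is either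
  the full preimage of a bracket of \<open>T/C\<close> or lies inside the preimage of a singleton bracket, that
  is, inside an essential bracket. The former make up a bracketing of \<open>T/C\<close>, the latter a family of
  bracketings of the trees \<open>T|\<^sub>E\<close>. Conversely such data are glued by taking preimages and ordering
  brackets lexicographically: first by their image in \<open>T/C\<close>, then inside the common \<open>E\<close>.\<close>

text \<open>The argument is carried out for an arbitrary surjection \<open>\<rho>\<close> between
  trees, and collisions enter only through the shape of its fibers. The delicate point is the order.
  Two disjoint brackets over a common truncation may have images that meet; both must then be shown
  to lie inside a single fiber, since otherwise neither factor would record how they compare. A
  second obstacle is that the fiber product sees only essential brackets, whereas gluing wants a
  compatible family over all vertices of T/C. The remaining fibers are singleton brackets, whose
  subtrees are paths with exactly one bracketing, so the family extends in a unique way. The same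
  rigidity explains why no compatibility is demanded at the fusion bracket: its truncation is a
  singleton bracket. Finally, consecutiveness would be awkward to transport along
  \<open>\<rho>\<close>; deriving it from the order axioms keeps it out of all
  constructions.\<close>

lemma bsub_iff: "A \<sqsubseteq> A' \<longleftrightarrow> length A = length A' \<and> (\<forall>i < length A. A ! i \<subseteq> A' ! i)"
  by (simp add: bsub_def list_all2_conv_all_nth)

lemma bsub_refl [simp]: "A \<sqsubseteq> A"
  by (simp add: bsub_iff)

lemma bsub_trans [trans]: "A \<sqsubseteq> A' \<Longrightarrow> A' \<sqsubseteq> A'' \<Longrightarrow> A \<sqsubseteq> A''"
  unfolding bsub_def by (rule list_all2_trans[OF subset_trans])

lemma bsub_antisym: "A \<sqsubseteq> A' \<Longrightarrow> A' \<sqsubseteq> A \<Longrightarrow> A = A'"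
  by (auto simp: bsub_iff intro!: nth_equalityI)

lemma bsub_length: "A \<sqsubseteq> A' \<Longrightarrow> length A = length A'"
  by (simp add: bsub_iff)

lemma bsub_snoc [simp]: "A @ [S] \<sqsubseteq> A' @ [S'] \<longleftrightarrow> A \<sqsubseteq> A' \<and> S \<subseteq> S'"
  unfolding bsub_iff by (force simp: nth_append less_Suc_eq)

lemma bsub_butlast: "A \<sqsubseteq> A' \<Longrightarrow> butlast A \<sqsubseteq> butlast A'"
  by (auto simp: bsub_iff nth_butlast)

lemma bsub_last: "A \<sqsubseteq> A' \<Longrightarrow> A \<noteq> [] \<Longrightarrow> last A \<subseteq> last A'"
  by (cases A rule: rev_cases; cases A' rule: rev_cases) (auto dest: bsub_length)

text \<open>Brackets over the same truncation differ only in their last entry, so strictness must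
  show there. This makes the size of \<open>last A\<close> a measure for descending among such
  brackets.\<close>

lemma bpsub_last:
  assumes "A \<sqsubset> A'" "butlast A = butlast A'" "A \<noteq> []"
  shows "last A \<subset> last A'"
proof -
  have "A' \<noteq> []" using assms by (auto simp: bpsub_def bsub_iff)
  then have "last A \<noteq> last A'"
    using assms by (metis append_butlast_last_id bpsub_def)
  then show ?thesis using assms bsub_last by (auto simp: bpsub_def)
qed

lemma bsub_over:
  assumes "butlast A = butlast A'" "A \<noteq> []" "A' \<noteq> []" "last A \<subseteq> last A'"
  shows "A \<sqsubseteq> A'"
  using assms by (metis append_butlast_last_id bsub_refl bsub_snoc)


section \<open>Levels and brackets of plane trees\<close>

lemma level_0 [simp]: "level T 0 = {root T}"
  by (auto simp: level_def)

lemma level_Suc: "level T (Suc k) = (\<Union>u \<in> level T k. ch T u)"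
  by (auto simp: level_def ch_def)

lemma level_SucI: "u \<in> level T k \<Longrightarrow> v \<in> ch T u \<Longrightarrow> v \<in> level T (Suc k)"
  by (auto simp: level_Suc)

text \<open>Brackets without the condition that siblings are consecutive.\<close>

inductive pre_bracket :: "'v plane_tree \<Rightarrow> 'v bracket \<Rightarrow> bool" for T where
  root: "pre_bracket T [{root T}]"
| snoc: "pre_bracket T A \<Longrightarrow> S \<noteq> {} \<Longrightarrow> S \<subseteq> (\<Union>u \<in> last A. ch T u) \<Longrightarrow> pre_bracket T (A @ [S])"

lemma pre_bracket_nonempty: "pre_bracket T A \<Longrightarrow> A \<noteq> []"
  by (induction rule: pre_bracket.induct) auto

lemma not_pre_bracket_Nil [simp]: "\<not> pre_bracket T []"
  using pre_bracket_nonempty by blast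

lemma pre_bracket_last: "pre_bracket T A \<Longrightarrow> last A \<noteq> {}"
  by (induction rule: pre_bracket.induct) auto

lemma pre_bracket_singleton_iff: "pre_bracket T [S] \<longleftrightarrow> S = {root T}"
  by (auto intro: pre_bracket.root elim: pre_bracket.cases)

lemma pre_bracket_length1: "pre_bracket T A \<Longrightarrow> length A = Suc 0 \<Longrightarrow> A = [{root T}]"
  by (cases A) (auto simp: pre_bracket_singleton_iff)

lemma pre_bracket_snoc_iff:
  "A \<noteq> [] \<Longrightarrow> pre_bracket T (A @ [S]) \<longleftrightarrow>
     pre_bracket T A \<and> S \<noteq> {} \<and> S \<subseteq> (\<Union>u \<in> last A. ch T u)"
  by (auto intro: pre_bracket.snoc elim: pre_bracket.cases)

lemma pre_bracket_butlast: "pre_bracket T A \<Longrightarrow> butlast A \<noteq> [] \<Longrightarrow> pre_bracket T (butlast A)"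
  by (cases A rule: rev_cases) (auto simp: pre_bracket_snoc_iff)

lemma pre_bracket_parent:
  assumes "pre_bracket T A" "butlast A \<noteq> []" "v \<in> last A"
  obtains u where "u \<in> last (butlast A)" "v \<in> ch T u"
  using assms by (cases A rule: rev_cases) (auto simp: pre_bracket_snoc_iff)

lemma pre_bracket_nth:
  "pre_bracket T A \<Longrightarrow> i < length A \<Longrightarrow> A ! i \<subseteq> level T i \<and> A ! i \<noteq> {}"
proof (induction arbitrary: i rule: pre_bracket.induct)
  case (snoc A S)
  show ?case
  proof (cases "i = length A")
    case True
    have "last A \<subseteq> level T (length A - 1)"
      using snoc.IH[of "length A - 1"] pre_bracket_nonempty[OF snoc.hyps(1)]
      by (simp add: last_conv_nth)
    moreover have "Suc (length A - 1) = length A"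
      using pre_bracket_nonempty[OF snoc.hyps(1)] by simp
    ultimately have "S \<subseteq> level T (length A)"
      using snoc.hyps(3) level_SucI[of _ T "length A - 1"] by fastforce
    then show ?thesis using True snoc.hyps by auto
  next
    case False
    then show ?thesis using snoc by (auto simp: nth_append)
  qed
qed auto

lemma pre_bracket_last_level: "pre_bracket T A \<Longrightarrow> last A \<subseteq> level T (length A - 1)"
  using pre_bracket_nth[of T A "length A - 1"] pre_bracket_nonempty[of T A]
  by (simp add: last_conv_nth)

text \<open>Nonemptiness is demanded of the last entry alone: each vertex has its parent in the
  preceding entry, so nonemptiness propagates towards the root.\<close>

lemma pre_bracket_iff:
  "pre_bracket T A \<longleftrightarrow> A \<noteq> [] \<and> last A \<noteq> {} \<and> (\<forall>i < length A. A ! i \<subseteq> level T i) \<and>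
     (\<forall>i. Suc i < length A \<longrightarrow> A ! Suc i \<subseteq> (\<Union>u \<in> A ! i. ch T u))" (is "_ \<longleftrightarrow> ?R A")
proof
  assume "pre_bracket T A"
  then show "?R A"
  proof (induction rule: pre_bracket.induct)
    case (snoc A S)
    have A: "A \<noteq> []" using snoc.IH by simp
    have "(A @ [S]) ! i \<subseteq> level T i" if "i < length (A @ [S])" for i
      using pre_bracket_nth[OF pre_bracket.snoc[OF snoc.hyps] that] by simp
    moreover have "(A @ [S]) ! Suc i \<subseteq> (\<Union>u \<in> (A @ [S]) ! i. ch T u)"
      if "Suc i < length (A @ [S])" for i
    proof (cases "Suc i = length A")
      case True
      then have "last A = A ! i" using A by (metis diff_Suc_1 last_conv_nth)
      then show ?thesis using True snoc.hyps by (simp add: nth_append)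
    qed (use that snoc.IH in \<open>auto simp: nth_append\<close>)
    ultimately show ?case using snoc.hyps by simp
  qed auto
next
  assume "?R A"
  then show "pre_bracket T A"
  proof (induction A rule: rev_induct)
    case (snoc S A)
    show ?case
    proof (cases "A = []")
      case True
      then show ?thesis using snoc.prems by (auto simp: pre_bracket_singleton_iff)
    next
      case False
      have step: "(A @ [S]) ! Suc i \<subseteq> (\<Union>u \<in> (A @ [S]) ! i. ch T u)"
        if "Suc i < length (A @ [S])" for i
        using snoc.prems that by blast
      have S: "S \<subseteq> (\<Union>u \<in> last A. ch T u)"
        using step[of "length A - 1"] False by (simp add: nth_append last_conv_nth)
      then have "last A \<noteq> {}" using snoc.prems by fastforce
      moreover have "A ! i \<subseteq> level T i" if "i < length A" for i
        using snoc.prems that by (metis length_append_singleton less_SucI nth_append)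
      moreover have "A ! Suc i \<subseteq> (\<Union>u \<in> A ! i. ch T u)" if "Suc i < length A" for i
        using step[of i] that by (simp add: nth_append)
      ultimately have "pre_bracket T A" using snoc.IH False by blast
      then show ?thesis using S snoc.prems by (intro pre_bracket.snoc) auto
    qed
  qed simp
qed

lemma pre_bracket_step:
  "pre_bracket T A \<Longrightarrow> Suc i < length A \<Longrightarrow> A ! Suc i \<subseteq> (\<Union>u \<in> A ! i. ch T u)"
  by (simp only: pre_bracket_iff)

text \<open>Chosen so that it can be verified directly both for the subtrees T|_E and for the
  contracted tree. The relation \<open>sib\<close> is constrained only at vertices on some level,
  its values elsewhere being arbitrary.\<close>

locale ptree =
  fixes T :: "'v plane_tree"
  assumes finite_arcs: "finite (arcs T)"
    and root_no_parent: "root T \<notin> ch T u"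
    and parent_unique: "v \<in> ch T u \<Longrightarrow> v \<in> ch T u' \<Longrightarrow> u = u'"
    and sib_ch: "u \<in> level T k \<Longrightarrow> sib T u \<subseteq> ch T u \<times> ch T u"
begin

lemma level_unique: "v \<in> level T k \<Longrightarrow> v \<in> level T j \<Longrightarrow> k = j"
proof (induction k arbitrary: v j)
  case 0
  then show ?case using root_no_parent by (cases j) (auto simp: level_Suc)
next
  case (Suc k)
  then obtain u where u: "u \<in> level T k" "v \<in> ch T u" by (auto simp: level_Suc)
  show ?case
  proof (cases j)
    case 0
    then show ?thesis using Suc.prems u(2) root_no_parent by simp
  next
    case (Suc j')
    then obtain u' where u': "u' \<in> level T j'" "v \<in> ch T u'"
      using \<open>v \<in> level T j\<close> by (auto simp: level_Suc)
    have "u = u'" using u(2) u'(2) by (rule parent_unique)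
    then have "k = j'" using Suc.IH[OF u(1)] u'(1) by blast
    then show ?thesis using Suc by simp
  qed
qed

lemma ch_level: "u \<in> level T k \<Longrightarrow> v \<in> ch T u \<Longrightarrow> v \<in> level T j \<Longrightarrow> j = Suc k"
  by (rule level_unique[of v]) (auto intro: level_SucI)

lemma level_subset: "level T k \<subseteq> insert (root T) (snd ` arcs T)"
proof
  fix v
  assume "v \<in> level T k"
  then have "v = root T \<or> (\<exists>u. (u, v) \<in> arcs T)"
    by (cases k) (auto simp: level_Suc ch_def)
  then show "v \<in> insert (root T) (snd ` arcs T)" by force
qed

lemma finite_level: "finite (level T k)"
  using level_subset finite_arcs by (meson finite_imageI finite_insert finite_subset)

text \<open>A vertex determines its level, and apart from the root every vertex on a level is the
  target of one of finitely many arcs. This gives sense to the \<open>Max\<close> in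
  \<open>depth\<close>.\<close>

lemma finite_nonempty_levels: "finite {k. level T k \<noteq> {}}"
proof -
  define f where "f v = (THE k. v \<in> level T k)" for v
  have "f v = k" if "v \<in> level T k" for v k
    unfolding f_def using that by (rule the_equality) (rule level_unique[OF _ that])
  then have "{k. level T k \<noteq> {}} \<subseteq> f ` insert (root T) (snd ` arcs T)"
    using level_subset by (force simp: image_iff simp del: insert_iff)
  then show ?thesis using finite_arcs by (meson finite_imageI finite_insert finite_subset)
qed

lemma level_nonempty_le: "level T k \<noteq> {} \<Longrightarrow> j \<le> k \<Longrightarrow> level T j \<noteq> {}"
proof (induction k)
  case (Suc k)
  then have "level T k \<noteq> {}" by (auto simp: level_Suc)
  then show ?case using Suc by (cases "j = Suc k") auto
qed simp

lemma level_nonempty_iff: "level T k \<noteq> {} \<longleftrightarrow> k \<le> depth T"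
proof
  assume "level T k \<noteq> {}"
  then show "k \<le> depth T" unfolding depth_def using finite_nonempty_levels by (simp add: Max_ge)
next
  assume k: "k \<le> depth T"
  have "0 \<in> {k. level T k \<noteq> {}}" by simp
  then have "depth T \<in> {k. level T k \<noteq> {}}"
    unfolding depth_def using finite_nonempty_levels by (intro Max_in) blast+
  then show "level T k \<noteq> {}" using k level_nonempty_le by blast
qed

lemma level_le_depth: "u \<in> level T k \<Longrightarrow> k \<le> depth T"
  using level_nonempty_iff by blast

lemma descendant_level: "(u, v) \<in> (arcs T)\<^sup>* \<Longrightarrow> u \<in> level T i \<Longrightarrow> \<exists>j \<ge> i. v \<in> level T j"
proof (induction rule: rtrancl_induct)
  case (step y z)
  then obtain j where "j \<ge> i" "y \<in> level T j" by blast
  then show ?case using step.hyps level_SucI[of y T j z] by (intro exI[of _ "Suc j"]) (auto simp: ch_def)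
qed blast

section \<open>Singleton and maximum brackets\<close>

lemma singleton_root [simp]: "singleton_bracket T 0 (root T) = [{root T}]"
  by (auto simp: singleton_bracket_def)

text \<open>As parents are unique, the ancestors of \<open>v\<close> are \<open>v\<close> itself and
  those of its parent. This recursion stands in for reachability in the inductions below.\<close>

lemma singleton_Suc:
  assumes u: "u \<in> level T k" and v: "v \<in> ch T u"
  shows "singleton_bracket T (Suc k) v = singleton_bracket T k u @ [{v}]"
proof -
  have vk: "v \<in> level T (Suc k)" using u v by (rule level_SucI)
  have anc: "(x, v) \<in> (arcs T)\<^sup>* \<longleftrightarrow> x = v \<or> (x, u) \<in> (arcs T)\<^sup>*" for x
  proof
    assume "(x, v) \<in> (arcs T)\<^sup>*"
    then show "x = v \<or> (x, u) \<in> (arcs T)\<^sup>*"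
    proof (cases rule: rtranclE)
      case (step y)
      then have "y = u" using v by (intro parent_unique[of v]) (auto simp: ch_def)
      then show ?thesis using step by simp
    qed simp
  qed (use v in \<open>auto simp: ch_def intro: rtrancl_into_rtrancl\<close>)
  have "{x \<in> level T i. (x, v) \<in> (arcs T)\<^sup>*} = {x \<in> level T i. (x, u) \<in> (arcs T)\<^sup>*}"
    if "i \<le> k" for i
  proof -
    have "v \<notin> level T i" using level_unique[OF vk] that by fastforce
    then show ?thesis by (auto simp: anc)
  qed
  moreover have "{x \<in> level T (Suc k). (x, v) \<in> (arcs T)\<^sup>*} = {v}"
  proof -
    have "(x, u) \<notin> (arcs T)\<^sup>*" if x: "x \<in> level T (Suc k)" for x
    proof
      assume "(x, u) \<in> (arcs T)\<^sup>*"
      then obtain j where "j \<ge> Suc k" "u \<in> level T j" using descendant_level x by blast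
      then show False using level_unique[OF u] by fastforce
    qed
    then show ?thesis using anc vk by blast
  qed
  ultimately show ?thesis by (auto simp: singleton_bracket_def)
qed

lemma length_singleton [simp]: "length (singleton_bracket T k u) = Suc k"
  by (simp add: singleton_bracket_def)

lemma length_max [simp]: "length (max_bracket T k) = Suc k"
  by (simp add: max_bracket_def)

lemma last_singleton: "u \<in> level T k \<Longrightarrow> last (singleton_bracket T k u) = {u}"
  by (cases k) (auto simp: level_Suc singleton_Suc)

lemma butlast_singleton:
  "u \<in> level T k \<Longrightarrow> v \<in> ch T u \<Longrightarrow> butlast (singleton_bracket T (Suc k) v) = singleton_bracket T k u"
  by (simp add: singleton_Suc)

lemma singleton_pre_bracket: "u \<in> level T k \<Longrightarrow> pre_bracket T (singleton_bracket T k u)"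
proof (induction k arbitrary: u)
  case 0
  then show ?case by (simp add: pre_bracket.root)
next
  case (Suc k)
  then obtain p where "p \<in> level T k" "u \<in> ch T p" by (auto simp: level_Suc)
  then show ?case
    using Suc.IH by (auto simp: singleton_Suc last_singleton intro!: pre_bracket.snoc)
qed

lemma max_0 [simp]: "max_bracket T 0 = [{root T}]"
  by (simp add: max_bracket_def)

lemma max_Suc: "max_bracket T (Suc k) = max_bracket T k @ [level T (Suc k)]"
  by (simp add: max_bracket_def)

lemma last_max [simp]: "last (max_bracket T k) = level T k"
  by (simp add: max_bracket_def)

lemma butlast_max [simp]: "butlast (max_bracket T (Suc k)) = max_bracket T k"
  by (simp add: max_Suc)

lemma max_pre_bracket: "level T k \<noteq> {} \<Longrightarrow> pre_bracket T (max_bracket T k)"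
proof (induction k)
  case (Suc k)
  then have "level T k \<noteq> {}" using level_nonempty_le by (metis le_SucI order_refl)
  then show ?case using Suc by (auto simp: max_Suc level_Suc intro!: pre_bracket.snoc)
qed (simp add: pre_bracket.root)

lemma bsub_max: "pre_bracket T A \<Longrightarrow> A \<sqsubseteq> max_bracket T (length A - 1)"
  using pre_bracket_nth[of T A] pre_bracket_nonempty[of T A]
  by (auto simp: bsub_iff max_bracket_def simp del: upt_Suc)

lemma singleton_bsub:
  "pre_bracket T A \<Longrightarrow> u \<in> last A \<Longrightarrow> singleton_bracket T (length A - 1) u \<sqsubseteq> A"
proof (induction arbitrary: u rule: pre_bracket.induct)
  case (snoc A S)
  then obtain p where p: "p \<in> last A" "u \<in> ch T p" by auto
  have "p \<in> level T (length A - 1)" using p pre_bracket_last_level snoc.hyps(1) by blast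
  then have "singleton_bracket T (Suc (length A - 1)) u = singleton_bracket T (length A - 1) p @ [{u}]"
    using p by (simp add: singleton_Suc)
  moreover have "A \<noteq> []" using snoc.hyps(1) pre_bracket_nonempty by blast
  ultimately show ?case using snoc.IH[OF p(1)] snoc.prems by simp
qed auto

text \<open>A singleton bracket has one vertex per level and entries of brackets are nonempty, so
  there is no room below it. Applied in the target of a surjection, this pins down the image of
  every bracket inside a fiber.\<close>

lemma bsub_singleton:
  "pre_bracket T A \<Longrightarrow> u \<in> level T k \<Longrightarrow> A \<sqsubseteq> singleton_bracket T k u \<Longrightarrow> A = singleton_bracket T k u"
proof (induction arbitrary: u k rule: pre_bracket.induct)
  case root
  then have "k = 0" by (auto dest!: bsub_length)
  with root show ?case by auto
next
  case (snoc A S)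
  obtain k' where k': "k = Suc k'"
    using bsub_length[OF snoc.prems(2)] pre_bracket_nonempty[OF snoc.hyps(1)] by (cases k) auto
  then obtain p where p: "p \<in> level T k'" "u \<in> ch T p" using snoc.prems by (auto simp: level_Suc)
  have "A \<sqsubseteq> singleton_bracket T k' p" "S \<subseteq> {u}"
    using snoc.prems(2) p by (simp_all add: k' singleton_Suc)
  then show ?case using snoc.IH[OF p(1)] snoc.hyps(2) p by (auto simp: k' singleton_Suc)
qed

end

section \<open>Bracketings\<close>

text \<open>An equivalent form of \<open>is_bracketing\<close>, see \<open>is_bracketing_iff\<close>. That brackets are consecutive is
  not assumed, since it follows from the order axioms; and in \<open>less_mono\<close>, which is (5c), the
  comparability of the smaller brackets is automatic by (5a).\<close>

locale bracketing = ptree T for T :: "'v plane_tree" +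
  fixes B :: "'v bracketing"
  assumes pre_bracket: "A \<in> brs B \<Longrightarrow> pre_bracket T A"
    and less_brs: "less_rel B \<subseteq> brs B \<times> brs B"
    and less_irrefl: "(A, A) \<notin> less_rel B"
    and less_trans: "(A1, A2) \<in> less_rel B \<Longrightarrow> (A2, A3) \<in> less_rel B \<Longrightarrow> (A1, A3) \<in> less_rel B"
    and max_brs: "level T k \<noteq> {} \<Longrightarrow> max_bracket T k \<in> brs B"
    and singleton_brs: "u \<in> level T k \<Longrightarrow> singleton_bracket T k u \<in> brs B"
    and butlast_brs: "A \<in> brs B \<Longrightarrow> butlast A \<noteq> [] \<Longrightarrow> butlast A \<in> brs B"
    and nested: "A1 \<in> brs B \<Longrightarrow> A2 \<in> brs B \<Longrightarrow> length A1 = length A2 \<Longrightarrow>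
      last A1 \<inter> last A2 \<noteq> {} \<Longrightarrow> A1 \<sqsubseteq> A2 \<or> A2 \<sqsubseteq> A1"
    and cover: "A \<in> brs B \<Longrightarrow> u \<in> last A \<Longrightarrow> v \<in> ch T u \<Longrightarrow>
      \<exists>A' \<in> brs B. butlast A' = A \<and> v \<in> last A'"
    and refine: "A1 \<in> brs B \<Longrightarrow> A2 \<in> brs B \<Longrightarrow> butlast A2 = butlast A1 \<Longrightarrow> A2 \<sqsubset> A1 \<Longrightarrow>
      v \<in> last A1 \<Longrightarrow> \<exists>A3 \<in> brs B. butlast A3 = butlast A1 \<and> A3 \<sqsubset> A1 \<and> v \<in> last A3"
    and less_over: "(A1, A2) \<in> less_rel B \<Longrightarrow> butlast A1 = butlast A2 \<and> last A1 \<inter> last A2 = {}"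
    and less_total: "A1 \<in> brs B \<Longrightarrow> A2 \<in> brs B \<Longrightarrow> butlast A1 = butlast A2 \<Longrightarrow>
      last A1 \<inter> last A2 = {} \<Longrightarrow> (A1, A2) \<in> less_rel B \<or> (A2, A1) \<in> less_rel B"
    and less_sib: "u \<in> level T k \<Longrightarrow> (u1, u2) \<in> sib T u \<Longrightarrow>
      (singleton_bracket T (Suc k) u1, singleton_bracket T (Suc k) u2) \<in> less_rel B"
    and less_mono: "(A1, A2) \<in> less_rel B \<Longrightarrow> A1' \<in> brs B \<Longrightarrow> A2' \<in> brs B \<Longrightarrow>
      butlast A1' = butlast A2' \<Longrightarrow> A1' \<sqsubseteq> A1 \<Longrightarrow> A2' \<sqsubseteq> A2 \<Longrightarrow> (A1', A2') \<in> less_rel B"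
begin

lemma brs_nonempty: "A \<in> brs B \<Longrightarrow> A \<noteq> []"
  using pre_bracket pre_bracket_nonempty by blast

lemma take_brs: "A \<in> brs B \<Longrightarrow> 0 < j \<Longrightarrow> take j A \<in> brs B"
proof (induction "length A - j" arbitrary: A)
  case (Suc d)
  then have "butlast A \<noteq> []" by (cases A rule: rev_cases) auto
  then have "butlast A \<in> brs B" using Suc by (intro butlast_brs)
  moreover have "take j (butlast A) = take j A"
    using Suc.hyps(2) by (simp add: take_butlast)
  ultimately show ?case using Suc.hyps(1)[of "butlast A"] Suc.hyps(2) Suc.prems by simp
qed simp

lemma less_asym: "(A1, A2) \<in> less_rel B \<Longrightarrow> (A2, A1) \<notin> less_rel B"
  using less_trans less_irrefl by blast

text \<open>The axiom \<open>refine\<close> shrinks any nonminimal bracket while keeping the chosen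
  vertex, so a bracket over \<open>A\<close> through \<open>v\<close> whose last entry has fewest
  vertices is minimal.\<close>

lemma minimal_over:
  assumes A: "A \<in> brs B" "u \<in> last A" "v \<in> ch T u"
  obtains A' where "A' \<in> brs B" "butlast A' = A" "v \<in> last A'"
    "\<And>A''. A'' \<in> brs B \<Longrightarrow> butlast A'' = A \<Longrightarrow> A'' \<sqsubseteq> A' \<Longrightarrow> A'' = A'"
proof -
  define P where "P A' \<longleftrightarrow> A' \<in> brs B \<and> butlast A' = A \<and> v \<in> last A'" for A'
  obtain A0 where "P A0" using cover[OF A] P_def by blast
  then obtain A' where A': "P A'" and least: "\<And>A''. P A'' \<Longrightarrow> card (last A') \<le> card (last A'')"
    using ex_has_least_nat[of P A0 "\<lambda>A. card (last A)"] by blast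
  show thesis
  proof
    show "A' \<in> brs B" "butlast A' = A" "v \<in> last A'" using A' P_def by auto
    fix A''
    assume A'': "A'' \<in> brs B" "butlast A'' = A" "A'' \<sqsubseteq> A'"
    show "A'' = A'"
    proof (rule ccontr)
      assume "A'' \<noteq> A'"
      then obtain A3 where A3: "A3 \<in> brs B" "butlast A3 = A" "A3 \<sqsubset> A'" "v \<in> last A3"
        using refine[of A' A'' v] A' A'' by (auto simp: P_def bpsub_def)
      then have "last A3 \<subset> last A'" using A' brs_nonempty by (intro bpsub_last) (auto simp: P_def)
      moreover have "finite (last A')"
        using A' pre_bracket pre_bracket_last_level finite_level finite_subset unfolding P_def by metis
      ultimately have "card (last A3) < card (last A')" by (rule psubset_card_mono[rotated])
      moreover have "P A3" using A3 P_def by blast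
      ultimately show False using least by fastforce
    qed
  qed
qed

lemma consecutive_brs:
  assumes A: "A \<in> brs B" "butlast A \<noteq> []" and u: "u \<in> last (butlast A)"
  shows "consecutive T u (last A \<inter> ch T u)"
  unfolding consecutive_def
proof (intro conjI ballI impI)
  define k where "k = length (butlast A) - 1"
  have P: "butlast A \<in> brs B" using A by (rule butlast_brs)
  have uk: "u \<in> level T k" unfolding k_def using P u pre_bracket pre_bracket_last_level by blast
  have len: "length A = Suc (Suc k)" using A(2) unfolding k_def by (cases A rule: rev_cases) auto
  fix x y z
  assume x: "x \<in> last A \<inter> ch T u" and z: "z \<in> last A \<inter> ch T u" and y: "y \<in> ch T u"
    and xyz: "(x, y) \<in> sib T u \<and> (y, z) \<in> sib T u"
  let ?s = "singleton_bracket T (Suc k)"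
  have brs: "?s x \<in> brs B" "?s y \<in> brs B" "?s z \<in> brs B"
    using x y z level_SucI[OF uk] singleton_brs by blast+
  have over: "butlast (?s x) = butlast (?s y)" "butlast (?s z) = butlast (?s y)"
    using x y z uk by (simp_all add: butlast_singleton)
  have less: "(?s x, ?s y) \<in> less_rel B" "(?s y, ?s z) \<in> less_rel B"
    using xyz less_sib uk by blast+
  have sub: "?s w \<sqsubseteq> A'" if "A' \<in> brs B" "w \<in> last A'" "butlast A' = butlast A" for A' w
  proof -
    have "length A' = length A"
      using that(1,3) A brs_nonempty by (metis append_butlast_last_id length_append_singleton)
    then show ?thesis using singleton_bsub[OF pre_bracket[OF that(1)] that(2)] len by simp
  qed
  \<comment> \<open>A minimal bracket \<open>A'\<close> through \<open>y\<close> beside \<open>A\<close> would have to be comparable to \<open>A\<close>, against the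
     order of \<open>x\<close>, \<open>y\<close> and \<open>z\<close>.\<close>
  obtain A' where A': "A' \<in> brs B" "butlast A' = butlast A" "y \<in> last A'"
    "\<And>A''. A'' \<in> brs B \<Longrightarrow> butlast A'' = butlast A \<Longrightarrow> A'' \<sqsubseteq> A' \<Longrightarrow> A'' = A'"
    using minimal_over[OF P u y] by blast
  have "length A' = length A"
    using A' A brs_nonempty by (metis append_butlast_last_id length_append_singleton)
  have "last A \<inter> last A' \<noteq> {}"
  proof
    assume "last A \<inter> last A' = {}"
    then consider "(A, A') \<in> less_rel B" | "(A', A) \<in> less_rel B"
      using less_total A A' by metis
    then show False
    proof cases
      case 1
      then have "(?s z, ?s y) \<in> less_rel B"
        using less_mono[OF 1] brs over sub A A' z by simp
      then show False using less less_asym by blast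
    next
      case 2
      then have "(?s y, ?s x) \<in> less_rel B"
        using less_mono[OF 2] brs over sub A A' x by simp
      then show False using less less_asym by blast
    qed
  qed
  then have "A \<sqsubseteq> A' \<or> A' \<sqsubseteq> A" using nested[OF A(1) A'(1)] \<open>length A' = length A\<close> by simp
  then have "A' \<sqsubseteq> A" using A' A by auto
  then show "y \<in> last A \<inter> ch T u" using bsub_last[OF _ brs_nonempty[OF A'(1)]] A'(3) y by blast
qed blast

lemma is_bracket:
  assumes A: "A \<in> brs B" and len: "length A = Suc k"
  shows "is_bracket T k A"
  unfolding is_bracket_def
proof (intro conjI ballI allI impI)
  have pre: "pre_bracket T A" using A by (rule pre_bracket)
  show "length A = Suc k" by (fact len)
  show "A ! i \<subseteq> level T i" if "i \<le> k" for i using pre_bracket_nth[OF pre] that len by simp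
  show "A ! k \<noteq> {}" using pre_bracket_nth[OF pre] len by simp
  fix i
  assume i: "i \<in> {1..k}"
  show "\<exists>v \<in> A ! (i - 1). u \<in> ch T v" if "u \<in> A ! i" for u
  proof -
    obtain i' where "i = Suc i'" using i by (cases i) auto
    then have "u \<in> (\<Union>v \<in> A ! i'. ch T v)"
      using pre_bracket_step[OF pre, of i'] i len that by auto
    then show ?thesis using \<open>i = Suc i'\<close> by auto
  qed
  fix u
  assume u: "u \<in> A ! (i - 1)"
  let ?A = "take (Suc i) A"
  have "last ?A = A ! i" using i len by (simp add: take_Suc_conv_app_nth)
  moreover have but: "butlast ?A = take i A" using i len by (simp add: butlast_take)
  moreover have "last (butlast ?A) = A ! (i - 1)"
  proof -
    obtain i' where "i = Suc i'" using i by (cases i) auto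
    then show ?thesis using but i len by (simp add: take_Suc_conv_app_nth)
  qed
  ultimately show "consecutive T u (A ! i \<inter> ch T u)"
    using consecutive_brs[of ?A u] take_brs[OF A, of "Suc i"] brs_nonempty[OF A] i len u by auto
qed

end

text \<open>Which pairs are comparable is decided by truncations and disjointness, independently of
  the bracketing. Hence both orders relate the same pairs of brackets of \<open>B1\<close>, and
  asymmetry upgrades inclusion of the orders to restriction.\<close>

lemma bracketing_bk_le_iff:
  assumes "bracketing T B1" "bracketing T B2"
  shows "bk_le B1 B2 \<longleftrightarrow> brs B1 \<subseteq> brs B2 \<and> less_rel B1 \<subseteq> less_rel B2"
proof -
  interpret B1: bracketing T B1 by fact
  interpret B2: bracketing T B2 by fact
  have "less_rel B2 \<inter> brs B1 \<times> brs B1 \<subseteq> less_rel B1" if "less_rel B1 \<subseteq> less_rel B2"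
  proof clarify
    fix A1 A2
    assume A: "(A1, A2) \<in> less_rel B2" "A1 \<in> brs B1" "A2 \<in> brs B1"
    then have "(A1, A2) \<in> less_rel B1 \<or> (A2, A1) \<in> less_rel B1"
      using B1.less_total B2.less_over by blast
    then show "(A1, A2) \<in> less_rel B1" using B2.less_asym A that by blast
  qed
  then have "less_rel B1 = less_rel B2 \<inter> brs B1 \<times> brs B1 \<longleftrightarrow> less_rel B1 \<subseteq> less_rel B2"
    using B1.less_brs by (intro iffI subset_antisym Int_greatest) simp_all
  then show ?thesis by (simp add: bk_le_def)
qed

section \<open>Equivalence of the indexed axioms with those on lists\<close>

lemma is_bracketing_imp_bracketing:
  assumes T: "ptree T" and B: "is_bracketing T B"
  shows "bracketing T B"
proof -
  interpret ptree T by fact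
  note defs = B[unfolded is_bracketing_def]
  have isb: "\<forall>A \<in> brs B. \<exists>k \<le> depth T. is_bracket T k A" using defs by (elim conjE)
  have sub: "less_rel B \<subseteq> brs B \<times> brs B" and irr: "irrefl (less_rel B)" and tr: "trans (less_rel B)"
    using defs by simp_all
  have max: "\<forall>k \<le> depth T. max_bracket T k \<in> brs_at B k \<and>
        (\<forall>u \<in> level T k. singleton_bracket T k u \<in> brs_at B k)" using defs by (elim conjE)
  have but: "\<forall>k \<in> {1..depth T}. \<forall>A \<in> brs_at B k. butlast A \<in> brs_at B (k - 1)" using defs by (elim conjE)
  have nest: "\<forall>k \<le> depth T. \<forall>A1 \<in> brs_at B k. \<forall>A2 \<in> brs_at B k.
        A1 ! k \<inter> A2 ! k \<noteq> {} \<longrightarrow> A1 \<sqsubseteq> A2 \<or> A2 \<sqsubseteq> A1" using defs by (elim conjE)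
  have cov: "\<forall>k \<in> {1..depth T}. \<forall>A \<in> brs_at B (k - 1).
        (\<Union>A' \<in> brs_over B k A. A' ! k) = (\<Union>u \<in> A ! (k - 1). ch T u)" using defs by (elim conjE)
  have ref: "\<forall>k \<in> {1..depth T}. \<forall>A \<in> brs_at B (k - 1).
        \<forall>A1 \<in> brs_over B k A. \<forall>A2 \<in> brs_over B k A. A2 \<sqsubset> A1 \<longrightarrow>
          (\<forall>u \<in> A1 ! k. \<exists>A3 \<in> brs_over B k A. A3 \<sqsubset> A1 \<and> u \<in> A3 ! k)" using defs by (elim conjE)
  have comp: "\<forall>k \<le> depth T. \<forall>A1 \<in> brs_at B k. \<forall>A2 \<in> brs_at B k. A1 \<noteq> A2 \<longrightarrow>
        (comparable B A1 A2 \<longleftrightarrow> butlast A1 = butlast A2 \<and> A1 ! k \<inter> A2 ! k = {})" using defs by (elim conjE)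
  have complen: "\<forall>A1 A2. comparable B A1 A2 \<longrightarrow> length A1 = length A2" using defs by (elim conjE)
  have sibs: "\<forall>k \<in> {1..depth T}. \<forall>u \<in> level T (k - 1). \<forall>(u1, u2) \<in> sib T u.
        (singleton_bracket T k u1, singleton_bracket T k u2) \<in> less_rel B" using defs by (elim conjE)
  have mono: "\<forall>k \<in> {1..depth T}. \<forall>A \<in> brs_at B (k - 1). \<forall>A' \<in> brs_at B (k - 1). A' \<sqsubseteq> A \<longrightarrow>
        (\<forall>A1 \<in> brs_over B k A. \<forall>A2 \<in> brs_over B k A.
         \<forall>A1' \<in> brs_over B k A'. \<forall>A2' \<in> brs_over B k A'.
           A1 \<noteq> A2 \<and> comparable B A1 A2 \<and> A1' \<noteq> A2' \<and> comparable B A1' A2' \<and>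
           A1' \<sqsubseteq> A1 \<and> A2' \<sqsubseteq> A2 \<longrightarrow>
             ((A1, A2) \<in> less_rel B \<longleftrightarrow> (A1', A2') \<in> less_rel B))" using defs by (elim conjE)
  have ne: "A \<noteq> []" if "A \<in> brs B" for A using isb that by (auto simp: is_bracket_def)
  have pre: "pre_bracket T A" if A: "A \<in> brs B" for A
  proof -
    obtain k where k: "is_bracket T k A" using isb A by blast
    then have len: "length A = Suc k" by (simp add: is_bracket_def)
    have "A ! Suc i \<subseteq> (\<Union>u \<in> A ! i. ch T u)" if "Suc i < length A" for i
      using k that len unfolding is_bracket_def by (force dest: bspec[of _ _ "Suc i"])
    moreover have "last A = A ! k" using len ne[OF A] by (simp add: last_conv_nth)
    ultimately show ?thesis using k len ne[OF A] unfolding pre_bracket_iff is_bracket_def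
      by (auto simp: less_Suc_eq_le)
  qed
  have at: "A \<in> brs_at B (length A - 1)" "length A - 1 \<le> depth T" "A ! (length A - 1) = last A"
    if "A \<in> brs B" for A
    using that ne isb by (auto simp: brs_at_def last_conv_nth is_bracket_def)
  have at_iff: "A \<in> brs_at B k \<longleftrightarrow> A \<in> brs B \<and> k = length A - 1" for A k
    using ne by (auto simp: brs_at_def)
  have over: "A \<in> brs_over B (length A - 1) (butlast A)" if "A \<in> brs B" for A
    using at that by (simp add: brs_over_def)
  have over_iff: "A' \<in> brs_over B k A \<longleftrightarrow> A' \<in> brs B \<and> k = length A' - 1 \<and> butlast A' = A" for A' A k
    by (auto simp: brs_over_def at_iff)
  have butlast: "butlast A \<in> brs B \<and> length A - 1 \<in> {1..depth T}
      \<and> butlast A \<in> brs_at B (length A - 1 - 1)" if "A \<in> brs B" "butlast A \<noteq> []" for A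
  proof -
    have "length A - 1 \<in> {1..depth T}"
      using at(2)[OF that(1)] that(2) by (cases A rule: rev_cases) (simp_all add: Suc_le_eq)
    then show ?thesis using but at(1)[OF that(1)] by (auto simp: brs_at_def)
  qed
  have comparable: "comparable B A1 A2 \<longleftrightarrow> butlast A1 = butlast A2 \<and> last A1 \<inter> last A2 = {}"
    if "A1 \<in> brs B" "A2 \<in> brs B" "length A1 = length A2" "A1 \<noteq> A2" for A1 A2
    using comp at[OF that(1)] at[OF that(2)] that by metis
  have len_eq: "length A1 = length A2" if "A1 \<in> brs B" "A2 \<in> brs B" "butlast A1 = butlast A2" for A1 A2
    using that ne by (metis append_butlast_last_id length_append_singleton)
  have less_neq: "A1 \<noteq> A2" "length A1 = length A2" "A1 \<in> brs B" "A2 \<in> brs B"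
    if "(A1, A2) \<in> less_rel B" for A1 A2
    using that irr sub complen unfolding irrefl_def comparable_def by blast+
  have total: "(A1, A2) \<in> less_rel B \<or> (A2, A1) \<in> less_rel B"
    if A: "A1 \<in> brs B" "A2 \<in> brs B" "butlast A1 = butlast A2" "last A1 \<inter> last A2 = {}" for A1 A2
  proof -
    have "last A1 \<noteq> {}" using pre A pre_bracket_last by blast
    then have "A1 \<noteq> A2" using A by auto
    then show ?thesis using comparable[OF A(1,2) len_eq[OF A(1-3)]] A(3,4) by (simp add: comparable_def)
  qed
  show ?thesis
  proof
    fix A A1 A2 A3 A1' A2' :: "'a bracket" and k u v u1 u2
    show "A \<in> brs B \<Longrightarrow> pre_bracket T A" by (fact pre)
    show "less_rel B \<subseteq> brs B \<times> brs B" by (fact sub)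
    show "(A, A) \<notin> less_rel B" using irr by (simp add: irrefl_def)
    show "(A1, A2) \<in> less_rel B \<Longrightarrow> (A2, A3) \<in> less_rel B \<Longrightarrow> (A1, A3) \<in> less_rel B"
      using tr by (rule transD)
    show "level T k \<noteq> {} \<Longrightarrow> max_bracket T k \<in> brs B"
      using max level_nonempty_iff by (auto simp: brs_at_def)
    show "u \<in> level T k \<Longrightarrow> singleton_bracket T k u \<in> brs B"
      using max level_le_depth by (auto simp: brs_at_def)
    show "A \<in> brs B \<Longrightarrow> butlast A \<noteq> [] \<Longrightarrow> butlast A \<in> brs B" using butlast by blast
    show "A1 \<sqsubseteq> A2 \<or> A2 \<sqsubseteq> A1" if "A1 \<in> brs B" "A2 \<in> brs B" "length A1 = length A2"
      "last A1 \<inter> last A2 \<noteq> {}"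
      using nest at[OF that(1)] at[OF that(2)] that by metis
    show "\<exists>A' \<in> brs B. butlast A' = A \<and> v \<in> last A'"
      if A: "A \<in> brs B" and u: "u \<in> last A" and v: "v \<in> ch T u"
    proof -
      have "u \<in> level T (length A - 1)" using u pre[OF A] pre_bracket_last_level by blast
      then have "v \<in> level T (length A)"
        using level_SucI v ne[OF A] by (metis One_nat_def Suc_pred length_greater_0_conv)
      then have "length A \<in> {1..depth T}"
        using level_le_depth ne[OF A] by (auto simp: Suc_le_eq)
      then have "(\<Union>A' \<in> brs_over B (length A) A. A' ! length A) = (\<Union>u \<in> A ! (length A - 1). ch T u)"
        using cov at[OF A] by blast
      moreover have "v \<in> (\<Union>u \<in> A ! (length A - 1). ch T u)" using u v at[OF A] by auto
      ultimately obtain A' where "A' \<in> brs_over B (length A) A" "v \<in> A' ! length A" by blast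
      then show ?thesis using at(3)[of A'] by (auto simp: over_iff)
    qed
    show "\<exists>A3 \<in> brs B. butlast A3 = butlast A1 \<and> A3 \<sqsubset> A1 \<and> v \<in> last A3"
      if A: "A1 \<in> brs B" "A2 \<in> brs B" "butlast A2 = butlast A1" "A2 \<sqsubset> A1" and v: "v \<in> last A1"
    \<comment> \<open>The indexed axiom starts at level 1. At level 0 there is only the bracket
      \<open>[{root T}]\<close>, so no strict inclusion occurs.\<close>
    proof (cases "butlast A1 = []")
      case True
      then have "length A1 = Suc 0" "length A2 = Suc 0"
        using A ne by (metis append_butlast_last_id append_Nil length_Cons list.size(3))+
      then have "A1 = A2" using A pre pre_bracket_length1 by metis
      then show ?thesis using A by (simp add: bpsub_def)
    next
      case False
      note bl = butlast[OF A(1) False]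
      have "A1 \<in> brs_over B (length A1 - 1) (butlast A1)" "A2 \<in> brs_over B (length A1 - 1) (butlast A1)"
        using over[OF A(1)] over[OF A(2)] A(3) len_eq[OF A(2,1,3)] by auto
      then have "\<forall>u \<in> A1 ! (length A1 - 1). \<exists>A3 \<in> brs_over B (length A1 - 1) (butlast A1).
          A3 \<sqsubset> A1 \<and> u \<in> A3 ! (length A1 - 1)"
        using ref bl A(4) by blast
      then obtain A3 where "A3 \<in> brs_over B (length A1 - 1) (butlast A1)" "A3 \<sqsubset> A1"
        "v \<in> A3 ! (length A1 - 1)" using v at[OF A(1)] by auto
      then show ?thesis using at(3)[of A3] by (auto simp: over_iff)
    qed
    show "butlast A1 = butlast A2 \<and> last A1 \<inter> last A2 = {}" if "(A1, A2) \<in> less_rel B"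
      using comparable[OF less_neq(3,4,2,1), OF that that that that] that by (simp add: comparable_def)
    show "A1 \<in> brs B \<Longrightarrow> A2 \<in> brs B \<Longrightarrow> butlast A1 = butlast A2 \<Longrightarrow>
      last A1 \<inter> last A2 = {} \<Longrightarrow> (A1, A2) \<in> less_rel B \<or> (A2, A1) \<in> less_rel B"
      by (fact total)
    show "(singleton_bracket T (Suc k) u1, singleton_bracket T (Suc k) u2) \<in> less_rel B"
      if "u \<in> level T k" "(u1, u2) \<in> sib T u"
    proof -
      have "u1 \<in> level T (Suc k)"
        using sib_ch[OF that(1)] that(2) level_SucI[OF that(1)] by blast
      then have "Suc k \<in> {1..depth T}" using level_le_depth[of u1 "Suc k"] by simp
      then show ?thesis using sibs[rule_format, of "Suc k" u "(u1, u2)"] that by simp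
    qed
    show "(A1', A2') \<in> less_rel B"
      if less: "(A1, A2) \<in> less_rel B" and A': "A1' \<in> brs B" "A2' \<in> brs B"
        "butlast A1' = butlast A2'" "A1' \<sqsubseteq> A1" "A2' \<sqsubseteq> A2"
    proof -
      have A: "A1 \<in> brs B" "A2 \<in> brs B" "A1 \<noteq> A2" "length A1 = length A2"
        using less_neq[OF less] by auto
      have cA: "comparable B A1 A2" using less by (simp add: comparable_def)
      then have overA: "butlast A1 = butlast A2" "last A1 \<inter> last A2 = {}"
        using comparable A by blast+
      have "last A1' \<inter> last A2' = {}"
        using overA bsub_last[OF A'(4) ne[OF A'(1)]] bsub_last[OF A'(5) ne[OF A'(2)]] by blast
      then have cA': "comparable B A1' A2'" using total[OF A'(1-3)] by (simp add: comparable_def)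
      then have "A1' \<noteq> A2'" using irr unfolding comparable_def irrefl_def by blast
      \<comment> \<open>There is a single 0-bracket and the order is irreflexive, so related
        brackets have level at least 1, where the indexed axiom applies.\<close>
      have ne1: "butlast A1 \<noteq> []"
      proof
        assume "butlast A1 = []"
        then have "length A1 = Suc 0" "length A2 = Suc 0"
          using A overA ne by (metis append_butlast_last_id append_Nil length_Cons list.size(3))+
        then have "A1 = A2" using A pre pre_bracket_length1 by metis
        then show False using A by simp
      qed
      have len: "length A1' = length A1" "length A2' = length A1"
        using bsub_length[OF A'(4)] bsub_length[OF A'(5)] A(4) by simp_all
      have "butlast A1' \<noteq> []" using ne1 len(1) by (auto simp flip: length_greater_0_conv)
      then have 1: "butlast A1' \<in> brs_at B (length A1 - 1 - 1)" using butlast[OF A'(1)] len by simp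
      have 2: "butlast A1 \<in> brs_at B (length A1 - 1 - 1)" "length A1 - 1 \<in> {1..depth T}"
        using butlast[OF A(1) ne1] by auto
      have 3: "A1 \<in> brs_over B (length A1 - 1) (butlast A1)" "A2 \<in> brs_over B (length A1 - 1) (butlast A1)"
        "A1' \<in> brs_over B (length A1 - 1) (butlast A1')" "A2' \<in> brs_over B (length A1 - 1) (butlast A1')"
        using A A' overA len by (auto simp: over_iff)
      have 4: "butlast A1' \<sqsubseteq> butlast A1" using A' bsub_butlast by blast
      have "(A1, A2) \<in> less_rel B \<longleftrightarrow> (A1', A2') \<in> less_rel B"
        by (rule mono[rule_format, OF 2(2,1) 1 4 3])
          (use A A' cA cA' \<open>A1' \<noteq> A2'\<close> in simp)
      then show ?thesis using less by blast
    qed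
  qed
qed

lemma (in bracketing) is_bracketing: "is_bracketing T B"
proof -
  have ne: "A \<noteq> []" if "A \<in> brs B" for A using that by (rule brs_nonempty)
  have lastk: "A ! k = last A" if "A \<in> brs_at B k" for A k
    using that by (auto simp: brs_at_def last_conv_nth simp flip: length_greater_0_conv)
  have len_eq: "length A1 = length A2" if "A1 \<in> brs B" "A2 \<in> brs B" "butlast A1 = butlast A2" for A1 A2
    using that ne by (metis append_butlast_last_id length_append_singleton)
  have len_less: "A1 \<in> brs B \<and> A2 \<in> brs B \<and> length A1 = length A2" if "(A1, A2) \<in> less_rel B" for A1 A2
    using less_over[OF that] less_brs that len_eq[of A1 A2] by blast
  show ?thesis
    unfolding is_bracketing_def
  proof (intro conjI)
    show "\<forall>A \<in> brs B. \<exists>k \<le> depth T. is_bracket T k A"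
    proof
      fix A
      assume A: "A \<in> brs B"
      have "level T (length A - 1) \<noteq> {}"
        using pre_bracket_last_level[of T A] pre_bracket_last[of T A] pre_bracket[OF A] by blast
      then have "length A - 1 \<le> depth T" by (simp add: level_nonempty_iff)
      moreover have "is_bracket T (length A - 1) A" using A ne[OF A] by (intro is_bracket) auto
      ultimately show "\<exists>k \<le> depth T. is_bracket T k A" by blast
    qed
    show "less_rel B \<subseteq> brs B \<times> brs B" by (fact less_brs)
    show "irrefl (less_rel B)" using less_irrefl by (simp add: irrefl_def)
    show "trans (less_rel B)" using less_trans by (blast intro: transI)
    show "\<forall>k \<le> depth T. max_bracket T k \<in> brs_at B k \<and>
        (\<forall>u \<in> level T k. singleton_bracket T k u \<in> brs_at B k)"
      using max_brs singleton_brs by (auto simp: brs_at_def level_nonempty_iff)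
    show "\<forall>k \<in> {1..depth T}. \<forall>A \<in> brs_at B k. butlast A \<in> brs_at B (k - 1)"
      using butlast_brs by (auto simp: brs_at_def simp flip: length_greater_0_conv)
    show "\<forall>k \<le> depth T. \<forall>A1 \<in> brs_at B k. \<forall>A2 \<in> brs_at B k.
        A1 ! k \<inter> A2 ! k \<noteq> {} \<longrightarrow> A1 \<sqsubseteq> A2 \<or> A2 \<sqsubseteq> A1"
    proof (intro allI impI ballI)
      fix k A1 A2
      assume "A1 \<in> brs_at B k" "A2 \<in> brs_at B k" "A1 ! k \<inter> A2 ! k \<noteq> {}"
      then show "A1 \<sqsubseteq> A2 \<or> A2 \<sqsubseteq> A1"
        using nested[of A1 A2] by (simp add: lastk) (simp add: brs_at_def)
    qed
    show "\<forall>k \<in> {1..depth T}. \<forall>A \<in> brs_at B (k - 1).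
        (\<Union>A' \<in> brs_over B k A. A' ! k) = (\<Union>u \<in> A ! (k - 1). ch T u)"
    proof (intro ballI set_eqI iffI)
      fix k A v
      assume k: "k \<in> {1..depth T}" and A: "A \<in> brs_at B (k - 1)"
      note lastA = lastk[OF A]
      show "v \<in> (\<Union>u \<in> A ! (k - 1). ch T u)" if "v \<in> (\<Union>A' \<in> brs_over B k A. A' ! k)"
      proof -
        obtain A' where A': "A' \<in> brs_at B k" "butlast A' = A" "v \<in> last A'"
          using \<open>v \<in> (\<Union>A' \<in> brs_over B k A. A' ! k)\<close> lastk by (auto simp: brs_over_def)
        moreover have "A \<noteq> []" using A by (auto simp: brs_at_def)
        ultimately obtain u where "u \<in> last A" "v \<in> ch T u"
          using pre_bracket_parent[of T A' v] pre_bracket by (auto simp: brs_at_def)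
        then show ?thesis using lastA by blast
      qed
      show "v \<in> (\<Union>A' \<in> brs_over B k A. A' ! k)" if "v \<in> (\<Union>u \<in> A ! (k - 1). ch T u)"
      proof -
        obtain u where "u \<in> last A" "v \<in> ch T u"
          using \<open>v \<in> (\<Union>u \<in> A ! (k - 1). ch T u)\<close> lastA by auto
        then obtain A' where A': "A' \<in> brs B" "butlast A' = A" "v \<in> last A'"
          using cover[of A u v] A by (auto simp: brs_at_def)
        then have "length A' = Suc k" using A k ne[OF A'(1)]
          by (cases A' rule: rev_cases) (auto simp: brs_at_def)
        then have "A' \<in> brs_over B k A" "v \<in> A' ! k"
          using A' lastk[of A' k] by (auto simp: brs_over_def brs_at_def)
        then show ?thesis by blast
      qed
    qed
    show "\<forall>k \<in> {1..depth T}. \<forall>A \<in> brs_at B (k - 1).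
        \<forall>A1 \<in> brs_over B k A. \<forall>A2 \<in> brs_over B k A. A2 \<sqsubset> A1 \<longrightarrow>
          (\<forall>u \<in> A1 ! k. \<exists>A3 \<in> brs_over B k A. A3 \<sqsubset> A1 \<and> u \<in> A3 ! k)"
    proof (intro ballI impI)
      fix k A A1 A2 u
      assume A: "A1 \<in> brs_over B k A" "A2 \<in> brs_over B k A" "A2 \<sqsubset> A1" and u: "u \<in> A1 ! k"
      have "u \<in> last A1" using u lastk A by (auto simp: brs_over_def)
      then obtain A3 where A3: "A3 \<in> brs B" "butlast A3 = A" "A3 \<sqsubset> A1" "u \<in> last A3"
        using refine[of A1 A2 u] A by (auto simp: brs_over_def brs_at_def)
      then have "A3 \<in> brs_at B k"
        using A by (auto simp: brs_over_def brs_at_def bpsub_def dest: bsub_length)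
      then show "\<exists>A3 \<in> brs_over B k A. A3 \<sqsubset> A1 \<and> u \<in> A3 ! k"
        using A3 lastk by (auto simp: brs_over_def)
    qed
    show "\<forall>k \<le> depth T. \<forall>A1 \<in> brs_at B k. \<forall>A2 \<in> brs_at B k. A1 \<noteq> A2 \<longrightarrow>
        (comparable B A1 A2 \<longleftrightarrow> butlast A1 = butlast A2 \<and> A1 ! k \<inter> A2 ! k = {})"
    proof (intro allI ballI impI)
      fix k A1 A2
      assume A: "A1 \<in> brs_at B k" "A2 \<in> brs_at B k"
      have "A1 \<in> brs B" "A2 \<in> brs B" using A by (auto simp: brs_at_def)
      then show "comparable B A1 A2 \<longleftrightarrow> butlast A1 = butlast A2 \<and> A1 ! k \<inter> A2 ! k = {}"
        unfolding comparable_def lastk[OF A(1)] lastk[OF A(2)]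
        using less_over[of A1 A2] less_over[of A2 A1] less_total[of A1 A2] by auto
    qed
    show "\<forall>A1 A2. comparable B A1 A2 \<longrightarrow> length A1 = length A2"
      using len_less unfolding comparable_def by metis
    show "\<forall>k \<in> {1..depth T}. \<forall>u \<in> level T (k - 1). \<forall>(u1, u2) \<in> sib T u.
        (singleton_bracket T k u1, singleton_bracket T k u2) \<in> less_rel B"
    proof clarify
      fix k u u1 u2
      assume "k \<in> {1..depth T}" "u \<in> level T (k - 1)" "(u1, u2) \<in> sib T u"
      then show "(singleton_bracket T k u1, singleton_bracket T k u2) \<in> less_rel B"
        using less_sib[of u "k - 1" u1 u2] by simp
    qed
    show "\<forall>k \<in> {1..depth T}. \<forall>A \<in> brs_at B (k - 1). \<forall>A' \<in> brs_at B (k - 1). A' \<sqsubseteq> A \<longrightarrow>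
        (\<forall>A1 \<in> brs_over B k A. \<forall>A2 \<in> brs_over B k A.
         \<forall>A1' \<in> brs_over B k A'. \<forall>A2' \<in> brs_over B k A'.
           A1 \<noteq> A2 \<and> comparable B A1 A2 \<and> A1' \<noteq> A2' \<and> comparable B A1' A2' \<and>
           A1' \<sqsubseteq> A1 \<and> A2' \<sqsubseteq> A2 \<longrightarrow>
             ((A1, A2) \<in> less_rel B \<longleftrightarrow> (A1', A2') \<in> less_rel B))"
    proof (intro ballI impI)
      fix k A A' A1 A2 A1' A2'
      assume "A1 \<in> brs_over B k A" "A2 \<in> brs_over B k A" "A1' \<in> brs_over B k A'" "A2' \<in> brs_over B k A'"
        and comp: "A1 \<noteq> A2 \<and> comparable B A1 A2 \<and> A1' \<noteq> A2' \<and> comparable B A1' A2' \<and> A1' \<sqsubseteq> A1 \<and> A2' \<sqsubseteq> A2"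
      then have brs: "A1' \<in> brs B" "A2' \<in> brs B" "butlast A1' = butlast A2'"
        by (auto simp: brs_over_def brs_at_def)
      show "(A1, A2) \<in> less_rel B \<longleftrightarrow> (A1', A2') \<in> less_rel B"
      proof
        show "(A1, A2) \<in> less_rel B \<Longrightarrow> (A1', A2') \<in> less_rel B"
          using less_mono brs comp by blast
        \<comment> \<open>\<open>less_mono\<close> runs only downwards. For the converse,
          comparability leaves just the opposite order of \<open>A1\<close> and \<open>A2\<close>,
          which monotonicity would carry down to the smaller pair.\<close>
        assume less': "(A1', A2') \<in> less_rel B"
        have "(A2, A1) \<notin> less_rel B"
          using less_mono[of A2 A1 A2' A1'] brs comp less_asym[OF less'] by auto
        then show "(A1, A2) \<in> less_rel B" using comp by (auto simp: comparable_def)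
      qed
    qed
  qed
qed

lemma is_bracketing_iff: "ptree T \<Longrightarrow> is_bracketing T B \<longleftrightarrow> bracketing T B"
  using is_bracketing_imp_bracketing bracketing.is_bracketing by blast

section \<open>Restriction to a bracket\<close>

lemma bsub_butlast_take: "A \<sqsubseteq> take (length A) E \<Longrightarrow> butlast A \<sqsubseteq> take (length (butlast A)) E"
  using bsub_butlast[of A "take (length A) E"] bsub_length[of A "take (length A) E"]
  by (simp add: butlast_take)

text \<open>Inclusion forces equal lengths, so only one cut of \<open>E\<close> can serve as the
  witness in \<open>restrict_bracketing\<close>.\<close>

lemma bsub_take_iff: "(\<exists>j. A \<sqsubseteq> take j E) \<longleftrightarrow> A \<sqsubseteq> take (length A) E"
proof
  assume "\<exists>j. A \<sqsubseteq> take j E"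
  then obtain j where j: "A \<sqsubseteq> take j E" by blast
  then have "length A = min (length E) j" using bsub_length by fastforce
  then have "take (length A) E = take j E" by (cases "j \<le> length E") (simp_all add: min_def)
  then show "A \<sqsubseteq> take (length A) E" using j by simp
qed blast

lemma bsub_take_length: "A \<sqsubseteq> take (length A) E \<Longrightarrow> length A \<le> length E"
  using bsub_length by fastforce

lemma brs_restrict_bracketing:
  "A \<in> brs (restrict_bracketing B E) \<longleftrightarrow> A \<in> brs B \<and> A \<sqsubseteq> take (length A) E"
  by (simp add: restrict_bracketing_def restrict_brs_def bsub_take_iff)

lemma less_restrict_bracketing:
  "(A1, A2) \<in> less_rel (restrict_bracketing B E) \<longleftrightarrow>
     (A1, A2) \<in> less_rel B \<and> A1 \<sqsubseteq> take (length A1) E \<and> A2 \<sqsubseteq> take (length A2) E"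
  by (simp add: restrict_bracketing_def restrict_brs_def bsub_take_iff)

locale bracket_subtree = ptree T for T :: "'v plane_tree" +
  fixes E
  assumes pre: "pre_bracket T E"
begin

definition "V = \<Union>(set E)"

lemma verts_iff: "v \<in> V \<longleftrightarrow> (\<exists>i < length E. v \<in> E ! i)"
  unfolding V_def Union_iff Bex_def in_set_conv_nth by blast

lemma ch_subtree: "ch (subtree T E) u = (if u \<in> V then ch T u \<inter> V else {})"
  by (auto simp: ch_def subtree_def Let_def V_def)

text \<open>A vertex has only one level, so forming the union of the entries of \<open>E\<close>
  does not mix them; and each entry stays reachable because parents lie in the preceding
  one.\<close>

lemma level_subtree: "level (subtree T E) k = (if k < length E then E ! k else {})"
proof (induction k)
  case 0
  have "E ! 0 = {root T}" using pre_bracket_nth[OF pre, of 0] pre_bracket_nonempty[OF pre] by auto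
  then show ?case using pre_bracket_nonempty[OF pre] by (auto simp: subtree_def Let_def)
next
  case (Suc k)
  show ?case
  proof (cases "k < length E")
    case True
    have "ch T u \<inter> V = (if Suc k < length E then ch T u \<inter> E ! Suc k else {})" if u: "u \<in> E ! k" for u
    proof -
      have uk: "u \<in> level T k" using u pre_bracket_nth[OF pre True] by blast
      have "i = Suc k" if "v \<in> ch T u" "i < length E" "v \<in> E ! i" for v i
        using ch_level[OF uk] pre_bracket_nth[OF pre] that by blast
      then show ?thesis by (auto simp: verts_iff)
    qed
    moreover have "u \<in> V" if "u \<in> E ! k" for u using that True verts_iff by blast
    ultimately have "level (subtree T E) (Suc k) =
        (\<Union>u \<in> E ! k. if Suc k < length E then ch T u \<inter> E ! Suc k else {})"
      using Suc True unfolding level_Suc ch_subtree by simp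
    also have "\<dots> = (if Suc k < length E then E ! Suc k else {})"
      using pre_bracket_step[OF pre, of k] by auto
    finally show ?thesis .
  qed (use Suc in \<open>simp add: level_Suc\<close>)
qed

sublocale sub: ptree "subtree T E"
proof
  show "finite (arcs (subtree T E))" using finite_arcs by (simp add: subtree_def Let_def)
  show "root (subtree T E) \<notin> ch (subtree T E) u" for u
    using root_no_parent[of u] by (simp add: ch_subtree) (simp add: subtree_def Let_def)
  show "v \<in> ch (subtree T E) u \<Longrightarrow> v \<in> ch (subtree T E) u' \<Longrightarrow> u = u'" for u u' v
    using parent_unique[of v u u'] by (auto simp: ch_subtree split: if_splits)
  show "sib (subtree T E) u \<subseteq> ch (subtree T E) u \<times> ch (subtree T E) u"
    if "u \<in> level (subtree T E) k" for u k
  proof -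
    have k: "k < length E" "u \<in> E ! k" using that by (auto simp: level_subtree split: if_splits)
    then have "u \<in> level T k" "u \<in> V" using pre_bracket_nth[OF pre] verts_iff by blast+
    then show ?thesis using sib_ch[of u k] by (auto simp: subtree_def Let_def ch_def V_def)
  qed
qed

lemma ch_subtree_level:
  assumes "u \<in> E ! k" "Suc k < length E" "v \<in> E ! Suc k"
  shows "v \<in> ch (subtree T E) u \<longleftrightarrow> v \<in> ch T u"
  using assms verts_iff[of u] verts_iff[of v] Suc_lessD by (auto simp: ch_subtree)

lemma pre_bracket_subtree:
  "pre_bracket (subtree T E) A \<longleftrightarrow> pre_bracket T A \<and> A \<sqsubseteq> take (length A) E"
proof
  assume A: "pre_bracket (subtree T E) A"
  have nth: "i < length E \<and> A ! i \<subseteq> E ! i" if "i < length A" for i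
    using pre_bracket_nth[OF A that] by (auto simp: level_subtree split: if_splits)
  have "length A \<le> length E" using nth[of "length A - 1"] pre_bracket_nonempty[OF A] by (cases A) auto
  then have "A \<sqsubseteq> take (length A) E" using nth by (auto simp: bsub_iff)
  moreover have "pre_bracket T A"
    unfolding pre_bracket_iff
  proof (intro conjI allI impI)
    show "A \<noteq> []" "last A \<noteq> {}" using A pre_bracket_nonempty pre_bracket_last by blast+
    show "A ! i \<subseteq> level T i" if "i < length A" for i
      using nth[OF that] pre_bracket_nth[OF pre, of i] by blast
    have sub_ch: "ch (subtree T E) u \<subseteq> ch T u" for u by (simp add: ch_subtree)
    show "A ! Suc i \<subseteq> (\<Union>u \<in> A ! i. ch T u)" if "Suc i < length A" for i
      using pre_bracket_step[OF A that] UN_mono[OF order_refl sub_ch] by (rule order_trans)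
  qed
  ultimately show "pre_bracket T A \<and> A \<sqsubseteq> take (length A) E" by simp
next
  assume A: "pre_bracket T A \<and> A \<sqsubseteq> take (length A) E"
  have len: "length A \<le> length E" using A bsub_take_length by blast
  then have nth: "A ! i \<subseteq> E ! i" if "i < length A" for i
    using A that by (simp add: bsub_iff)
  show "pre_bracket (subtree T E) A"
    unfolding pre_bracket_iff
  proof (intro conjI allI impI)
    show "A \<noteq> []" "last A \<noteq> {}" using A pre_bracket_nonempty pre_bracket_last by blast+
    show "A ! i \<subseteq> level (subtree T E) i" if "i < length A" for i
      using nth[OF that] that len by (simp add: level_subtree)
    show "A ! Suc i \<subseteq> (\<Union>u \<in> A ! i. ch (subtree T E) u)" if i: "Suc i < length A" for i
    proof
      fix v
      assume v: "v \<in> A ! Suc i"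
      then obtain u where u: "u \<in> A ! i" "v \<in> ch T u"
        using pre_bracket_step[of T A i] A i by blast
      moreover have "u \<in> E ! i" "v \<in> E ! Suc i" using u v nth i Suc_lessD by blast+
      ultimately have "v \<in> ch (subtree T E) u" using ch_subtree_level i len by simp
      then show "v \<in> (\<Union>u \<in> A ! i. ch (subtree T E) u)" using u by blast
    qed
  qed
qed

lemma singleton_subtree:
  "k < length E \<Longrightarrow> u \<in> E ! k \<Longrightarrow> singleton_bracket (subtree T E) k u = singleton_bracket T k u"
proof (induction k arbitrary: u)
  case 0
  then have "u = root T" using pre_bracket_nth[OF pre, of 0] by auto
  then show ?case using sub.singleton_root by (simp add: subtree_def Let_def)
next
  case (Suc k)
  then obtain p where p: "p \<in> E ! k" "u \<in> ch T p" using pre_bracket_step[OF pre, of k] by blast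
  have k: "k < length E" using Suc by simp
  have "p \<in> level (subtree T E) k" "u \<in> ch (subtree T E) p"
    using p Suc.prems k ch_subtree_level by (simp_all add: level_subtree)
  moreover have "p \<in> level T k" using p pre_bracket_nth[OF pre k] by blast
  ultimately show ?case
    using Suc.IH[OF k p(1)] p(2) by (simp add: singleton_Suc sub.singleton_Suc)
qed

lemma max_subtree: "k < length E \<Longrightarrow> max_bracket (subtree T E) k = take (Suc k) E"
  by (auto simp: max_bracket_def level_subtree intro!: nth_equalityI simp del: upt_Suc)

lemma singleton_sub: "k < length E \<Longrightarrow> u \<in> E ! k \<Longrightarrow> singleton_bracket T k u \<sqsubseteq> take (Suc k) E"
  using sub.singleton_pre_bracket[of u k] by (simp add: level_subtree pre_bracket_subtree singleton_subtree)

end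

text \<open>The maxima of T|_E are the prefixes of \<open>E\<close>, which belong to
  \<open>B\<close> by closure under truncation. The one axiom that is not simply inherited is
  \<open>cover\<close>, as a covering bracket in \<open>B\<close> may leave
  \<open>E\<close>.\<close>

lemma (in bracketing) restrict_bracketing:
  assumes E: "E \<in> brs B"
  shows "bracketing (subtree T E) (restrict_bracketing B E)"
proof -
  interpret bracket_subtree T E by unfold_locales (rule pre_bracket[OF E])
  let ?R = "restrict_bracketing B E"
  note [simp] = brs_restrict_bracketing less_restrict_bracketing
  have down: "A' \<sqsubseteq> take (length A') E" if "A' \<sqsubseteq> A" "A \<sqsubseteq> take (length A) E" for A' A
    using that bsub_trans bsub_length by metis
  show ?thesis
  proof
    fix A A1 A2 A3 A1' A2' :: "'v bracket" and k u v u1 u2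
    show "A \<in> brs ?R \<Longrightarrow> pre_bracket (subtree T E) A"
      by (simp add: pre_bracket_subtree pre_bracket)
    show "less_rel ?R \<subseteq> brs ?R \<times> brs ?R" using less_brs by auto
    show "(A, A) \<notin> less_rel ?R" by (simp add: less_irrefl)
    show "(A1, A2) \<in> less_rel ?R \<Longrightarrow> (A2, A3) \<in> less_rel ?R \<Longrightarrow> (A1, A3) \<in> less_rel ?R"
      using less_trans by auto
    show "max_bracket (subtree T E) k \<in> brs ?R" if "level (subtree T E) k \<noteq> {}"
    proof -
      have "k < length E" using that by (auto simp: level_subtree split: if_splits)
      then show ?thesis using take_brs[OF E, of "Suc k"] by (simp add: max_subtree)
    qed
    show "singleton_bracket (subtree T E) k u \<in> brs ?R" if "u \<in> level (subtree T E) k"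
    proof -
      have k: "k < length E" "u \<in> E ! k" using that by (auto simp: level_subtree split: if_splits)
      then have "u \<in> level T k" using pre_bracket_nth[OF pre] by blast
      then show ?thesis using k singleton_brs singleton_sub[OF k] by (simp add: singleton_subtree)
    qed
    show "A \<in> brs ?R \<Longrightarrow> butlast A \<noteq> [] \<Longrightarrow> butlast A \<in> brs ?R"
      using butlast_brs[of A] bsub_butlast_take[of A E] by simp
    show "A1 \<in> brs ?R \<Longrightarrow> A2 \<in> brs ?R \<Longrightarrow> length A1 = length A2 \<Longrightarrow>
      last A1 \<inter> last A2 \<noteq> {} \<Longrightarrow> A1 \<sqsubseteq> A2 \<or> A2 \<sqsubseteq> A1"
      using nested by simp
    show "\<exists>A' \<in> brs ?R. butlast A' = A \<and> v \<in> last A'"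
      if A: "A \<in> brs ?R" and u: "u \<in> last A" and v: "v \<in> ch (subtree T E) u"
    proof -
      have AB: "A \<in> brs B" and AE: "A \<sqsubseteq> take (length A) E" using A by auto
      define k where "k = length A - 1"
      have k: "length A = Suc k" using brs_nonempty[OF AB] by (simp add: k_def)
      have "k < length E" using bsub_take_length[OF AE] k by simp
      have uE: "u \<in> E ! k" using AE u k bsub_last[OF AE brs_nonempty[OF AB]] \<open>k < length E\<close>
        by (auto simp: take_Suc_conv_app_nth)
      have "u \<in> level (subtree T E) k" using uE \<open>k < length E\<close> by (simp add: level_subtree)
      then have "v \<in> level (subtree T E) (Suc k)" using v level_SucI by fast
      then have k': "Suc k < length E" and vE: "v \<in> E ! Suc k" by (auto simp: level_subtree split: if_splits)
      then have "v \<in> ch T u" using v ch_subtree_level uE by blast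
      then obtain A' where A': "A' \<in> brs B" "butlast A' = A" "v \<in> last A'"
        using cover[OF AB u] by blast
      let ?E = "take (Suc (Suc k)) E"
      have EB: "?E \<in> brs B" using take_brs[OF E] by simp
      have Esplit: "?E = take (Suc k) E @ [E ! Suc k]" using k' by (simp add: take_Suc_conv_app_nth)
      have len: "length A' = Suc (Suc k)" using A' k brs_nonempty
        by (metis append_butlast_last_id length_append_singleton)
      \<comment> \<open>Both brackets contain \<open>v\<close>, so they are nested. If
        \<open>A'\<close> is the larger one, then \<open>A\<close> is squeezed onto the truncation
        of \<open>?E\<close>, and \<open>?E\<close> itself covers \<open>v\<close> inside
        \<open>E\<close>.\<close>
      have "A' \<sqsubseteq> ?E \<or> ?E \<sqsubseteq> A'"
      proof (rule nested[OF A'(1) EB])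
        show "length A' = length ?E" using len k' by simp
        have "v \<in> last ?E" unfolding Esplit using vE by simp
        then show "last A' \<inter> last ?E \<noteq> {}" using A'(3) by blast
      qed
      then show ?thesis
      proof
        assume "A' \<sqsubseteq> ?E"
        then show ?thesis using A' len by auto
      next
        assume "?E \<sqsubseteq> A'"
        then have "butlast ?E \<sqsubseteq> A" using bsub_butlast A'(2) by metis
        then have "A = butlast ?E" using AE k unfolding Esplit by (simp add: bsub_antisym)
        moreover have "?E \<in> brs ?R" using EB k' by simp
        moreover have "v \<in> last ?E" unfolding Esplit using vE by simp
        ultimately show ?thesis by blast
      qed
    qed
    show "\<exists>A3 \<in> brs ?R. butlast A3 = butlast A1 \<and> A3 \<sqsubset> A1 \<and> v \<in> last A3"
      if A: "A1 \<in> brs ?R" "A2 \<in> brs ?R" "butlast A2 = butlast A1" "A2 \<sqsubset> A1" "v \<in> last A1"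
    proof -
      obtain A3 where "A3 \<in> brs B" "butlast A3 = butlast A1" "A3 \<sqsubset> A1" "v \<in> last A3"
        using refine[of A1 A2 v] A by auto
      moreover have "A3 \<sqsubseteq> take (length A3) E"
        using down[of A3 A1] calculation A by (simp add: bpsub_def)
      ultimately show ?thesis by auto
    qed
    show "(A1, A2) \<in> less_rel ?R \<Longrightarrow> butlast A1 = butlast A2 \<and> last A1 \<inter> last A2 = {}"
      using less_over by simp
    show "A1 \<in> brs ?R \<Longrightarrow> A2 \<in> brs ?R \<Longrightarrow> butlast A1 = butlast A2 \<Longrightarrow>
      last A1 \<inter> last A2 = {} \<Longrightarrow> (A1, A2) \<in> less_rel ?R \<or> (A2, A1) \<in> less_rel ?R"
      using less_total by simp
    show "(singleton_bracket (subtree T E) (Suc k) u1, singleton_bracket (subtree T E) (Suc k) u2) \<in> less_rel ?R"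
      if u: "u \<in> level (subtree T E) k" and s: "(u1, u2) \<in> sib (subtree T E) u"
    proof -
      have "u1 \<in> level (subtree T E) (Suc k)" "u2 \<in> level (subtree T E) (Suc k)"
        using sub.sib_ch[OF u] s level_SucI[OF u] by blast+
      then have k: "Suc k < length E" and u12: "u1 \<in> E ! Suc k" "u2 \<in> E ! Suc k"
        by (auto simp: level_subtree split: if_splits)
      have "u \<in> level T k" using u k pre_bracket_nth[OF pre, of k] by (auto simp: level_subtree)
      moreover have "(u1, u2) \<in> sib T u" using s by (simp add: subtree_def Let_def)
      ultimately show ?thesis using less_sib k u12 singleton_sub[OF k] by (simp add: singleton_subtree)
    qed
    show "(A1, A2) \<in> less_rel ?R \<Longrightarrow> A1' \<in> brs ?R \<Longrightarrow> A2' \<in> brs ?R \<Longrightarrow>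
      butlast A1' = butlast A2' \<Longrightarrow> A1' \<sqsubseteq> A1 \<Longrightarrow> A2' \<sqsubseteq> A2 \<Longrightarrow> (A1', A2') \<in> less_rel ?R"
      using less_mono[of A1 A2 A1' A2'] by simp
  qed
qed

section \<open>Truncation of bracketings\<close>

lemma bsub_take_butlast:
  assumes "E \<noteq> []"
  shows "A \<sqsubseteq> take (length A) (butlast E) \<longleftrightarrow> length A < length E \<and> A \<sqsubseteq> take (length A) E"
  using assms bsub_take_length[of A "butlast E"]
  by (cases "length A < length E"; cases E rule: rev_cases) auto

text \<open>Because of this, the restrictions of one bracketing to the essential brackets satisfy
  the compatibility condition of the fiber product.\<close>

lemma truncate_restrict_bracketing:
  assumes "E \<noteq> []"
  shows "truncate_bracketing (length E - 1) (restrict_bracketing B E) = restrict_bracketing B (butlast E)"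
proof -
  have *: "length A \<le> length E - Suc 0 \<longleftrightarrow> length A < length E" for A :: "'a bracket"
    using assms by (cases E) auto
  show ?thesis
    unfolding truncate_bracketing_def restrict_brs_def
    by (intro bracketing.equality) 
      (auto simp: brs_restrict_bracketing less_restrict_bracketing * bsub_take_butlast[OF assms])
qed

lemma brs_truncate: "A \<in> brs (truncate_bracketing n B) \<longleftrightarrow> A \<in> brs B \<and> length A \<le> n"
  by (simp add: truncate_bracketing_def restrict_brs_def)

lemma less_truncate: "(A1, A2) \<in> less_rel (truncate_bracketing n B) \<longleftrightarrow>
    (A1, A2) \<in> less_rel B \<and> length A1 \<le> n \<and> length A2 \<le> n"
  by (simp add: truncate_bracketing_def restrict_brs_def)

lemma bracketing_eqI:
  assumes "\<And>A. A \<in> brs B1 \<longleftrightarrow> A \<in> brs B2"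
    and "\<And>A1 A2. (A1, A2) \<in> less_rel B1 \<longleftrightarrow> (A1, A2) \<in> less_rel B2"
  shows "B1 = (B2 :: 'v bracketing)"
proof -
  have "brs B1 = brs B2" "less_rel B1 = less_rel B2" using assms by auto
  then show ?thesis by simp
qed

lemma truncate_truncate: "j \<le> k \<Longrightarrow> truncate_bracketing j (truncate_bracketing k B) = truncate_bracketing j B"
  by (rule bracketing_eqI) (auto simp: brs_truncate less_truncate)

lemma (in bracketing) truncate_all:
  assumes "\<And>A. A \<in> brs B \<Longrightarrow> length A \<le> n"
  shows "truncate_bracketing n B = B"
  using assms less_brs by (intro bracketing_eqI) (auto simp: brs_truncate less_truncate)

section \<open>Surjections of plane trees\<close>

text \<open>The model is the quotient map from \<open>T\<close> to \<open>T/C\<close>; the fiber of \<open>v\<^sub>E\<close> is then \<open>E\<close>.\<close>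

locale tree_map = dom: ptree T + cod: ptree T'
  for T :: "'v plane_tree" and T' :: "'w plane_tree" +
  fixes \<rho> :: "'v \<Rightarrow> 'w"
  assumes map_root: "\<rho> (root T) = root T'"
    and map_level: "level T' k = \<rho> ` level T k"
    and map_ch: "u \<in> level T k \<Longrightarrow> v \<in> ch T u \<Longrightarrow> \<rho> v \<in> ch T' (\<rho> u)"
    and map_sib: "u \<in> level T k \<Longrightarrow> (a, b) \<in> sib T u \<Longrightarrow> \<rho> a = \<rho> b \<or> (\<rho> a, \<rho> b) \<in> sib T' (\<rho> u)"
begin

definition push :: "'v bracket \<Rightarrow> 'w bracket" where
  "push A = map ((`) \<rho>) A"

text \<open>The guard that \<open>v\<close> lies on some level excludes elements of the type outside
  the tree, where \<open>\<rho>\<close> is arbitrary. It need not name the level: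
  \<open>\<rho>\<close> preserves levels, so the right one is automatic, see
  \<open>preimage_level\<close>.\<close>

definition pull :: "'w bracket \<Rightarrow> 'v bracket" where
  "pull D = map (\<lambda>S. {v. (\<exists>k. v \<in> level T k) \<and> \<rho> v \<in> S}) D"

abbreviation fiber :: "nat \<Rightarrow> 'w \<Rightarrow> 'v bracket" where
  "fiber k x \<equiv> pull (singleton_bracket T' k x)"

text \<open>Among the brackets of \<open>T\<close> these are exactly the full preimages of brackets
  of \<open>T'\<close>; \<open>pull (push A)\<close> is the saturated hull of
  \<open>A\<close>.\<close>

definition saturated :: "'v bracket set" where
  "saturated = {A. pull (push A) = A}"

definition push_bracketing :: "'v bracketing \<Rightarrow> 'w bracketing" where
  "push_bracketing B = \<lparr>brs = push ` (brs B \<inter> saturated),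
     less_rel = map_prod push push ` (less_rel B \<inter> saturated \<times> saturated)\<rparr>"

lemma length_push [simp]: "length (push A) = length A"
  and length_pull [simp]: "length (pull D) = length D"
  by (simp_all add: push_def pull_def)

lemma push_eq_Nil [simp]: "push A = [] \<longleftrightarrow> A = []"
  and pull_eq_Nil [simp]: "pull D = [] \<longleftrightarrow> D = []"
  by (simp_all add: push_def pull_def)

lemma push_snoc [simp]: "push (A @ [S]) = push A @ [\<rho> ` S]"
  by (simp add: push_def)

lemma butlast_push [simp]: "butlast (push A) = push (butlast A)"
  and butlast_pull [simp]: "butlast (pull D) = pull (butlast D)"
  by (simp_all add: push_def pull_def map_butlast)

lemma last_push: "A \<noteq> [] \<Longrightarrow> last (push A) = \<rho> ` last A"
  by (simp add: push_def last_map)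

lemma last_pull: "D \<noteq> [] \<Longrightarrow> last (pull D) = {v. (\<exists>k. v \<in> level T k) \<and> \<rho> v \<in> last D}"
  by (simp add: pull_def last_map)

lemma push_mono: "A \<sqsubseteq> A' \<Longrightarrow> push A \<sqsubseteq> push A'"
  by (simp add: bsub_iff push_def image_mono)

lemma pull_mono: "D \<sqsubseteq> D' \<Longrightarrow> pull D \<sqsubseteq> pull D'"
proof -
  have "{v. (\<exists>k. v \<in> level T k) \<and> \<rho> v \<in> S} \<subseteq> {v. (\<exists>k. v \<in> level T k) \<and> \<rho> v \<in> S'}" if "S \<subseteq> S'" for S S'
    using that by blast
  then show "D \<sqsubseteq> D' \<Longrightarrow> pull D \<sqsubseteq> pull D'" by (simp add: bsub_iff pull_def)
qed

lemma map_level_iff: "v \<in> level T j \<Longrightarrow> \<rho> v \<in> level T' k \<longleftrightarrow> j = k"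
  using cod.level_unique[of "\<rho> v"] map_level by blast

lemma preimage_level:
  assumes "S \<subseteq> level T' k"
  shows "{v. (\<exists>j. v \<in> level T j) \<and> \<rho> v \<in> S} = {v \<in> level T k. \<rho> v \<in> S}"
proof (intro Collect_cong iffI)
  fix v
  assume v: "(\<exists>j. v \<in> level T j) \<and> \<rho> v \<in> S"
  then obtain j where "v \<in> level T j" by blast
  then show "v \<in> level T k \<and> \<rho> v \<in> S" using v assms map_level_iff[of v j k] by auto
qed blast

lemma pre_bracket_push: "pre_bracket T A \<Longrightarrow> pre_bracket T' (push A)"
proof (induction rule: pre_bracket.induct)
  case root
  then show ?case by (simp add: push_def map_root pre_bracket.root)
next
  case (snoc A S)
  have "A \<noteq> []" using snoc.hyps(1) pre_bracket_nonempty by blast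
  have "\<rho> ` S \<subseteq> (\<Union>x \<in> \<rho> ` last A. ch T' x)"
  proof
    fix y
    assume "y \<in> \<rho> ` S"
    then obtain v where v: "v \<in> S" "y = \<rho> v" by blast
    then obtain u where u: "u \<in> last A" "v \<in> ch T u" using snoc.hyps(3) by blast
    then have "u \<in> level T (length A - 1)" using pre_bracket_last_level[OF snoc.hyps(1)] by blast
    then have "y \<in> ch T' (\<rho> u)" using map_ch u v by simp
    then show "y \<in> (\<Union>x \<in> \<rho> ` last A. ch T' x)" using u by blast
  qed
  then show ?case
    unfolding push_snoc using snoc.IH snoc.hyps(2) \<open>A \<noteq> []\<close>
    by (intro pre_bracket.snoc) (auto simp: last_push)
qed

text \<open>Preimages are nonempty because \<open>\<rho>\<close> is onto on every level. They are
  closed under parents because the parent of a vertex maps to a parent of its image, and parents in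
  \<open>T'\<close> are unique.\<close>

lemma pre_bracket_pull: "pre_bracket T' D \<Longrightarrow> pre_bracket T (pull D)"
proof (induction rule: pre_bracket.induct)
  case root
  have "{v. (\<exists>j. v \<in> level T j) \<and> \<rho> v \<in> {root T'}} = {root T}"
    using preimage_level[of "{root T'}" 0] map_root by auto
  then show ?case by (simp add: pull_def pre_bracket.root)
next
  case (snoc D S)
  let ?k = "length D - 1"
  let ?S = "{v. (\<exists>j. v \<in> level T j) \<and> \<rho> v \<in> S}"
  have D: "D \<noteq> []" using snoc.hyps(1) pre_bracket_nonempty by blast
  have "last D \<subseteq> level T' ?k" by (rule pre_bracket_last_level[OF snoc.hyps(1)])
  then have S: "S \<subseteq> level T' (Suc ?k)" using snoc.hyps(3) level_SucI by fast
  then have S': "?S = {v \<in> level T (Suc ?k). \<rho> v \<in> S}" by (rule preimage_level)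
  obtain x where x: "x \<in> S" using snoc.hyps(2) by blast
  then obtain v where "v \<in> level T (Suc ?k)" "x = \<rho> v" using S map_level[of "Suc ?k"] by blast
  then have "?S \<noteq> {}" using x by blast
  moreover have "?S \<subseteq> (\<Union>u \<in> last (pull D). ch T u)"
  proof
    fix v
    assume "v \<in> ?S"
    then have v: "v \<in> level T (Suc ?k)" "\<rho> v \<in> S" using S' by auto
    then obtain u where u: "u \<in> level T ?k" "v \<in> ch T u" by (auto simp: level_Suc)
    obtain x where x: "x \<in> last D" "\<rho> v \<in> ch T' x" using v snoc.hyps(3) by blast
    have "\<rho> u = x" using map_ch[OF u] x(2) by (rule cod.parent_unique)
    then have "u \<in> last (pull D)" using u x D by (auto simp: last_pull)
    then show "v \<in> (\<Union>u \<in> last (pull D). ch T u)" using u by blast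
  qed
  ultimately have "pre_bracket T (pull D @ [?S])" using snoc.IH by (intro pre_bracket.snoc)
  then show ?case by (simp add: pull_def)
qed

text \<open>Entries of a bracket lie in levels, onto which \<open>\<rho>\<close> is surjective.
  Hence \<open>pull\<close> embeds the brackets of \<open>T'\<close>, with inclusion, into those of
  \<open>T\<close>.\<close>

lemma push_pull: 
  assumes "pre_bracket T' D"
  shows "push (pull D) = D"
proof (rule nth_equalityI)
  fix i
  assume i: "i < length (push (pull D))"
  then have "D ! i \<subseteq> \<rho> ` level T i" using pre_bracket_nth[OF assms, of i] map_level by auto
  then show "push (pull D) ! i = D ! i" using i by (simp add: push_def pull_def) blast
qed simp

lemma pull_in_saturated: "pre_bracket T' D \<Longrightarrow> pull D \<in> saturated"
  by (simp add: saturated_def push_pull)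

lemma bsub_pull_push: "pre_bracket T A \<Longrightarrow> A \<sqsubseteq> pull (push A)"
  unfolding bsub_iff
proof (intro conjI allI impI)
  fix i
  assume "pre_bracket T A" "i < length A"
  then have "A ! i \<subseteq> level T i" using pre_bracket_nth by blast
  then show "A ! i \<subseteq> pull (push A) ! i" using \<open>i < length A\<close> by (auto simp: push_def pull_def)
qed simp

lemma pull_inject: "pre_bracket T' D \<Longrightarrow> pre_bracket T' D' \<Longrightarrow> pull D = pull D' \<longleftrightarrow> D = D'"
  using push_pull by metis

lemma pull_bsub_iff: "pre_bracket T' D \<Longrightarrow> pre_bracket T' D' \<Longrightarrow> pull D \<sqsubseteq> pull D' \<longleftrightarrow> D \<sqsubseteq> D'"
  using push_pull push_mono pull_mono by metis

lemma pull_max: "pull (max_bracket T' k) = max_bracket T k"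
proof (rule nth_equalityI)
  fix i
  assume i: "i < length (pull (max_bracket T' k))"
  then have "pull (max_bracket T' k) ! i = {v. (\<exists>j. v \<in> level T j) \<and> \<rho> v \<in> level T' i}"
    by (simp add: pull_def max_bracket_def del: upt_Suc)
  also have "\<dots> = level T i" using map_level preimage_level[of "level T' i" i] by auto
  finally show "pull (max_bracket T' k) ! i = max_bracket T k ! i"
    using i by (simp add: max_bracket_def del: upt_Suc)
qed simp

lemma push_singleton: "u \<in> level T k \<Longrightarrow> push (singleton_bracket T k u) = singleton_bracket T' k (\<rho> u)"
proof (induction k arbitrary: u)
  case 0
  then show ?case by (simp add: push_def map_root)
next
  case (Suc k)
  then obtain p where p: "p \<in> level T k" "u \<in> ch T p" by (auto simp: level_Suc)
  then have "\<rho> p \<in> level T' k" "\<rho> u \<in> ch T' (\<rho> p)" using map_level map_ch by blast+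
  then show ?case using Suc.IH[OF p(1)] p by (simp add: dom.singleton_Suc cod.singleton_Suc)
qed

lemma fiber_pre: "x \<in> level T' k \<Longrightarrow> pre_bracket T (fiber k x)"
  by (intro pre_bracket_pull cod.singleton_pre_bracket)

lemma last_fiber: "x \<in> level T' k \<Longrightarrow> last (fiber k x) = {v \<in> level T k. \<rho> v = x}"
  using preimage_level[of "{x}" k] last_pull[of "singleton_bracket T' k x"] cod.last_singleton[of x k]
  by (simp flip: length_greater_0_conv)

lemma butlast_fiber: "x \<in> level T' k \<Longrightarrow> y \<in> ch T' x \<Longrightarrow> butlast (fiber (Suc k) y) = fiber k x"
  by (simp add: cod.butlast_singleton)

text \<open>Nothing lies strictly below a singleton bracket of \<open>T'\<close>. So whether a
  bracket lies inside a fiber, and inside which one, is visible from its image.\<close>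

lemma bsub_fiber_iff:
  assumes "x \<in> level T' k" "pre_bracket T A"
  shows "A \<sqsubseteq> fiber k x \<longleftrightarrow> push A = singleton_bracket T' k x"
proof
  assume "A \<sqsubseteq> fiber k x"
  then have "push A \<sqsubseteq> singleton_bracket T' k x"
    using push_mono push_pull[OF cod.singleton_pre_bracket[OF assms(1)]] by metis
  then show "push A = singleton_bracket T' k x"
    using cod.bsub_singleton pre_bracket_push assms by blast
next
  assume "push A = singleton_bracket T' k x"
  then show "A \<sqsubseteq> fiber k x" using bsub_pull_push[OF assms(2)] by simp
qed

lemma disjoint_push:
  assumes "A \<noteq> []" "A' \<noteq> []" "last (push A) \<inter> last (push A') = {}"
  shows "last A \<inter> last A' = {}"
  using assms by (auto simp: last_push)

lemma disjoint_pull_iff: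
  assumes "pre_bracket T' D" "pre_bracket T' D'" "length D = length D'"
  shows "last (pull D) \<inter> last (pull D') = {} \<longleftrightarrow> last D \<inter> last D' = {}"
proof -
  have ne: "D \<noteq> []" "D' \<noteq> []" using assms pre_bracket_nonempty by blast+
  have "last D \<subseteq> \<rho> ` level T (length D - 1)"
    using pre_bracket_last_level[OF assms(1)] map_level by simp
  then show ?thesis using ne by (auto simp: last_pull)
qed

text \<open>A saturated bracket with image \<open>D\<close> can only be \<open>pull D\<close>, which
  turns the image set in \<open>push_bracketing\<close> into a membership test.\<close>

lemma brs_push_bracketing:
  assumes "pre_bracket T' D"
  shows "D \<in> brs (push_bracketing B) \<longleftrightarrow> pull D \<in> brs B"
proof
  assume "D \<in> brs (push_bracketing B)"
  then show "pull D \<in> brs B" by (auto simp: push_bracketing_def saturated_def)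
next
  assume "pull D \<in> brs B"
  then have "push (pull D) \<in> brs (push_bracketing B)"
    using pull_in_saturated[OF assms] unfolding push_bracketing_def by simp
  then show "D \<in> brs (push_bracketing B)" by (simp add: push_pull assms)
qed

lemma less_push_bracketing:
  assumes "pre_bracket T' D1" "pre_bracket T' D2"
  shows "(D1, D2) \<in> less_rel (push_bracketing B) \<longleftrightarrow> (pull D1, pull D2) \<in> less_rel B"
proof
  assume "(D1, D2) \<in> less_rel (push_bracketing B)"
  then show "(pull D1, pull D2) \<in> less_rel B" by (auto simp: push_bracketing_def saturated_def)
next
  assume "(pull D1, pull D2) \<in> less_rel B"
  then have "(pull D1, pull D2) \<in> less_rel B \<inter> saturated \<times> saturated"
    using pull_in_saturated assms by blast
  then have "map_prod push push (pull D1, pull D2) \<in> less_rel (push_bracketing B)"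
    unfolding push_bracketing_def bracketing.select_convs by (rule imageI)
  then show "(D1, D2) \<in> less_rel (push_bracketing B)" by (simp add: push_pull assms)
qed

end

text \<open>For the quotient map to \<open>T/C\<close> these are the elements of the facet of \<open>C\<close>.\<close>

locale fibered_bracketing = tree_map T T' \<rho> + bracketing T B
  for T :: "'v plane_tree" and T' :: "'w plane_tree" and \<rho> B +
  assumes fiber_brs: "x \<in> level T' k \<Longrightarrow> fiber k x \<in> brs B"
    and fiber_less: "x \<in> level T' k \<Longrightarrow> (x1, x2) \<in> sib T' x \<Longrightarrow>
      (fiber (Suc k) x1, fiber (Suc k) x2) \<in> less_rel B"
begin

text \<open>Induction on the length. For every \<open>v\<close> in the last entry \<open>S\<close>,
  the fiber through \<open>v\<close> meets the bracket and is therefore nested with it. If some such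
  fiber contains the bracket, its image is a singleton bracket. Otherwise all of them lie below it,
  so that \<open>S\<close> is a union of fibers, and it remains to see that the truncation
  \<open>P\<close> is saturated.\<close>

lemma saturated_or_in_fiber:
  assumes "A \<in> brs B"
  shows "A \<in> saturated \<or> (\<exists>x \<in> level T' (length A - 1). push A = singleton_bracket T' (length A - 1) x)"
  using assms
proof (induction A rule: rev_induct)
  case (snoc S P)
  show ?case
  proof (cases "P = []")
    case True
    then have "S = {root T}" using pre_bracket[OF snoc.prems] by (simp add: pre_bracket_singleton_iff)
    then show ?thesis using True cod.singleton_root by (simp add: push_def map_root)
  next
    case False
    define k where "k = length P - 1"
    have lenP: "length P = Suc k" using False by (simp add: k_def)
    have P: "P \<in> brs B" using snoc.prems False butlast_brs by fastforce
    have pre: "pre_bracket T (P @ [S])" and preP: "pre_bracket T P"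
      using snoc.prems P pre_bracket by blast+
    have Sl: "S \<subseteq> level T (Suc k)" using pre_bracket_last_level[OF pre] lenP by simp
    have S: "S \<noteq> {}" using pre_bracket_last[OF pre] by simp
    show ?thesis
    proof (cases "\<exists>v \<in> S. P @ [S] \<sqsubseteq> fiber (Suc k) (\<rho> v)")
      case True
      then obtain v where v: "v \<in> S" "P @ [S] \<sqsubseteq> fiber (Suc k) (\<rho> v)" by blast
      then have "\<rho> v \<in> level T' (Suc k)" using Sl map_level by blast
      then show ?thesis using v pre lenP bsub_fiber_iff by auto
    next
      case False
      have above: "fiber (Suc k) (\<rho> v) \<sqsubseteq> P @ [S]" if v: "v \<in> S" for v
      proof -
        have x: "\<rho> v \<in> level T' (Suc k)" using Sl map_level v by blast
        have "v \<in> last (fiber (Suc k) (\<rho> v))" using last_fiber[OF x] v Sl by auto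
        then have "last (P @ [S]) \<inter> last (fiber (Suc k) (\<rho> v)) \<noteq> {}" using v by auto
        then show ?thesis
          using nested[OF snoc.prems fiber_brs[OF x]] False v lenP by auto
      qed
      obtain v where v: "v \<in> S" using S by blast
      then obtain p where p: "p \<in> last P" "v \<in> ch T p"
        using pre \<open>P \<noteq> []\<close> by (auto simp: pre_bracket_snoc_iff)
      have pk: "p \<in> level T k" using p pre_bracket_last_level[OF preP] k_def by blast
      then have px: "\<rho> p \<in> level T' k" using map_level by blast
      \<comment> \<open>If \<open>P\<close> were only known to lie inside a fiber, that fiber would
        be the truncation of the fiber through \<open>v\<close>, which lies below \<open>P\<close>.
        So \<open>P\<close> is the whole fiber.\<close>
      have "P \<in> saturated"
        using snoc.IH[OF P]
      proof
        assume "\<exists>x \<in> level T' (length P - 1). push P = singleton_bracket T' (length P - 1) x"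
        then obtain x where x: "x \<in> level T' k" "push P = singleton_bracket T' k x" using k_def by blast
        have "\<rho> p \<in> last (push P)" using p \<open>P \<noteq> []\<close> by (simp add: last_push)
        then have "\<rho> p = x" using x cod.last_singleton by simp
        then have "pull (push P) = butlast (fiber (Suc k) (\<rho> v))"
          using x butlast_fiber[OF px map_ch[OF pk p(2)]] by simp
        also have "\<dots> \<sqsubseteq> P" using bsub_butlast[OF above[OF v]] by simp
        finally show "P \<in> saturated"
          using bsub_pull_push[OF preP] by (auto simp: saturated_def intro: bsub_antisym)
      qed
      moreover have "w \<in> S" if w: "\<exists>j. w \<in> level T j" "\<rho> w \<in> \<rho> ` S" for w
      proof -
        obtain v where v: "v \<in> S" "\<rho> w = \<rho> v" using w by blast
        have x: "\<rho> v \<in> level T' (Suc k)" using Sl map_level v by blast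
        then have "w \<in> last (fiber (Suc k) (\<rho> v))"
          using w v map_level_iff last_fiber by fastforce
        then show ?thesis using bsub_last[OF above[OF v(1)]] by (auto simp flip: length_greater_0_conv)
      qed
      ultimately have "P @ [S] \<in> saturated"
        using Sl by (auto simp: saturated_def pull_def push_def)
      then show ?thesis by blast
    qed
  qed
qed (use brs_nonempty in blast)

text \<open>The saturated hull of a bracket is the bracket itself or a fiber; both belong to
  \<open>B\<close>.\<close>

lemma pull_push_brs: "A \<in> brs B \<Longrightarrow> pull (push A) \<in> brs B"
  using saturated_or_in_fiber fiber_brs by (fastforce simp: saturated_def)

lemma push_bracketing: "bracketing T' (push_bracketing B)"
proof -
  let ?D = "push_bracketing B"
  have pre': "pre_bracket T' D" if "D \<in> brs ?D" for D
    using that pre_bracket_push pre_bracket by (auto simp: push_bracketing_def)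
  have brs_iff: "D \<in> brs ?D \<longleftrightarrow> pre_bracket T' D \<and> pull D \<in> brs B" for D
    using pre' brs_push_bracketing by blast
  have less_sub: "less_rel ?D \<subseteq> brs ?D \<times> brs ?D"
    using less_brs by (auto simp: push_bracketing_def)
  have less_iff: "(D1, D2) \<in> less_rel ?D \<longleftrightarrow>
      pre_bracket T' D1 \<and> pre_bracket T' D2 \<and> (pull D1, pull D2) \<in> less_rel B" for D1 D2
    using pre' less_sub less_push_bracketing by blast
  have ne: "D \<noteq> []" if "pre_bracket T' D" for D using that pre_bracket_nonempty by blast
  show ?thesis
  proof
    fix A A1 A2 A3 A1' A2' :: "'w bracket" and k u v u1 u2
    show "A \<in> brs ?D \<Longrightarrow> pre_bracket T' A" by (fact pre')
    show "less_rel ?D \<subseteq> brs ?D \<times> brs ?D" by (fact less_sub)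
    show "(A, A) \<notin> less_rel ?D" by (simp add: less_iff less_irrefl)
    show "(A1, A2) \<in> less_rel ?D \<Longrightarrow> (A2, A3) \<in> less_rel ?D \<Longrightarrow> (A1, A3) \<in> less_rel ?D"
      unfolding less_iff using less_trans by blast
    show "max_bracket T' k \<in> brs ?D" if "level T' k \<noteq> {}"
      using that max_brs map_level by (simp add: brs_iff pull_max cod.max_pre_bracket)
    show "u \<in> level T' k \<Longrightarrow> singleton_bracket T' k u \<in> brs ?D"
      by (simp add: brs_iff fiber_brs cod.singleton_pre_bracket)
    show "A \<in> brs ?D \<Longrightarrow> butlast A \<noteq> [] \<Longrightarrow> butlast A \<in> brs ?D"
      unfolding brs_iff using butlast_brs[of "pull A"] by (simp add: pre_bracket_butlast)
    show "A1 \<sqsubseteq> A2 \<or> A2 \<sqsubseteq> A1" if A: "A1 \<in> brs ?D" "A2 \<in> brs ?D" "length A1 = length A2"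
      "last A1 \<inter> last A2 \<noteq> {}"
      using nested[of "pull A1" "pull A2"] A disjoint_pull_iff[of A1 A2] pull_bsub_iff
      unfolding brs_iff by simp
    show "\<exists>A' \<in> brs ?D. butlast A' = A \<and> v \<in> last A'"
      if A: "A \<in> brs ?D" and u: "u \<in> last A" and v: "v \<in> ch T' u"
    proof -
      have pA: "pre_bracket T' A" "pull A \<in> brs B" using A brs_iff by blast+
      let ?k = "length A - 1"
      have uk: "u \<in> level T' ?k" using pre_bracket_last_level[OF pA(1)] u by blast
      then have "v \<in> level T' (Suc ?k)" using v level_SucI by fast
      then obtain w where w: "w \<in> level T (Suc ?k)" "v = \<rho> w" using map_level by blast
      then obtain p where p: "p \<in> level T ?k" "w \<in> ch T p" by (auto simp: level_Suc)
      have "\<rho> p = u" using map_ch[OF p] v unfolding w(2) by (rule cod.parent_unique)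
      then have "p \<in> last (pull A)" using p u ne[OF pA(1)] by (auto simp: last_pull)
      then obtain A' where A': "A' \<in> brs B" "butlast A' = pull A" "w \<in> last A'"
        using cover[OF pA(2) _ p(2)] by blast
      \<comment> \<open>\<open>A'\<close> itself may be unsaturated; its image qualifies because the
        hull of \<open>A'\<close> belongs to \<open>B\<close>.\<close>
      have "push A' \<in> brs ?D"
        using A' pull_push_brs pre_bracket pre_bracket_push by (simp add: brs_iff)
      moreover have "butlast (push A') = A" using A' pA push_pull by simp
      moreover have "v \<in> last (push A')" using A' w brs_nonempty by (simp add: last_push)
      ultimately show ?thesis by blast
    qed
    show "\<exists>A3 \<in> brs ?D. butlast A3 = butlast A1 \<and> A3 \<sqsubset> A1 \<and> v \<in> last A3"
      if A: "A1 \<in> brs ?D" "A2 \<in> brs ?D" "butlast A2 = butlast A1" "A2 \<sqsubset> A1" and v: "v \<in> last A1"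
    proof -
      have pA: "pre_bracket T' A1" "pull A1 \<in> brs B" "pre_bracket T' A2" "pull A2 \<in> brs B"
        using A brs_iff by blast+
      have "v \<in> level T' (length A1 - 1)" using pre_bracket_last_level[OF pA(1)] v by blast
      then obtain w where w: "w \<in> level T (length A1 - 1)" "v = \<rho> w" using map_level by blast
      then have "w \<in> last (pull A1)" using v ne[OF pA(1)] by (auto simp: last_pull)
      moreover have "pull A2 \<sqsubset> pull A1"
        using A(4) pA pull_inject pull_mono by (simp add: bpsub_def)
      ultimately obtain A3 where A3: "A3 \<in> brs B" "butlast A3 = pull (butlast A1)"
        "A3 \<sqsubset> pull A1" "w \<in> last A3"
        using refine[OF pA(2) pA(4)] A(3) by auto
      have len3: "length A3 = length A1" using A3 bsub_length by (fastforce simp: bpsub_def)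
      have mem: "push A3 \<in> brs ?D"
        using A3 pull_push_brs pre_bracket pre_bracket_push by (simp add: brs_iff)
      have le: "push A3 \<sqsubseteq> A1" using A3 push_mono push_pull[OF pA(1)] by (metis bpsub_def)
      \<comment> \<open>Strictness could be lost only if \<open>A3\<close> is unsaturated, and then
        its image \<open>A1\<close> would be a singleton bracket, leaving no room for the smaller
        \<open>A2\<close>.\<close>
      have "push A3 \<noteq> A1"
      proof
        assume eq: "push A3 = A1"
        then have "A3 \<notin> saturated" using A3(3) by (auto simp: saturated_def bpsub_def)
        then obtain x where x: "x \<in> level T' (length A1 - 1)" "A1 = singleton_bracket T' (length A1 - 1) x"
          using saturated_or_in_fiber[OF A3(1)] eq len3 by auto
        then have "A2 = A1" using cod.bsub_singleton[OF pA(3) x(1)] A(4) by (simp add: bpsub_def)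
        then show False using A(4) by (simp add: bpsub_def)
      qed
      moreover have "butlast (push A3) = butlast A1"
      proof (cases "butlast A1 = []")
        case True
        then show ?thesis using A3(2) by (simp add: pull_def)
      next
        case False
        then show ?thesis using A3(2) push_pull[OF pre_bracket_butlast[OF pA(1)]] by simp
      qed
      moreover have "v \<in> last (push A3)" using A3 w brs_nonempty by (simp add: last_push)
      ultimately show ?thesis using mem le by (intro bexI[of _ "push A3"]) (simp_all add: bpsub_def)
    qed
    show "butlast A1 = butlast A2 \<and> last A1 \<inter> last A2 = {}" if "(A1, A2) \<in> less_rel ?D"
    proof -
      have pA: "pre_bracket T' A1" "pre_bracket T' A2" and less: "(pull A1, pull A2) \<in> less_rel B"
        using that less_iff by blast+
      have over: "pull (butlast A1) = pull (butlast A2)" "last (pull A1) \<inter> last (pull A2) = {}"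
        using less_over[OF less] by simp_all
      have len: "length A1 = length A2"
        using arg_cong[OF over(1), of length] ne[OF pA(1)] ne[OF pA(2)]
        by (cases A1 rule: rev_cases; cases A2 rule: rev_cases) simp_all
      have "butlast A1 = butlast A2"
      proof (cases "butlast A1 = []")
        case True
        then show ?thesis using over(1) by (simp add: pull_def)
      next
        case False
        then have "butlast A2 \<noteq> []" using over(1) by (auto simp: pull_def)
        then show ?thesis using over(1) False pA pull_inject pre_bracket_butlast by metis
      qed
      then show ?thesis using over(2) disjoint_pull_iff[OF pA len] by simp
    qed
    show "(A1, A2) \<in> less_rel ?D \<or> (A2, A1) \<in> less_rel ?D"
      if A: "A1 \<in> brs ?D" "A2 \<in> brs ?D" "butlast A1 = butlast A2" "last A1 \<inter> last A2 = {}"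
    proof -
      have pA: "pre_bracket T' A1" "pull A1 \<in> brs B" "pre_bracket T' A2" "pull A2 \<in> brs B"
        using A brs_iff by blast+
      have len: "length A1 = length A2"
        using A(3) ne[OF pA(1)] ne[OF pA(3)]
        by (metis append_butlast_last_id length_append_singleton)
      show ?thesis
        using less_total[OF pA(2,4)] A(3,4) disjoint_pull_iff[OF pA(1,3) len] pA by (simp add: less_iff)
    qed
    show "(singleton_bracket T' (Suc k) u1, singleton_bracket T' (Suc k) u2) \<in> less_rel ?D"
      if u: "u \<in> level T' k" "(u1, u2) \<in> sib T' u"
    proof -
      have "u1 \<in> level T' (Suc k)" "u2 \<in> level T' (Suc k)"
        using cod.sib_ch[OF u(1)] u(2) level_SucI[OF u(1)] by blast+
      then show ?thesis using fiber_less[OF u] by (simp add: less_iff cod.singleton_pre_bracket)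
    qed
    show "(A1', A2') \<in> less_rel ?D"
      if "(A1, A2) \<in> less_rel ?D" "A1' \<in> brs ?D" "A2' \<in> brs ?D"
      "butlast A1' = butlast A2'" "A1' \<sqsubseteq> A1" "A2' \<sqsubseteq> A2"
      using less_mono[of "pull A1" "pull A2" "pull A1'" "pull A2'"] that pull_mono
      by (simp add: brs_iff less_iff)
  qed
qed

end

section \<open>Comparison of two fibered bracketings\<close>

text \<open>Brackets are handled by the dichotomy \<open>saturated_or_in_fiber\<close>. For a
  related pair, disjoint hulls are ordered in the same direction, so the order is seen in
  \<open>T'\<close> and comes back down by \<open>less_mono\<close>. If the hulls meet, both
  brackets lie in one fiber and the restriction to that fiber records their order.\<close>

lemma fibered_bk_le_iff:
  assumes B1: "fibered_bracketing T T' \<rho> B1" and B2: "fibered_bracketing T T' \<rho> B2"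
  shows "bk_le B1 B2 \<longleftrightarrow>
    bk_le (tree_map.push_bracketing T \<rho> B1) (tree_map.push_bracketing T \<rho> B2) \<and>
    (\<forall>k. \<forall>x \<in> level T' k. bk_le (restrict_bracketing B1 (tree_map.pull T \<rho> (singleton_bracket T' k x)))
       (restrict_bracketing B2 (tree_map.pull T \<rho> (singleton_bracket T' k x))))"
    (is "?L \<longleftrightarrow> ?P \<and> ?R")
proof -
  interpret B1: fibered_bracketing T T' \<rho> B1 by fact
  interpret B2: fibered_bracketing T T' \<rho> B2 by fact
  have L: "?L \<longleftrightarrow> brs B1 \<subseteq> brs B2 \<and> less_rel B1 \<subseteq> less_rel B2"
    by (rule bracketing_bk_le_iff[OF B1.bracketing_axioms B2.bracketing_axioms])
  have P: "?P \<longleftrightarrow> brs (B1.push_bracketing B1) \<subseteq> brs (B1.push_bracketing B2) \<and>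
      less_rel (B1.push_bracketing B1) \<subseteq> less_rel (B1.push_bracketing B2)"
    by (rule bracketing_bk_le_iff[OF B1.push_bracketing B2.push_bracketing])
  have R: "?R \<longleftrightarrow> (\<forall>k. \<forall>x \<in> level T' k.
      brs (restrict_bracketing B1 (B1.fiber k x)) \<subseteq> brs (restrict_bracketing B2 (B1.fiber k x)) \<and>
      less_rel (restrict_bracketing B1 (B1.fiber k x)) \<subseteq> less_rel (restrict_bracketing B2 (B1.fiber k x)))"
    using bracketing_bk_le_iff[OF B1.restrict_bracketing[OF B1.fiber_brs] B2.restrict_bracketing[OF B2.fiber_brs]]
    by simp
  show ?thesis
  proof
    assume ?L
    then have "brs B1 \<subseteq> brs B2" "less_rel B1 \<subseteq> less_rel B2" using L by auto
    then show "?P \<and> ?R"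
      unfolding P R
      by (auto simp: B1.push_bracketing_def brs_restrict_bracketing less_restrict_bracketing)
  next
    assume PR: "?P \<and> ?R"
    then have P': "brs (B1.push_bracketing B1) \<subseteq> brs (B1.push_bracketing B2)"
      "less_rel (B1.push_bracketing B1) \<subseteq> less_rel (B1.push_bracketing B2)" using P by auto
    have R': "A \<in> brs B2" if "x \<in> level T' k" "A \<in> brs B1" "A \<sqsubseteq> B1.fiber k x" for k x A
      using PR R that bsub_length[OF that(3)] brs_restrict_bracketing
      by (metis (no_types, lifting) in_mono order_refl take_all)
    have R'': "(A1, A2) \<in> less_rel B2"
      if "x \<in> level T' k" "(A1, A2) \<in> less_rel B1" "A1 \<sqsubseteq> B1.fiber k x" "A2 \<sqsubseteq> B1.fiber k x" for k x A1 A2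
    proof -
      have len: "length A1 = Suc k" "length A2 = Suc k"
        using bsub_length[OF that(3)] bsub_length[OF that(4)] by simp_all
      have "(A1, A2) \<in> less_rel (restrict_bracketing B1 (B1.fiber k x))"
        using that len by (simp add: less_restrict_bracketing)
      then have "(A1, A2) \<in> less_rel (restrict_bracketing B2 (B1.fiber k x))"
        using PR that(1) unfolding R by blast
      then show ?thesis by (simp add: less_restrict_bracketing)
    qed
    have push_pre: "pre_bracket T' (B1.push A)" if "A \<in> brs B1" for A
      using that B1.pre_bracket B1.pre_bracket_push by blast
    have brs: "A \<in> brs B2" if A: "A \<in> brs B1" for A
      using B1.saturated_or_in_fiber[OF A]
    proof
      assume sat: "A \<in> B1.saturated"
      then have "B1.push A \<in> brs (B1.push_bracketing B1)"
        using A by (auto simp: B1.push_bracketing_def)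
      then have "B1.push A \<in> brs (B1.push_bracketing B2)" using P' by blast
      then have "B1.pull (B1.push A) \<in> brs B2" using B1.brs_push_bracketing push_pre[OF A] by blast
      then show ?thesis using sat by (simp add: B1.saturated_def)
    next
      assume "\<exists>x \<in> level T' (length A - 1). B1.push A = singleton_bracket T' (length A - 1) x"
      then obtain x where "x \<in> level T' (length A - 1)" "A \<sqsubseteq> B1.fiber (length A - 1) x"
        using B1.bsub_fiber_iff[OF _ B1.pre_bracket[OF A]] by auto
      then show ?thesis using R'[OF _ A] by simp
    qed
    have less: "(A1, A2) \<in> less_rel B2" if A: "(A1, A2) \<in> less_rel B1" for A1 A2
    proof -
      have mem: "A1 \<in> brs B1" "A2 \<in> brs B1" using A B1.less_brs by auto
      have over: "butlast A1 = butlast A2" "last A1 \<inter> last A2 = {}" using B1.less_over[OF A] by auto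
      have len: "length A1 = length A2"
        using over mem B1.brs_nonempty by (metis append_butlast_last_id length_append_singleton)
      have pre: "pre_bracket T A1" "pre_bracket T A2" using mem B1.pre_bracket by auto
      let ?S1 = "B1.pull (B1.push A1)" and ?S2 = "B1.pull (B1.push A2)"
      have S: "?S1 \<in> brs B1" "?S2 \<in> brs B1" using mem B1.pull_push_brs by auto
      show ?thesis
      proof (cases "last ?S1 \<inter> last ?S2 = {}")
        case True
        have "(?S1, ?S2) \<in> less_rel B1"
        proof -
          have "(?S2, ?S1) \<notin> less_rel B1"
            using B1.less_mono[OF _ mem(2,1)] B1.bsub_pull_push pre over B1.less_asym[OF A] by metis
          then show ?thesis using B1.less_total[OF S _ True] over by simp
        qed
        then have "(B1.push A1, B1.push A2) \<in> less_rel (B1.push_bracketing B2)"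
          using P' B1.less_push_bracketing[OF push_pre push_pre] mem by blast
        then have "(?S1, ?S2) \<in> less_rel B2"
          using B1.less_push_bracketing[OF push_pre push_pre] mem by blast
        then show ?thesis
          using B2.less_mono[OF _ brs[OF mem(1)] brs[OF mem(2)]] over B1.bsub_pull_push pre by blast
      next
        case False
        have "\<exists>x \<in> level T' (length A1 - 1). A1 \<sqsubseteq> B1.fiber (length A1 - 1) x \<and> A2 \<sqsubseteq> B1.fiber (length A1 - 1) x"
        proof -
          have nest: "?S1 \<sqsubseteq> ?S2 \<or> ?S2 \<sqsubseteq> ?S1" using B1.nested[OF S] len False by simp
          \<comment> \<open>If the bracket with the larger hull were saturated, it would contain the
            other one, although the two are disjoint. So it is unsaturated, and its hull is a fiber
            containing both.\<close>
          have "\<not> A1 \<sqsubseteq> A2" "\<not> A2 \<sqsubseteq> A1"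
            using over(2) bsub_last[of A1 A2] bsub_last[of A2 A1] pre pre_bracket_last[of T]
              pre_bracket_nonempty[of T] by blast+
          then have "\<not> ?S1 \<sqsubseteq> ?S2 \<or> A2 \<notin> B1.saturated" "\<not> ?S2 \<sqsubseteq> ?S1 \<or> A1 \<notin> B1.saturated"
            using bsub_trans[OF B1.bsub_pull_push[OF pre(1)], of ?S2]
              bsub_trans[OF B1.bsub_pull_push[OF pre(2)], of ?S1]
            by (auto simp: B1.saturated_def)
          then consider "?S1 \<sqsubseteq> ?S2" "A2 \<notin> B1.saturated" | "?S2 \<sqsubseteq> ?S1" "A1 \<notin> B1.saturated"
            using nest by blast
          then show ?thesis
          proof cases
            case 1
            then obtain x where x: "x \<in> level T' (length A1 - 1)" "B1.push A2 = singleton_bracket T' (length A1 - 1) x"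
              using B1.saturated_or_in_fiber[OF mem(2)] len by auto
            show ?thesis
              using x(1) bsub_trans[OF B1.bsub_pull_push[OF pre(1)] 1(1)] B1.bsub_pull_push[OF pre(2)]
              unfolding x(2) by (intro bexI[OF _ x(1)] conjI)
          next
            case 2
            then obtain x where x: "x \<in> level T' (length A1 - 1)" "B1.push A1 = singleton_bracket T' (length A1 - 1) x"
              using B1.saturated_or_in_fiber[OF mem(1)] by auto
            show ?thesis
              using x(1) B1.bsub_pull_push[OF pre(1)] bsub_trans[OF B1.bsub_pull_push[OF pre(2)] 2(1)]
              unfolding x(2) by (intro bexI[OF _ x(1)] conjI)
          qed
        qed
        then show ?thesis using R'' A by blast
      qed
    qed
    show ?L unfolding L using brs less by auto
  qed
qed

section \<open>Gluing bracketings along a surjection\<close>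

text \<open>The family covers the fibers of all vertices of \<open>T'\<close>, which makes
  compatibility one uniform condition along the arcs of \<open>T'\<close>. It is indexed by the
  brackets \<open>fiber k x\<close> instead of the vertices \<open>x\<close> in order to match
  \<open>fiber_product\<close>.\<close>

locale gluing = tree_map T T' \<rho> + D: bracketing T' D
  for T :: "'v plane_tree" and T' :: "'w plane_tree" and \<rho> D +
  fixes F :: "'v bracket \<Rightarrow> 'v bracketing"
  assumes F: "x \<in> level T' k \<Longrightarrow> bracketing (subtree T (fiber k x)) (F (fiber k x))"
    and F_truncate: "x \<in> level T' k \<Longrightarrow> y \<in> ch T' x \<Longrightarrow>
      truncate_bracketing (Suc k) (F (fiber (Suc k) y)) = F (fiber k x)"
begin

lemma fiber_subtree: "x \<in> level T' k \<Longrightarrow> bracket_subtree T (fiber k x)"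
  by unfold_locales (rule fiber_pre)

lemma F_pre:
  assumes "x \<in> level T' k" "A \<in> brs (F (fiber k x))"
  shows "pre_bracket T A" "A \<sqsubseteq> take (length A) (fiber k x)"
  using bracketing.pre_bracket[OF F[OF assms(1)] assms(2)]
    bracket_subtree.pre_bracket_subtree[OF fiber_subtree[OF assms(1)]] by simp_all

lemma F_length: "x \<in> level T' k \<Longrightarrow> A \<in> brs (F (fiber k x)) \<Longrightarrow> length A \<le> Suc k"
  using bsub_take_length[OF F_pre(2)] by simp

text \<open>Iterates \<open>F_truncate\<close> along the path to the root. It is needed since gluing
  consults a member of the family only for brackets of full length, so shorter ones must be traced
  to an ancestor.\<close>

lemma F_ancestor:
  assumes "x \<in> level T' k" "j \<le> k"
  shows "\<exists>y \<in> level T' j. take (Suc j) (fiber k x) = fiber j y \<and>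
    truncate_bracketing (Suc j) (F (fiber k x)) = F (fiber j y)"
  using assms
proof (induction k arbitrary: x)
  case 0
  then have "truncate_bracketing (Suc 0) (F (fiber 0 x)) = F (fiber 0 x)"
    by (intro bracketing.truncate_all[OF F] F_length)
  then show ?case using 0 by (intro bexI[of _ x]) simp_all
next
  case (Suc k)
  show ?case
  proof (cases "j = Suc k")
    case True
    have "truncate_bracketing (Suc (Suc k)) (F (fiber (Suc k) x)) = F (fiber (Suc k) x)"
      using Suc.prems(1) by (intro bracketing.truncate_all[OF F] F_length)
    then show ?thesis using Suc.prems True by (intro bexI[of _ x]) simp_all
  next
    case False
    then have j: "j \<le> k" using Suc.prems by simp
    obtain p where p: "p \<in> level T' k" "x \<in> ch T' p" using Suc.prems(1) by (auto simp: level_Suc)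
    obtain y where y: "y \<in> level T' j" "take (Suc j) (fiber k p) = fiber j y"
      "truncate_bracketing (Suc j) (F (fiber k p)) = F (fiber j y)"
      using Suc.IH[OF p(1) j] by blast
    have "take (Suc j) (fiber (Suc k) x) = take (Suc j) (butlast (fiber (Suc k) x))"
      using j by (subst take_butlast) simp_all
    also have "\<dots> = fiber j y" using y(2) butlast_fiber[OF p] by simp
    finally have "take (Suc j) (fiber (Suc k) x) = fiber j y" .
    moreover have "truncate_bracketing (Suc j) (F (fiber (Suc k) x)) = F (fiber j y)"
      using truncate_truncate[of "Suc j" "Suc k" "F (fiber (Suc k) x)"] j y(3) F_truncate[OF p] by simp
    ultimately show ?thesis using y(1) by blast
  qed
qed

text \<open>An unsaturated bracket is looked up in a fiber over its own level. The shorter brackets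
  of a member of \<open>F\<close> are found at the ancestors, by \<open>F_truncate\<close>.\<close>

definition glued_brs :: "'v bracket set" where
  "glued_brs = {A. pre_bracket T A \<and> push A \<in> brs D \<and>
     (A \<in> saturated \<or> (\<exists>x \<in> level T' (length A - 1). A \<in> brs (F (fiber (length A - 1) x))))}"

text \<open>The order is lexicographic: first the images in the target tree, then the position inside a
  common fiber.\<close>

definition glued :: "'v bracketing" where
  "glued = \<lparr>brs = glued_brs,
     less_rel = {(A1, A2). A1 \<in> glued_brs \<and> A2 \<in> glued_brs \<and> butlast A1 = butlast A2 \<and>
       ((push A1, push A2) \<in> less_rel D \<or>
        (\<exists>x \<in> level T' (length A1 - 1). (A1, A2) \<in> less_rel (F (fiber (length A1 - 1) x))))}\<rparr>"

lemma brs_glued [simp]: "brs glued = glued_brs"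
  by (simp add: glued_def)

lemma glued_pre: "A \<in> glued_brs \<Longrightarrow> pre_bracket T A"
  by (simp add: glued_brs_def)

lemma glued_nonempty: "A \<in> glued_brs \<Longrightarrow> A \<noteq> []"
  using glued_pre pre_bracket_nonempty by blast

lemma glued_push: "A \<in> glued_brs \<Longrightarrow> push A \<in> brs D"
  by (simp add: glued_brs_def)

lemma pull_glued: "S \<in> brs D \<Longrightarrow> pull S \<in> glued_brs"
  using D.pre_bracket[of S] by (simp add: glued_brs_def pre_bracket_pull push_pull pull_in_saturated)

lemma push_F:
  assumes "x \<in> level T' k" "A \<in> brs (F (fiber k x))" "length A = Suc k"
  shows "push A = singleton_bracket T' k x"
  using F_pre[OF assms(1,2)] assms by (simp add: bsub_fiber_iff)

lemma F_glued:
  assumes "x \<in> level T' k" "A \<in> brs (F (fiber k x))" "length A = Suc k"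
  shows "A \<in> glued_brs"
  using F_pre(1)[OF assms(1,2)] push_F[OF assms] D.singleton_brs[OF assms(1)] assms
  by (auto simp: glued_brs_def)

lemma fiber_nth: "x \<in> level T' k \<Longrightarrow> fiber k x ! k = {v \<in> level T k. \<rho> v = x}"
  using last_fiber[of x k] last_conv_nth[of "fiber k x"] by (simp flip: length_greater_0_conv)

lemma fiber_nth_parent:
  assumes "x \<in> level T' k" "y \<in> ch T' x"
  shows "fiber (Suc k) y ! k = {v \<in> level T k. \<rho> v = x}"
  using fiber_nth[OF assms(1)] nth_butlast[of k "fiber (Suc k) y"] butlast_fiber[OF assms] by simp

lemma fiber_F:
  assumes x: "x \<in> level T' k"
  shows "fiber k x \<in> brs (F (fiber k x))"
proof -
  interpret bracket_subtree T "fiber k x" by (rule fiber_subtree[OF x])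
  have "level (subtree T (fiber k x)) k \<noteq> {}"
    using pre_bracket_nth[OF fiber_pre[OF x], of k] by (simp add: level_subtree)
  then have "max_bracket (subtree T (fiber k x)) k \<in> brs (F (fiber k x))"
    by (rule bracketing.max_brs[OF F[OF x]])
  then show ?thesis by (simp add: max_subtree)
qed

text \<open>A saturated bracket over a singleton is the whole fiber, the maximum of its subtree. An
  unsaturated one comes from some fiber, and the image tells from which.\<close>

lemma F_if_push:
  assumes "x \<in> level T' k" "A \<in> glued_brs" "push A = singleton_bracket T' k x"
  shows "A \<in> brs (F (fiber k x))"
proof (cases "A \<in> saturated")
  case True
  then have "A = fiber k x" using assms(3) by (simp add: saturated_def)
  then show ?thesis using fiber_F[OF assms(1)] by simp
next
  case False
  have len: "length A = Suc k" using arg_cong[OF assms(3), of length] by simp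
  then obtain y where y: "y \<in> level T' k" "A \<in> brs (F (fiber k y))"
    using False assms(2) by (auto simp: glued_brs_def)
  then have "singleton_bracket T' k y = singleton_bracket T' k x" using push_F len assms(3) by simp
  then have "y = x" using cod.last_singleton y(1) assms(1) by (metis the_elem_eq)
  then show ?thesis using y by simp
qed

lemma glued_cases:
  assumes "A \<in> glued_brs"
  obtains (sat) "pull (push A) = A"
  | (fib) k x where "x \<in> level T' k" "length A = Suc k" "push A = singleton_bracket T' k x"
      "A \<in> brs (F (fiber k x))"
proof (cases "A \<in> saturated")
  case True
  then show thesis using sat by (simp add: saturated_def)
next
  case False
  have "length A = Suc (length A - 1)" using glued_nonempty[OF assms] by simp
  moreover obtain x where "x \<in> level T' (length A - 1)" "A \<in> brs (F (fiber (length A - 1) x))"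
    using False assms by (auto simp: glued_brs_def)
  ultimately show thesis using fib push_F by blast
qed

text \<open>This lifts nestedness from \<open>D\<close>. If \<open>A2\<close> is saturated, it
  contains the hull of \<open>A1\<close>. Otherwise its image is a singleton bracket, with nothing
  strictly below it, so \<open>A1\<close> has the same image and the comparison takes place within
  one member of \<open>F\<close>.\<close>

lemma push_bsub_cases:
  assumes "A1 \<in> glued_brs" "A2 \<in> glued_brs" "push A1 \<sqsubseteq> push A2"
  obtains (le) "A1 \<sqsubseteq> A2"
  | (fib) k x where "x \<in> level T' k" "length A1 = Suc k" "length A2 = Suc k"
      "push A1 = singleton_bracket T' k x" "push A2 = singleton_bracket T' k x"
      "A1 \<in> brs (F (fiber k x))" "A2 \<in> brs (F (fiber k x))"
  using assms(2)
proof (cases rule: glued_cases)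
  case sat
  have "A1 \<sqsubseteq> pull (push A1)" by (rule bsub_pull_push[OF glued_pre[OF assms(1)]])
  also have "\<dots> \<sqsubseteq> A2" using pull_mono[OF assms(3)] sat by simp
  finally show thesis by (rule le)
next
  case (fib k x)
  have "push A1 = singleton_bracket T' k x"
    using cod.bsub_singleton[OF _ fib(1)] assms(3) fib(3) pre_bracket_push[OF glued_pre[OF assms(1)]] by simp
  moreover have "length A1 = Suc k" using bsub_length[OF assms(3)] fib(2) by simp
  ultimately show thesis
    using that(2)[OF fib(1) _ fib(2) _ fib(3) _ fib(4)] F_if_push[OF fib(1) assms(1)] by blast
qed

lemma less_glued_iff: "(A1, A2) \<in> less_rel glued \<longleftrightarrow> A1 \<in> glued_brs \<and> A2 \<in> glued_brs \<and>
    butlast A1 = butlast A2 \<and> ((push A1, push A2) \<in> less_rel D \<or>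
      (\<exists>k. \<exists>x \<in> level T' k. length A1 = Suc k \<and> length A2 = Suc k \<and> A1 \<in> brs (F (fiber k x)) \<and>
         A2 \<in> brs (F (fiber k x)) \<and> (A1, A2) \<in> less_rel (F (fiber k x))))" (is "?L \<longleftrightarrow> ?R")
proof
  assume ?L
  then have A: "A1 \<in> glued_brs" "A2 \<in> glued_brs" "butlast A1 = butlast A2" by (auto simp: glued_def)
  have "length A1 = Suc (length A1 - 1)" "length A2 = Suc (length A1 - 1)"
    using A glued_nonempty by (metis Suc_pred' length_greater_0_conv append_butlast_last_id length_append_singleton)+
  moreover have "A1 \<in> brs (F (fiber k x)) \<and> A2 \<in> brs (F (fiber k x))"
    if "x \<in> level T' k" "(A1, A2) \<in> less_rel (F (fiber k x))" for k x
    using bracketing.less_brs[OF F[OF that(1)]] that(2) by blast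
  ultimately show ?R using \<open>?L\<close> unfolding glued_def by fastforce
next
  assume ?R
  then show ?L unfolding glued_def by fastforce
qed

lemma F_unique:
  assumes "x \<in> level T' k" "y \<in> level T' j" "length A = Suc k" "length A = Suc j"
    "A \<in> brs (F (fiber k x))" "A \<in> brs (F (fiber j y))"
  shows "j = k \<and> y = x"
proof -
  have "singleton_bracket T' k x = singleton_bracket T' k y"
    using push_F[of x k A] push_F[of y j A] assms by simp
  then show ?thesis using cod.last_singleton[OF assms(1)] cod.last_singleton[OF assms(2)] assms(3,4) by simp
qed

lemma singleton_F:
  assumes "u \<in> level T k"
  shows "singleton_bracket T k u \<in> brs (F (fiber k (\<rho> u)))"
proof -
  have x: "\<rho> u \<in> level T' k" using assms map_level by blast
  interpret bracket_subtree T "fiber k (\<rho> u)" by (rule fiber_subtree[OF x])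
  have u: "u \<in> fiber k (\<rho> u) ! k" using fiber_nth[OF x] assms by simp
  then have "u \<in> level (subtree T (fiber k (\<rho> u))) k" by (simp add: level_subtree)
  then have "singleton_bracket (subtree T (fiber k (\<rho> u))) k u \<in> brs (F (fiber k (\<rho> u)))"
    by (rule bracketing.singleton_brs[OF F[OF x]])
  then show ?thesis using u by (simp add: singleton_subtree)
qed

section \<open>The axioms for the glued bracketing\<close>

lemma glued_bracketing: "bracketing T glued"
proof
  fix A A1 A2 A3 A1' A2' :: "'v bracket" and k u v u1 u2
  show "A \<in> brs glued \<Longrightarrow> pre_bracket T A" by (simp add: glued_pre)
  show "less_rel glued \<subseteq> brs glued \<times> brs glued" by (auto simp: glued_def)
  show "(A, A) \<notin> less_rel glued"
    using D.less_irrefl bracketing.less_irrefl[OF F] by (auto simp: less_glued_iff)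
  show "(A1, A3) \<in> less_rel glued" if less: "(A1, A2) \<in> less_rel glued" "(A2, A3) \<in> less_rel glued"
  proof -
    have A: "A1 \<in> glued_brs" "A2 \<in> glued_brs" "A3 \<in> glued_brs" "butlast A1 = butlast A3"
      using less by (auto simp: less_glued_iff)
    \<comment> \<open>Brackets compared inside a fiber have equal images, so the mixed cases reduce
      to one relation in \<open>D\<close>. Two fiber steps share \<open>A2\<close> and hence use the
      same fiber.\<close>
    consider (DD) "(push A1, push A2) \<in> less_rel D" "(push A2, push A3) \<in> less_rel D"
      | (DF) k x where "(push A1, push A2) \<in> less_rel D" "x \<in> level T' k" "length A2 = Suc k" "length A3 = Suc k"
          "A2 \<in> brs (F (fiber k x))" "A3 \<in> brs (F (fiber k x))"
      | (FD) k x where "(push A2, push A3) \<in> less_rel D" "x \<in> level T' k" "length A1 = Suc k" "length A2 = Suc k"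
          "A1 \<in> brs (F (fiber k x))" "A2 \<in> brs (F (fiber k x))"
      | (FF) k x j y where "x \<in> level T' k" "y \<in> level T' j" "length A1 = Suc k" "length A2 = Suc k"
          "length A2 = Suc j" "length A3 = Suc j"
          "A1 \<in> brs (F (fiber k x))" "A2 \<in> brs (F (fiber k x))" "A2 \<in> brs (F (fiber j y))" "A3 \<in> brs (F (fiber j y))"
          "(A1, A2) \<in> less_rel (F (fiber k x))" "(A2, A3) \<in> less_rel (F (fiber j y))"
      using less unfolding less_glued_iff by (elim conjE disjE exE bexE) blast+
    then show ?thesis
    proof cases
      case DD
      then show ?thesis using A D.less_trans less_glued_iff by blast
    next
      case DF
      then have "push A2 = push A3" using push_F by simp
      then show ?thesis using DF A less_glued_iff by simp
    next
      case FD
      then have "push A1 = push A2" using push_F by simp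
      then show ?thesis using FD A less_glued_iff by simp
    next
      case FF
      then have "j = k \<and> y = x" using F_unique[of x k y j A2] by blast
      then have "(A1, A3) \<in> less_rel (F (fiber k x))"
        using FF bracketing.less_trans[OF F[OF FF(1)]] by blast
      then show ?thesis using FF A \<open>j = k \<and> y = x\<close> unfolding less_glued_iff by blast
    qed
  qed
  show "max_bracket T k \<in> brs glued" if "level T k \<noteq> {}"
    using pull_glued[OF D.max_brs] that map_level by (simp add: pull_max)
  show "singleton_bracket T k u \<in> brs glued" if "u \<in> level T k"
    using F_glued[OF _ singleton_F[OF that]] that map_level by simp
  show "butlast A \<in> brs glued" if A: "A \<in> brs glued" "butlast A \<noteq> []"
  proof -
    have "A \<in> glued_brs" using A by simp
    then show ?thesis
    proof (cases rule: glued_cases)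
      case sat
      have "butlast (push A) \<in> brs D"
        using D.butlast_brs[OF glued_push[OF \<open>A \<in> glued_brs\<close>]] A(2) by simp
      then have "pull (butlast (push A)) \<in> glued_brs" by (rule pull_glued)
      then show ?thesis using arg_cong[OF sat, of butlast] by simp
    next
      case (fib k x)
      \<comment> \<open>Truncation leads from the fiber of \<open>x\<close> to that of its parent,
        where compatibility of the family puts the truncated bracket.\<close>
      obtain j where j: "k = Suc j" using A(2) fib(2) by (cases k; cases A rule: rev_cases) auto
      then obtain p where p: "p \<in> level T' j" "x \<in> ch T' p" using fib(1) by (auto simp: level_Suc)
      have "butlast A \<in> brs (F (fiber k x))"
        by (rule bracketing.butlast_brs[OF F[OF fib(1)] fib(4) A(2)])
      then have "butlast A \<in> brs (truncate_bracketing (Suc j) (F (fiber (Suc j) x)))"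
        using fib(2) j by (simp add: brs_truncate)
      then have "butlast A \<in> brs (F (fiber j p))" using F_truncate[OF p] by simp
      then show ?thesis using F_glued[OF p(1)] fib(2) j by simp
    qed
  qed
  show "A1 \<sqsubseteq> A2 \<or> A2 \<sqsubseteq> A1" if "A1 \<in> brs glued" "A2 \<in> brs glued" "length A1 = length A2"
    "last A1 \<inter> last A2 \<noteq> {}"
  proof -
    have A: "A1 \<in> glued_brs" "A2 \<in> glued_brs" using that by simp_all
    have fib: "A1 \<sqsubseteq> A2 \<or> A2 \<sqsubseteq> A1"
      if "x \<in> level T' k" "A1 \<in> brs (F (fiber k x))" "A2 \<in> brs (F (fiber k x))" for k x
      using bracketing.nested[OF F[OF that(1)] that(2,3)] \<open>length A1 = length A2\<close>
        \<open>last A1 \<inter> last A2 \<noteq> {}\<close> by blast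
    have "last (push A1) \<inter> last (push A2) \<noteq> {}"
      using disjoint_push[of A1 A2] that(4) glued_nonempty A by blast
    then have "push A1 \<sqsubseteq> push A2 \<or> push A2 \<sqsubseteq> push A1"
      using D.nested[OF glued_push[OF A(1)] glued_push[OF A(2)]] that(3) by simp
    then show ?thesis
    proof
      assume "push A1 \<sqsubseteq> push A2"
      with A show ?thesis by (cases rule: push_bsub_cases) (use fib in blast)+
    next
      assume "push A2 \<sqsubseteq> push A1"
      with A(2,1) show ?thesis by (cases rule: push_bsub_cases) (use fib in blast)+
    qed
  qed
  show "\<exists>A' \<in> brs glued. butlast A' = A \<and> v \<in> last A'"
    if A': "A \<in> brs glued" and u: "u \<in> last A" and v: "v \<in> ch T u"
  proof -
    have A: "A \<in> glued_brs" using A' by simp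
    define k where "k = length A - 1"
    have len: "length A = Suc k" using glued_nonempty[OF A] by (simp add: k_def)
    have uk: "u \<in> level T k" using pre_bracket_last_level[OF glued_pre[OF A]] u k_def by blast
    have vk: "v \<in> level T (Suc k)" using uk v by (rule level_SucI)
    have \<rho>v: "\<rho> v \<in> ch T' (\<rho> u)" by (rule map_ch[OF uk v])
    have \<rho>u: "\<rho> u \<in> last (push A)" using u glued_nonempty[OF A] by (simp add: last_push)
    show ?thesis
      using A
    proof (cases rule: glued_cases)
      case sat
      obtain S where S: "S \<in> brs D" "butlast S = push A" "\<rho> v \<in> last S"
        using D.cover[OF glued_push[OF A] \<rho>u \<rho>v] by blast
      have "pull S \<in> brs glued" using pull_glued[OF S(1)] by simp
      moreover have "butlast (pull S) = A" using S(2) sat by simp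
      moreover have "v \<in> last (pull S)" using S vk D.brs_nonempty[OF S(1)] by (auto simp: last_pull)
      ultimately show ?thesis by blast
    next
      case (fib j x)
      then have j: "j = k" using len by simp
      have x: "\<rho> u = x" using \<rho>u fib(3) cod.last_singleton[OF fib(1)] by simp
      have xk: "x \<in> level T' k" and y: "\<rho> v \<in> ch T' x" using fib(1) \<rho>v x j by simp_all
      then have yk: "\<rho> v \<in> level T' (Suc k)" by (rule level_SucI)
      interpret bracket_subtree T "fiber (Suc k) (\<rho> v)" by (rule fiber_subtree[OF yk])
      \<comment> \<open>The new bracket is sought over the child \<open>\<rho> v\<close> of
        \<open>x\<close>: by compatibility the bracketing of that fiber contains \<open>A\<close>,
        and its own covering axiom applies.\<close>
      have "A \<in> brs (truncate_bracketing (Suc k) (F (fiber (Suc k) (\<rho> v))))"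
        using fib(4) F_truncate[OF xk y] j by simp
      then have AF: "A \<in> brs (F (fiber (Suc k) (\<rho> v)))" by (simp add: brs_truncate)
      have "v \<in> ch (subtree T (fiber (Suc k) (\<rho> v))) u"
      proof (rule ch_subtree_level[THEN iffD2])
        show "u \<in> fiber (Suc k) (\<rho> v) ! k" using fiber_nth_parent[OF xk y] uk x by simp
        show "v \<in> fiber (Suc k) (\<rho> v) ! Suc k" using fiber_nth[OF yk] vk by simp
      qed (use v in simp_all)
      then obtain A' where A': "A' \<in> brs (F (fiber (Suc k) (\<rho> v)))" "butlast A' = A" "v \<in> last A'"
        using bracketing.cover[OF F[OF yk] AF u] by blast
      have "A' \<noteq> []" using F_pre(1)[OF yk A'(1)] pre_bracket_nonempty by blast
      then have "length A' = Suc (Suc k)" using A'(2) len by (cases A' rule: rev_cases) auto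
      then have "A' \<in> brs glued" using F_glued[OF yk A'(1)] by simp
      then show ?thesis using A' by blast
    qed
  qed
  show "\<exists>A3 \<in> brs glued. butlast A3 = butlast A1 \<and> A3 \<sqsubset> A1 \<and> v \<in> last A3"
    if "A1 \<in> brs glued" "A2 \<in> brs glued" and over: "butlast A2 = butlast A1"
      and sub: "A2 \<sqsubset> A1" and v: "v \<in> last A1"
  proof -
    have A: "A1 \<in> glued_brs" "A2 \<in> glued_brs" using that by simp_all
    have le: "A2 \<sqsubseteq> A1" "A2 \<noteq> A1" using sub by (simp_all add: bpsub_def)
    have in_F: ?thesis
      if x: "x \<in> level T' k" "length A1 = Suc k" and F1: "A1 \<in> brs (F (fiber k x))" and F2: "A2 \<in> brs (F (fiber k x))" for k x
    proof -
      obtain A3 where A3: "A3 \<in> brs (F (fiber k x))" "butlast A3 = butlast A1" "A3 \<sqsubset> A1" "v \<in> last A3"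
        using bracketing.refine[OF F[OF x(1)] F1 F2 over sub v] by blast
      then have "length A3 = Suc k" using x(2) bsub_length by (fastforce simp: bpsub_def)
      then have "A3 \<in> brs glued" using F_glued[OF x(1) A3(1)] by simp
      then show ?thesis using A3 by blast
    qed
    show ?thesis
      using A(1)
    proof (cases rule: glued_cases)
      case (fib k x)
      have "push A2 = singleton_bracket T' k x"
        using cod.bsub_singleton[OF pre_bracket_push[OF glued_pre[OF A(2)]] fib(1)] push_mono[OF le(1)] fib(3) by simp
      then show ?thesis using in_F[OF fib(1,2,4)] F_if_push[OF fib(1) A(2)] by blast
    next
      case sat
      show ?thesis
      \<comment> \<open>With equal images, \<open>A2\<close> must be unsaturated; the image is then
        a singleton bracket, and \<open>A1\<close> is refined inside a member of \<open>F\<close>.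
        Otherwise the strict inclusion survives in \<open>D\<close>, and a refinement found there is
        pulled back.\<close>
      proof (cases "push A2 = push A1")
        case True
        from A(2) show ?thesis
        proof (cases rule: glued_cases)
          case sat2: sat
          then show ?thesis using True sat le by simp
        next
          case (fib k x)
          have "push A1 = singleton_bracket T' k x" using True fib(3) by simp
          then have "A1 \<in> brs (F (fiber k x))" using F_if_push[OF fib(1) A(1)] by simp
          then show ?thesis using in_F[OF fib(1) _ _ fib(4)] fib(2) bsub_length[OF le(1)] by simp
        qed
      next
        case False
        then have "push A2 \<sqsubset> push A1" using push_mono[OF le(1)] by (simp add: bpsub_def)
        moreover have "\<rho> v \<in> last (push A1)" using v glued_nonempty[OF A(1)] by (simp add: last_push)
        ultimately obtain S where S: "S \<in> brs D" "butlast S = push (butlast A1)" "S \<sqsubset> push A1" "\<rho> v \<in> last S"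
          using D.refine[OF glued_push[OF A(1)] glued_push[OF A(2)]] over by auto
        have "pull S \<in> brs glued" using pull_glued[OF S(1)] by simp
        moreover have "butlast (pull S) = butlast A1" using S(2) arg_cong[OF sat, of butlast] by simp
        moreover have "pull S \<sqsubseteq> A1" using S(3) pull_mono[of S "push A1"] sat by (simp add: bpsub_def)
        moreover have "pull S \<noteq> A1"
          using S(3) push_pull[OF D.pre_bracket[OF S(1)]] by (auto simp: bpsub_def)
        moreover have "v \<in> last (pull S)"
        proof -
          have "\<exists>j. v \<in> level T j" using v pre_bracket_last_level[OF glued_pre[OF A(1)]] by blast
          then show ?thesis using S(4) D.brs_nonempty[OF S(1)] by (simp add: last_pull)
        qed
        ultimately show ?thesis by (intro bexI[of _ "pull S"]) (simp_all add: bpsub_def)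
      qed
    qed
  qed
  show "butlast A1 = butlast A2 \<and> last A1 \<inter> last A2 = {}" if "(A1, A2) \<in> less_rel glued"
  proof -
    have A: "A1 \<in> glued_brs" "A2 \<in> glued_brs" "butlast A1 = butlast A2"
      using that by (auto simp: less_glued_iff)
    have "last A1 \<inter> last A2 = {}" if "(push A1, push A2) \<in> less_rel D"
      using D.less_over[OF that] disjoint_push glued_nonempty A by blast
    moreover have "last A1 \<inter> last A2 = {}"
      if "x \<in> level T' k" "(A1, A2) \<in> less_rel (F (fiber k x))" for k x
      using bracketing.less_over[OF F[OF that(1)] that(2)] by blast
    ultimately show ?thesis using A \<open>(A1, A2) \<in> less_rel glued\<close> unfolding less_glued_iff by blast
  qed
  show "(A1, A2) \<in> less_rel glued \<or> (A2, A1) \<in> less_rel glued"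
    if "A1 \<in> brs glued" "A2 \<in> brs glued" and over: "butlast A1 = butlast A2" and disj: "last A1 \<inter> last A2 = {}"
  proof -
    have A: "A1 \<in> glued_brs" "A2 \<in> glued_brs" using that by simp_all
    have ne: "last A1 \<noteq> {}" "last A2 \<noteq> {}" "A1 \<noteq> []" "A2 \<noteq> []"
      using A glued_pre pre_bracket_last glued_nonempty by blast+
    have fib: "(A1, A2) \<in> less_rel glued \<or> (A2, A1) \<in> less_rel glued"
      if x: "x \<in> level T' k" "length A1 = Suc k" "length A2 = Suc k"
        and F1: "A1 \<in> brs (F (fiber k x))" and F2: "A2 \<in> brs (F (fiber k x))" for k x
    proof -
      have "(A1, A2) \<in> less_rel (F (fiber k x)) \<or> (A2, A1) \<in> less_rel (F (fiber k x))"
        by (rule bracketing.less_total[OF F[OF x(1)] F1 F2 over disj])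
      then show ?thesis unfolding less_glued_iff using A over x F1 F2 by auto
    qed
    have not_le: "\<not> A1 \<sqsubseteq> A2" "\<not> A2 \<sqsubseteq> A1"
      using disj ne bsub_last[of A1 A2] bsub_last[of A2 A1] by blast+
    have len: "length A1 = length A2" using over ne by (metis append_butlast_last_id length_append_singleton)
    show ?thesis
    \<comment> \<open>Disjoint images are compared by \<open>D\<close>. Images that meet are nested,
      and since neither of the disjoint \<open>A1\<close>, \<open>A2\<close> contains the other,
      \<open>push_bsub_cases\<close> leaves only a common fiber.\<close>
    proof (cases "last (push A1) \<inter> last (push A2) = {}")
      case True
      then have "(push A1, push A2) \<in> less_rel D \<or> (push A2, push A1) \<in> less_rel D"
        using D.less_total[OF glued_push[OF A(1)] glued_push[OF A(2)]] over by simp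
      then show ?thesis using A over by (auto simp: less_glued_iff)
    next
      case False
      then have "push A1 \<sqsubseteq> push A2 \<or> push A2 \<sqsubseteq> push A1"
        using D.nested[OF glued_push[OF A(1)] glued_push[OF A(2)]] len by simp
      then show ?thesis
      proof
        assume "push A1 \<sqsubseteq> push A2"
        with A show ?thesis by (cases rule: push_bsub_cases) (use fib not_le in blast)+
      next
        assume "push A2 \<sqsubseteq> push A1"
        with A(2,1) show ?thesis by (cases rule: push_bsub_cases) (use fib not_le in blast)+
      qed
    qed
  qed
  show "(singleton_bracket T (Suc k) u1, singleton_bracket T (Suc k) u2) \<in> less_rel glued"
    if u: "u \<in> level T k" and s: "(u1, u2) \<in> sib T u"
  proof -
    let ?s = "singleton_bracket T (Suc k)"
    have u12: "u1 \<in> ch T u" "u2 \<in> ch T u" using dom.sib_ch[OF u] s by blast+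
    then have l: "u1 \<in> level T (Suc k)" "u2 \<in> level T (Suc k)" using level_SucI[OF u] by blast+
    have \<rho>u: "\<rho> u \<in> level T' k" using u map_level by blast
    have \<rho>12: "\<rho> u1 \<in> level T' (Suc k)" "\<rho> u2 \<in> level T' (Suc k)" using l map_level by blast+
    have F12: "?s u1 \<in> brs (F (fiber (Suc k) (\<rho> u1)))" "?s u2 \<in> brs (F (fiber (Suc k) (\<rho> u2)))"
      using singleton_F l by blast+
    have g: "?s u1 \<in> glued_brs" "?s u2 \<in> glued_brs"
      using F_glued[OF \<rho>12(1) F12(1)] F_glued[OF \<rho>12(2) F12(2)] by simp_all
    have over: "butlast (?s u1) = butlast (?s u2)" using u u12 by (simp add: dom.butlast_singleton)
    show ?thesis
    \<comment> \<open>\<open>map_sib\<close> respects the order only weakly: siblings may fall into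
      the same fiber, and then they are siblings in its subtree and ordered by
      \<open>F\<close>.\<close>
    proof (cases "\<rho> u1 = \<rho> u2")
      case False
      then have "(\<rho> u1, \<rho> u2) \<in> sib T' (\<rho> u)" using map_sib[OF u s] by blast
      then have "(push (?s u1), push (?s u2)) \<in> less_rel D"
        using D.less_sib[OF \<rho>u] l by (simp add: push_singleton)
      then show ?thesis using g over by (simp add: less_glued_iff)
    next
      case True
      let ?E = "fiber (Suc k) (\<rho> u1)"
      interpret bracket_subtree T ?E by (rule fiber_subtree[OF \<rho>12(1)])
      have \<rho>ch: "\<rho> u1 \<in> ch T' (\<rho> u)" by (rule map_ch[OF u u12(1)])
      have mem: "u \<in> ?E ! k" "u1 \<in> ?E ! Suc k" "u2 \<in> ?E ! Suc k"
        using fiber_nth_parent[OF \<rho>u \<rho>ch] fiber_nth[OF \<rho>12(1)] u l True by simp_all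
      then have "u \<in> level (subtree T ?E) k" by (simp add: level_subtree)
      moreover have "(u1, u2) \<in> sib (subtree T ?E) u"
        using s mem verts_iff[of u1] verts_iff[of u2] by (auto simp: subtree_def Let_def V_def)
      ultimately have "(singleton_bracket (subtree T ?E) (Suc k) u1, singleton_bracket (subtree T ?E) (Suc k) u2)
          \<in> less_rel (F ?E)"
        by (rule bracketing.less_sib[OF F[OF \<rho>12(1)]])
      then have "(?s u1, ?s u2) \<in> less_rel (F ?E)" using mem by (simp add: singleton_subtree)
      then show ?thesis unfolding less_glued_iff using g over F12 \<rho>12(1) True by auto
    qed
  qed
  show "(A1', A2') \<in> less_rel glued"
    if less: "(A1, A2) \<in> less_rel glued" and "A1' \<in> brs glued" "A2' \<in> brs glued"
      and over: "butlast A1' = butlast A2'" and sub: "A1' \<sqsubseteq> A1" "A2' \<sqsubseteq> A2"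
  proof -
    have A: "A1 \<in> glued_brs" "A2 \<in> glued_brs" using less by (auto simp: less_glued_iff)
    have A': "A1' \<in> glued_brs" "A2' \<in> glued_brs" using that by simp_all
    consider (D) "(push A1, push A2) \<in> less_rel D"
      | (F) k x where "x \<in> level T' k" "length A1 = Suc k" "length A2 = Suc k" "A1 \<in> brs (F (fiber k x))"
        "A2 \<in> brs (F (fiber k x))" "(A1, A2) \<in> less_rel (F (fiber k x))"
      using less unfolding less_glued_iff by blast
    then show ?thesis
    proof cases
      case D
      then have "(push A1', push A2') \<in> less_rel D"
        using D.less_mono[OF D glued_push[OF A'(1)] glued_push[OF A'(2)]] over
          push_mono[OF sub(1)] push_mono[OF sub(2)] by simp
      then show ?thesis using A' over by (simp add: less_glued_iff)
    next
      case (F k x)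
      \<comment> \<open>Passing to smaller brackets cannot change a singleton image, so the smaller
        pair stays in the same fiber.\<close>
      have "push A1' = singleton_bracket T' k x" "push A2' = singleton_bracket T' k x"
        using cod.bsub_singleton[OF pre_bracket_push[OF glued_pre[OF A'(1)]] F(1)]
          cod.bsub_singleton[OF pre_bracket_push[OF glued_pre[OF A'(2)]] F(1)]
          push_mono[OF sub(1)] push_mono[OF sub(2)] push_F[OF F(1,4,2)] push_F[OF F(1,5,3)] by simp_all
      then have mem: "A1' \<in> brs (F (fiber k x))" "A2' \<in> brs (F (fiber k x))"
        using F_if_push[OF F(1)] A' by blast+
      then have "(A1', A2') \<in> less_rel (F (fiber k x))"
        using bracketing.less_mono[OF gluing.F[OF gluing_axioms F(1)] F(6) mem over sub] by blast
      moreover have "length A1' = Suc k" "length A2' = Suc k"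
        using bsub_length[OF sub(1)] bsub_length[OF sub(2)] F(2,3) by simp_all
      ultimately show ?thesis unfolding less_glued_iff using A' over mem F(1) by blast
    qed
  qed
qed

lemma fibered_glued: "fibered_bracketing T T' \<rho> glued"
proof (intro fibered_bracketing.intro fibered_bracketing_axioms.intro)
  show "tree_map T T' \<rho>" by (rule tree_map_axioms)
  show "bracketing T glued" by (rule glued_bracketing)
  show fib: "fiber k x \<in> brs glued" if "x \<in> level T' k" for k x
    using pull_glued[OF D.singleton_brs[OF that]] by simp
  fix k x x1 x2
  assume x: "x \<in> level T' k" and s: "(x1, x2) \<in> sib T' x"
  have x12: "x1 \<in> ch T' x" "x2 \<in> ch T' x" using cod.sib_ch[OF x] s by blast+
  then have l: "x1 \<in> level T' (Suc k)" "x2 \<in> level T' (Suc k)" using level_SucI[OF x] by blast+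
  have "(singleton_bracket T' (Suc k) x1, singleton_bracket T' (Suc k) x2) \<in> less_rel D"
    by (rule D.less_sib[OF x s])
  then have "(push (fiber (Suc k) x1), push (fiber (Suc k) x2)) \<in> less_rel D"
    using l by (simp add: push_pull cod.singleton_pre_bracket)
  moreover have "butlast (fiber (Suc k) x1) = butlast (fiber (Suc k) x2)"
    using butlast_fiber[OF x] x12 by metis
  ultimately show "(fiber (Suc k) x1, fiber (Suc k) x2) \<in> less_rel glued"
    using fib[OF l(1)] fib[OF l(2)] by (simp add: less_glued_iff)
qed

section \<open>Recovering both components from the glued bracketing\<close>

lemma push_bracketing_glued: "push_bracketing glued = D"
proof (rule bracketing_eqI)
  interpret G: fibered_bracketing T T' \<rho> glued by (rule fibered_glued)
  interpret P: bracketing T' "push_bracketing glued" by (rule G.push_bracketing)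
  have mem: "S \<in> brs (push_bracketing glued) \<longleftrightarrow> S \<in> brs D" for S
  proof (cases "pre_bracket T' S")
    case True
    then show ?thesis
      using brs_push_bracketing[OF True, of glued] pull_glued[of S] glued_push[of "pull S"] push_pull[OF True] by auto
  next
    case False
    then show ?thesis using P.pre_bracket D.pre_bracket by blast
  qed
  show "S \<in> brs (push_bracketing glued) \<longleftrightarrow> S \<in> brs D" for S by (rule mem)
  fix S1 S2
  show "(S1, S2) \<in> less_rel (push_bracketing glued) \<longleftrightarrow> (S1, S2) \<in> less_rel D"
  proof (cases "S1 \<in> brs D \<and> S2 \<in> brs D")
    case False
    then show ?thesis using P.less_brs D.less_brs mem by blast
  next
    case True
    then have S: "S1 \<in> brs D" "S2 \<in> brs D" by auto
    note pre = D.pre_bracket[OF S(1)] D.pre_bracket[OF S(2)]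
    note pp = push_pull[OF pre(1)] push_pull[OF pre(2)]
    have "(S1, S2) \<in> less_rel D" if "(pull S1, pull S2) \<in> less_rel glued"
    proof -
      consider "(push (pull S1), push (pull S2)) \<in> less_rel D"
        | k x where "x \<in> level T' k" "length (pull S1) = Suc k" "length (pull S2) = Suc k"
          "pull S1 \<in> brs (F (fiber k x))" "pull S2 \<in> brs (F (fiber k x))" "(pull S1, pull S2) \<in> less_rel (F (fiber k x))"
        using \<open>(pull S1, pull S2) \<in> less_rel glued\<close> unfolding less_glued_iff by blast
      then show ?thesis
      proof cases
        case 1
        then show ?thesis by (simp add: pp)
      next
        case 2
        \<comment> \<open>Saturated brackets inside one fiber coincide, so between saturated
          brackets only the first key of the lexicographic order can act.\<close>
        then have "push (pull S1) = push (pull S2)" using push_F by metis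
        then have "pull S1 = pull S2" by (simp add: pp)
        then show ?thesis using 2 bracketing.less_irrefl[OF F[OF 2(1)]] by simp
      qed
    qed
    moreover have "(pull S1, pull S2) \<in> less_rel glued" if "(S1, S2) \<in> less_rel D"
      using that D.less_over[OF that] pull_glued[OF S(1)] pull_glued[OF S(2)] by (simp add: less_glued_iff pp)
    ultimately show ?thesis using less_push_bracketing[OF pre] by blast
  qed
qed

text \<open>A bracket inside a prefix of the fiber lies in the fiber of an ancestor \<open>y\<close>
  on its own level, so its image is the singleton bracket of \<open>y\<close>. For two such brackets
  with a common truncation the order of \<open>D\<close> is silent by irreflexivity, and what
  remains is \<open>F\<close> at \<open>y\<close>, a truncation of \<open>F\<close> at
  \<open>x\<close>.\<close>

lemma restrict_glued:
  assumes x: "x \<in> level T' k"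
  shows "restrict_bracketing glued (fiber k x) = F (fiber k x)"
proof (rule bracketing_eqI)
  interpret G: fibered_bracketing T T' \<rho> glued by (rule fibered_glued)
  have anc: "\<exists>y \<in> level T' (length A - 1). take (length A) (fiber k x) = fiber (length A - 1) y \<and>
      truncate_bracketing (length A) (F (fiber k x)) = F (fiber (length A - 1) y)"
    if "A \<noteq> []" "A \<sqsubseteq> take (length A) (fiber k x)" for A
  proof -
    define j where "j = length A - 1"
    have j: "length A = Suc j" using that(1) by (simp add: j_def)
    then have "j \<le> k" using bsub_take_length[OF that(2)] by simp
    then show ?thesis using F_ancestor[OF x, of j] j by simp
  qed
  have push: "push A = singleton_bracket T' (length A - 1) y"
    if "A \<in> glued_brs" "A \<sqsubseteq> take (length A) (fiber k x)"
      "y \<in> level T' (length A - 1)" "take (length A) (fiber k x) = fiber (length A - 1) y" for A y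
    using that bsub_fiber_iff[OF that(3) glued_pre[OF that(1)]] by simp
  fix A
  show "A \<in> brs (restrict_bracketing glued (fiber k x)) \<longleftrightarrow> A \<in> brs (F (fiber k x))"
  proof
    assume "A \<in> brs (restrict_bracketing glued (fiber k x))"
    then have A: "A \<in> glued_brs" "A \<sqsubseteq> take (length A) (fiber k x)" by (simp_all add: brs_restrict_bracketing)
    then obtain y where y: "y \<in> level T' (length A - 1)" "take (length A) (fiber k x) = fiber (length A - 1) y"
      "truncate_bracketing (length A) (F (fiber k x)) = F (fiber (length A - 1) y)"
      using anc glued_nonempty by blast
    then have "A \<in> brs (F (fiber (length A - 1) y))" using F_if_push[OF y(1) A(1)] push[OF A y(1,2)] by blast
    then show "A \<in> brs (F (fiber k x))" unfolding y(3)[symmetric] by (simp add: brs_truncate)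
  next
    assume A: "A \<in> brs (F (fiber k x))"
    have ne: "A \<noteq> []" using F_pre(1)[OF x A] pre_bracket_nonempty by blast
    obtain y where y: "y \<in> level T' (length A - 1)"
      "truncate_bracketing (length A) (F (fiber k x)) = F (fiber (length A - 1) y)"
      using anc[OF ne F_pre(2)[OF x A]] by blast
    have "A \<in> brs (F (fiber (length A - 1) y))" using A unfolding y(2)[symmetric] by (simp add: brs_truncate)
    then have "A \<in> glued_brs" using F_glued[OF y(1)] ne by simp
    then show "A \<in> brs (restrict_bracketing glued (fiber k x))"
      using F_pre(2)[OF x A] by (simp add: brs_restrict_bracketing)
  qed
  fix A1 A2
  show "(A1, A2) \<in> less_rel (restrict_bracketing glued (fiber k x)) \<longleftrightarrow> (A1, A2) \<in> less_rel (F (fiber k x))"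
  proof
    assume "(A1, A2) \<in> less_rel (restrict_bracketing glued (fiber k x))"
    then have less: "(A1, A2) \<in> less_rel glued"
      and sub: "A1 \<sqsubseteq> take (length A1) (fiber k x)" "A2 \<sqsubseteq> take (length A2) (fiber k x)"
      by (simp_all add: less_restrict_bracketing)
    have A: "A1 \<in> glued_brs" "A2 \<in> glued_brs" "butlast A1 = butlast A2" using less by (auto simp: less_glued_iff)
    have len: "length A1 = length A2" using A glued_nonempty by (metis append_butlast_last_id length_append_singleton)
    obtain y where y: "y \<in> level T' (length A1 - 1)" "take (length A1) (fiber k x) = fiber (length A1 - 1) y"
      "truncate_bracketing (length A1) (F (fiber k x)) = F (fiber (length A1 - 1) y)"
      using anc[OF glued_nonempty[OF A(1)] sub(1)] by blast
    have pe: "push A1 = singleton_bracket T' (length A1 - 1) y" "push A2 = singleton_bracket T' (length A1 - 1) y"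
      using push[OF A(1) sub(1) y(1,2)] push[OF A(2) sub(2), of y] y len by simp_all
    then have "(push A1, push A2) \<notin> less_rel D" using D.less_irrefl by simp
    then obtain j z where z: "z \<in> level T' j" "length A1 = Suc j" "A1 \<in> brs (F (fiber j z))"
      "(A1, A2) \<in> less_rel (F (fiber j z))" using less unfolding less_glued_iff by blast
    have "A1 \<in> brs (F (fiber (length A1 - 1) y))" by (rule F_if_push[OF y(1) A(1) pe(1)])
    then have "z = y" using F_unique[of y j z j A1] y(1) z by simp
    then have "(A1, A2) \<in> less_rel (F (fiber (length A1 - 1) y))" using z by simp
    then show "(A1, A2) \<in> less_rel (F (fiber k x))" unfolding y(3)[symmetric] by (simp add: less_truncate)
  next
    assume less: "(A1, A2) \<in> less_rel (F (fiber k x))"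
    have A: "A1 \<in> brs (F (fiber k x))" "A2 \<in> brs (F (fiber k x))"
      using bracketing.less_brs[OF F[OF x]] less by blast+
    have ne: "A1 \<noteq> []" "A2 \<noteq> []" using F_pre(1)[OF x] A pre_bracket_nonempty by blast+
    have over: "butlast A1 = butlast A2" using bracketing.less_over[OF F[OF x] less] by blast
    have len: "length A2 = length A1" using over ne by (metis append_butlast_last_id length_append_singleton)
    obtain j where j: "length A1 = Suc j" using ne by (cases A1) auto
    obtain y where y: "y \<in> level T' j" "truncate_bracketing (length A1) (F (fiber k x)) = F (fiber j y)"
      using anc[OF ne(1) F_pre(2)[OF x A(1)]] j by auto
    have "(A1, A2) \<in> less_rel (F (fiber j y))" using less len unfolding y(2)[symmetric] by (simp add: less_truncate)
    moreover have "A1 \<in> brs (F (fiber j y))" "A2 \<in> brs (F (fiber j y))"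
      using A len unfolding y(2)[symmetric] by (simp_all add: brs_truncate)
    moreover have "A1 \<in> glued_brs" "A2 \<in> glued_brs"
      using F_glued[OF y(1)] calculation j len by simp_all
    ultimately have "(A1, A2) \<in> less_rel glued" unfolding less_glued_iff using over y(1) j len by auto
    then show "(A1, A2) \<in> less_rel (restrict_bracketing glued (fiber k x))"
      using F_pre(2)[OF x A(1)] F_pre(2)[OF x A(2)] by (simp add: less_restrict_bracketing)
  qed
qed

end

section \<open>The structure of collisions\<close>

lemma funpow_butlast: "(butlast ^^ l) A = take (length A - l) A"
  by (induction l) (simp_all add: butlast_take)

lemma rooted_plane_tree_ptree:
  assumes "rooted_plane_tree T"
  shows "ptree T"
proof
  note T = assms[unfolded rooted_plane_tree_def]
  have arcs: "arcs T \<subseteq> verts T \<times> verts T" using T by blast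
  show "finite (arcs T)" using T by (meson finite_SigmaI finite_subset)
  show "root T \<notin> ch T u" for u using T by (simp add: ch_def)
  show "u = u'" if "v \<in> ch T u" "v \<in> ch T u'" for u u' v
  proof -
    have v: "(u, v) \<in> arcs T" "(u', v) \<in> arcs T" using that by (simp_all add: ch_def)
    then have "v \<in> verts T - {root T}" using T by blast
    then have "\<exists>!u. (u, v) \<in> arcs T" using T by blast
    then show ?thesis using v by blast
  qed
  show "sib T u \<subseteq> ch T u \<times> ch T u" if "u \<in> level T k" for u k
  proof -
    have "u \<in> verts T" using that T arcs by (cases k) (auto simp: level_Suc ch_def)
    then show ?thesis using T by blast
  qed
qed

section \<open>Trivial brackets and bracketings made of few brackets\<close>

context ptree
begin

lemma is_singleton_bracketI [intro]: "u \<in> level T k \<Longrightarrow> is_singleton_bracket T (singleton_bracket T k u)"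
  by (auto simp: is_singleton_bracket_def)

lemma is_singleton_bracketE:
  assumes "is_singleton_bracket T A"
  obtains k u where "u \<in> level T k" "A = singleton_bracket T k u" "last A = {u}" "length A = Suc k"
proof -
  obtain k u where "u \<in> level T k" "A = singleton_bracket T k u"
    using assms by (auto simp: is_singleton_bracket_def)
  then show thesis using that last_singleton by simp
qed

lemma singleton_nonempty: "is_singleton_bracket T A \<Longrightarrow> A \<noteq> []"
  by (auto elim: is_singleton_bracketE)

lemma is_singleton_pre_bracket: "is_singleton_bracket T A \<Longrightarrow> pre_bracket T A"
  by (auto elim!: is_singleton_bracketE intro: singleton_pre_bracket)

lemma is_singleton_butlast:
  assumes "is_singleton_bracket T A" "butlast A \<noteq> []"
  shows "is_singleton_bracket T (butlast A)"
proof -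
  obtain k u where A: "u \<in> level T k" "A = singleton_bracket T k u" "length A = Suc k"
    using assms(1) by (rule is_singleton_bracketE)
  obtain j where j: "k = Suc j" using assms(2) A(3) by (cases k; cases A rule: rev_cases) auto
  then obtain p where "p \<in> level T j" "u \<in> ch T p" using A by (auto simp: level_Suc)
  then show ?thesis using A j by (auto simp: butlast_singleton)
qed

lemma is_singleton_take:
  assumes "is_singleton_bracket T A" "0 < j"
  shows "is_singleton_bracket T (take j A)"
  using assms
proof (induction "length A - j" arbitrary: A)
  case (Suc d)
  have "butlast A \<noteq> []" using Suc.hyps(2) Suc.prems by (cases A rule: rev_cases) auto
  then have "is_singleton_bracket T (take j (butlast A))"
    using Suc.hyps is_singleton_butlast Suc.prems by simp
  then show ?case using Suc.hyps(2) by (simp add: take_butlast)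
qed simp

lemma is_max_bracket_iff: "is_max_bracket T A \<longleftrightarrow> (\<exists>k. level T k \<noteq> {} \<and> A = max_bracket T k)"
  unfolding is_max_bracket_def level_nonempty_iff by blast

lemma bsub_is_max:
  "is_max_bracket T A' \<Longrightarrow> pre_bracket T A \<Longrightarrow> length A = length A' \<Longrightarrow> A \<sqsubseteq> A'"
  using bsub_max[of A] by (auto simp: is_max_bracket_def)

lemma is_max_butlast: "is_max_bracket T A \<Longrightarrow> butlast A \<noteq> [] \<Longrightarrow> is_max_bracket T (butlast A)"
proof -
  assume "is_max_bracket T A" and ne: "butlast A \<noteq> []"
  then obtain k where k: "k \<le> depth T" "A = max_bracket T k" by (auto simp: is_max_bracket_def)
  then obtain j where "k = Suc j" using ne by (cases k) auto
  then show "is_max_bracket T (butlast A)" using k unfolding is_max_bracket_def by (intro exI[of _ j]) simp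
qed

lemma is_max_take: "is_max_bracket T A \<Longrightarrow> 0 < j \<Longrightarrow> is_max_bracket T (take j A)"
proof (induction "length A - j" arbitrary: A)
  case (Suc d)
  have "butlast A \<noteq> []" using Suc.hyps(2) Suc.prems by (cases A rule: rev_cases) auto
  then have "is_max_bracket T (take j (butlast A))"
    using Suc.hyps is_max_butlast Suc.prems by simp
  then show ?case using Suc.hyps(2) by (simp add: take_butlast)
qed simp

lemma last_over_singleton:
  assumes "pre_bracket T A" "butlast A = singleton_bracket T k u" "u \<in> level T k"
  shows "last A \<subseteq> ch T u"
proof
  fix v
  assume "v \<in> last A"
  moreover have "butlast A \<noteq> []" using assms by (auto simp flip: length_greater_0_conv)
  ultimately obtain p where "p \<in> last (butlast A)" "v \<in> ch T p"
    using pre_bracket_parent[OF assms(1)] by blast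
  then show "v \<in> ch T u" using assms by (simp add: last_singleton)
qed

end

context bracketing
begin

lemma length_over: "A1 \<in> brs B \<Longrightarrow> A2 \<in> brs B \<Longrightarrow> butlast A1 = butlast A2 \<Longrightarrow> length A1 = length A2"
  using brs_nonempty by (metis append_butlast_last_id length_append_singleton)

lemma trivial_brs: "\<not> nontrivial T A \<Longrightarrow> A \<in> brs B"
  using max_brs singleton_brs unfolding nontrivial_def is_singleton_bracket_def is_max_bracket_iff by blast

text \<open>A maximum contains every bracket of its level, so no bracket is disjoint from
  it.\<close>

lemma less_not_max:
  assumes "(A1, A2) \<in> less_rel B"
  shows "\<not> is_max_bracket T A1" "\<not> is_max_bracket T A2"
proof -
  have A: "A1 \<in> brs B" "A2 \<in> brs B" using assms less_brs by blast+
  have disj: "last A1 \<inter> last A2 = {}" and len: "length A1 = length A2"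
    using less_over[OF assms] length_over[OF A] by blast+
  have ne: "last A1 \<noteq> {}" "last A2 \<noteq> {}" using A pre_bracket pre_bracket_last by blast+
  show "\<not> is_max_bracket T A1"
    using bsub_last[OF bsub_is_max[OF _ pre_bracket[OF A(2)]] brs_nonempty[OF A(2)], of A1] len disj ne by auto
  show "\<not> is_max_bracket T A2"
    using bsub_last[OF bsub_is_max[OF _ pre_bracket[OF A(1)]] brs_nonempty[OF A(1)], of A2] len disj ne by auto
qed

lemma less_butlast_nonempty:
  assumes "(A1, A2) \<in> less_rel B"
  shows "butlast A1 \<noteq> []"
proof
  assume but: "butlast A1 = []"
  have A: "A1 \<in> brs B" "A2 \<in> brs B" using assms less_brs by blast+
  have "butlast A2 = []" using less_over[OF assms] but by simp
  then have "length A1 = Suc 0" "length A2 = Suc 0"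
    using but brs_nonempty[OF A(1)] brs_nonempty[OF A(2)]
    by (metis append_butlast_last_id append_Nil length_Cons list.size(3))+
  then have "A1 = A2" using A pre_bracket pre_bracket_length1 by metis
  then show False using assms less_irrefl by simp
qed

text \<open>The minimum arises with \<open>S = {}\<close>, a collision with \<open>S\<close> the tower over its fusion bracket.\<close>

lemma restrict_brs_bracketing:
  assumes S: "\<And>E. E \<in> S \<Longrightarrow> E \<in> brs B \<and> \<not> is_singleton_bracket T E \<and> butlast E \<noteq> [] \<and>
        (butlast E \<in> S \<or> is_singleton_bracket T (butlast E))"
    and S_cover: "\<And>E u v. E \<in> S \<Longrightarrow> u \<in> last E \<Longrightarrow> v \<in> ch T u \<Longrightarrow>
        \<exists>E' \<in> S. butlast E' = E \<and> v \<in> last E'"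
    and S_disjoint: "\<And>E1 E2. E1 \<in> S \<Longrightarrow> E2 \<in> S \<Longrightarrow> butlast E1 = butlast E2 \<Longrightarrow> E1 \<sqsubseteq> E2 \<Longrightarrow> E1 = E2"
  shows "bracketing T (restrict_brs B (S \<union> {A. \<not> nontrivial T A}))"
proof -
  let ?S = "S \<union> {A. \<not> nontrivial T A}"
  let ?R = "restrict_brs B ?S"
  have brs: "A \<in> brs ?R \<longleftrightarrow> A \<in> ?S" for A
    using S trivial_brs by (auto simp: restrict_brs_def)
  have sub: "A \<in> brs B" if "A \<in> ?S" for A using S trivial_brs that by blast
  have less: "(A1, A2) \<in> less_rel ?R \<longleftrightarrow> (A1, A2) \<in> less_rel B \<and> A1 \<in> ?S \<and> A2 \<in> ?S" for A1 A2
    by (simp add: restrict_brs_def)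
  have cases_S: "A \<in> ?S \<longleftrightarrow> A \<in> S \<or> is_singleton_bracket T A \<or> is_max_bracket T A" for A
    by (auto simp: nontrivial_def)
  show ?thesis
  proof
    fix A A1 A2 A3 A1' A2' :: "'v bracket" and k u v u1 u2
    show "A \<in> brs ?R \<Longrightarrow> pre_bracket T A" unfolding brs using pre_bracket sub by blast
    show "less_rel ?R \<subseteq> brs ?R \<times> brs ?R" using less_brs by (auto simp: restrict_brs_def)
    show "(A, A) \<notin> less_rel ?R" by (simp add: less less_irrefl)
    show "(A1, A2) \<in> less_rel ?R \<Longrightarrow> (A2, A3) \<in> less_rel ?R \<Longrightarrow> (A1, A3) \<in> less_rel ?R"
      unfolding less using less_trans by blast
    show "level T k \<noteq> {} \<Longrightarrow> max_bracket T k \<in> brs ?R"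
      unfolding brs cases_S is_max_bracket_iff by blast
    show "u \<in> level T k \<Longrightarrow> singleton_bracket T k u \<in> brs ?R"
      unfolding brs cases_S by blast
    show "A \<in> brs ?R \<Longrightarrow> butlast A \<noteq> [] \<Longrightarrow> butlast A \<in> brs ?R"
      unfolding brs cases_S using S is_singleton_butlast is_max_butlast by blast
    show "A1 \<in> brs ?R \<Longrightarrow> A2 \<in> brs ?R \<Longrightarrow> length A1 = length A2 \<Longrightarrow>
      last A1 \<inter> last A2 \<noteq> {} \<Longrightarrow> A1 \<sqsubseteq> A2 \<or> A2 \<sqsubseteq> A1"
      unfolding brs using nested sub by blast
    show "\<exists>A' \<in> brs ?R. butlast A' = A \<and> v \<in> last A'"
      if A: "A \<in> brs ?R" and u: "u \<in> last A" and v: "v \<in> ch T u"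
    proof -
      consider "A \<in> S" | "is_singleton_bracket T A" | "is_max_bracket T A"
        using A unfolding brs cases_S by blast
      then show ?thesis
      proof cases
        case 1
        obtain E where "E \<in> S" "butlast E = A" "v \<in> last E" using S_cover[OF 1 u v] by blast
        then show ?thesis by (intro bexI[of _ E]) (simp_all add: brs)
      next
        case 2
        then obtain k w where w: "w \<in> level T k" "A = singleton_bracket T k w" "last A = {w}"
          by (rule is_singleton_bracketE)
        then have "u = w" using u by simp
        then have vk: "v \<in> level T (Suc k)" using v w level_SucI by fast
        show ?thesis
        proof (intro bexI conjI)
          show "singleton_bracket T (Suc k) v \<in> brs ?R" unfolding brs cases_S using vk by blast
          show "butlast (singleton_bracket T (Suc k) v) = A" using w v \<open>u = w\<close> by (simp add: butlast_singleton)
          show "v \<in> last (singleton_bracket T (Suc k) v)" using vk by (simp add: last_singleton)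
        qed
      next
        case 3
        then obtain k where k: "level T k \<noteq> {}" "A = max_bracket T k" by (auto simp: is_max_bracket_iff)
        then have vk: "v \<in> level T (Suc k)" using u v by (auto simp: level_Suc)
        show ?thesis
        proof (intro bexI conjI)
          show "max_bracket T (Suc k) \<in> brs ?R" unfolding brs cases_S is_max_bracket_iff using vk by blast
          show "butlast (max_bracket T (Suc k)) = A" using k by simp
          show "v \<in> last (max_bracket T (Suc k))" using vk by simp
        qed
      qed
    qed
    show "\<exists>A3 \<in> brs ?R. butlast A3 = butlast A1 \<and> A3 \<sqsubset> A1 \<and> v \<in> last A3"
      if A: "A1 \<in> brs ?R" "A2 \<in> brs ?R" "butlast A2 = butlast A1" "A2 \<sqsubset> A1" and v: "v \<in> last A1"
    proof -
      have AB: "A1 \<in> brs B" "A2 \<in> brs B" using A sub unfolding brs by blast+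
      have le: "A2 \<sqsubseteq> A1" "A2 \<noteq> A1" using A(4) by (simp_all add: bpsub_def)
      have len: "length A2 = length A1" using le bsub_length by blast
      have ne: "butlast A1 \<noteq> []"
      proof
        assume "butlast A1 = []"
        then have "length A1 = Suc 0"
          using brs_nonempty[OF AB(1)] by (metis append_butlast_last_id append_Nil length_Cons list.size(3))
        then have "A1 = A2" using len AB pre_bracket pre_bracket_length1 by metis
        then show False using le by simp
      qed
      obtain u where u: "u \<in> last (butlast A1)" "v \<in> ch T u"
        using pre_bracket_parent[OF pre_bracket[OF AB(1)] ne v] by blast
      show ?thesis
      proof (cases "is_singleton_bracket T (butlast A1)")
        case True
        then obtain k w where w: "w \<in> level T k" "butlast A1 = singleton_bracket T k w" "last (butlast A1) = {w}"
          by (rule is_singleton_bracketE)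
        have vw: "v \<in> ch T w" using u w by simp
        then have vk: "v \<in> level T (Suc k)" using w level_SucI by fast
        \<comment> \<open>Over a singleton, the singleton bracket of \<open>v\<close> refines
          \<open>A1\<close>. It is strictly smaller, for otherwise \<open>A2\<close> could not fit
          strictly below \<open>A1\<close>.\<close>
        let ?A = "singleton_bracket T (Suc k) v"
        have over: "butlast ?A = butlast A1" using w vw by (simp add: butlast_singleton)
        have "?A \<sqsubseteq> A1"
          using over v vk brs_nonempty[OF AB(1)]
          by (intro bsub_over) (auto simp: last_singleton simp flip: length_greater_0_conv)
        moreover have "?A \<noteq> A1" using bsub_singleton[OF pre_bracket[OF AB(2)] vk] le by auto
        moreover have "?A \<in> brs ?R" unfolding brs cases_S using vk by blast
        ultimately show ?thesis using over vk by (intro bexI[of _ ?A]) (simp_all add: bpsub_def last_singleton)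
      next
        case False
        then have ns: "\<not> is_singleton_bracket T A1" "\<not> is_singleton_bracket T A2"
          using is_singleton_butlast[of A1] is_singleton_butlast[of A2] ne A(3) by auto
        \<comment> \<open>\<open>A2\<close> is now neither singleton nor maximum, so it lies in
          \<open>S\<close>. Brackets of \<open>S\<close> over one truncation form an antichain,
          which forces \<open>A1\<close> to be a maximum outside \<open>S\<close>; the bracket of
          \<open>S\<close> covering \<open>v\<close> then refines it.\<close>
        have "\<not> is_max_bracket T A2"
          using bsub_is_max[OF _ pre_bracket[OF AB(1)], of A2] len le bsub_antisym by auto
        then have A2S: "A2 \<in> S" using A(2) ns unfolding brs cases_S by blast
        then have P: "butlast A1 \<in> S" using S[OF A2S] A(3) False by simp
        have "A1 \<notin> S" using S_disjoint[OF A2S _ A(3) le(1)] le(2) by blast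
        then have max: "is_max_bracket T A1" using A(1) ns unfolding brs cases_S by blast
        obtain E where E: "E \<in> S" "butlast E = butlast A1" "v \<in> last E" using S_cover[OF P u] by blast
        have EB: "E \<in> brs B" using E S by blast
        have "E \<sqsubseteq> A1" using bsub_is_max[OF max pre_bracket[OF EB]] length_over[OF EB AB(1) E(2)] by simp
        moreover have "E \<noteq> A1" using E \<open>A1 \<notin> S\<close> by blast
        moreover have "E \<in> brs ?R" unfolding brs using E by blast
        ultimately show ?thesis using E by (intro bexI[of _ E]) (simp_all add: bpsub_def)
      qed
    qed
    show "(A1, A2) \<in> less_rel ?R \<Longrightarrow> butlast A1 = butlast A2 \<and> last A1 \<inter> last A2 = {}"
      unfolding less using less_over by blast
    show "A1 \<in> brs ?R \<Longrightarrow> A2 \<in> brs ?R \<Longrightarrow> butlast A1 = butlast A2 \<Longrightarrow>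
      last A1 \<inter> last A2 = {} \<Longrightarrow> (A1, A2) \<in> less_rel ?R \<or> (A2, A1) \<in> less_rel ?R"
      unfolding less brs using less_total[OF sub sub] by blast
    show "(singleton_bracket T (Suc k) u1, singleton_bracket T (Suc k) u2) \<in> less_rel ?R"
      if u: "u \<in> level T k" "(u1, u2) \<in> sib T u"
    proof -
      have "u1 \<in> level T (Suc k)" "u2 \<in> level T (Suc k)"
        using sib_ch[OF u(1)] u(2) level_SucI[OF u(1)] by blast+
      then show ?thesis unfolding less cases_S using less_sib[OF u] by blast
    qed
    show "(A1, A2) \<in> less_rel ?R \<Longrightarrow> A1' \<in> brs ?R \<Longrightarrow> A2' \<in> brs ?R \<Longrightarrow>
      butlast A1' = butlast A2' \<Longrightarrow> A1' \<sqsubseteq> A1 \<Longrightarrow> A2' \<sqsubseteq> A2 \<Longrightarrow> (A1', A2') \<in> less_rel ?R"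
      unfolding less brs using less_mono[of A1 A2 A1' A2'] sub[of A1'] sub[of A2'] by blast
  qed
qed

end

section \<open>The tower of minimal brackets over a nonsingleton bracket\<close>

text \<open>For a collision these are the essential brackets, see
  \<open>essentials_eq_tower\<close>. Growing by minimal brackets, without reference to nontrivial
  ones above, yields a set that can be shown to form a bracketing before anything is known about the
  other brackets of \<open>C\<close>.\<close>

inductive_set tower :: "'v bracketing \<Rightarrow> 'v bracket \<Rightarrow> 'v bracket set" for C E0 where
  base: "E0 \<in> tower C E0"
| step: "E \<in> tower C E0 \<Longrightarrow> E' \<in> brs C \<Longrightarrow> butlast E' = E \<Longrightarrow>
    (\<And>A. A \<in> brs C \<Longrightarrow> butlast A = E \<Longrightarrow> A \<sqsubseteq> E' \<Longrightarrow> A = E') \<Longrightarrow> E' \<in> tower C E0"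

locale fused = bracketing T C for T :: "'v plane_tree" and C +
  fixes E0
  assumes E0_brs: "E0 \<in> brs C"
    and E0_not_singleton: "\<not> is_singleton_bracket T E0"
    and E0_over_singleton: "is_singleton_bracket T (butlast E0)"
begin

lemma E0_butlast: "butlast E0 \<noteq> []"
  by (rule singleton_nonempty[OF E0_over_singleton])

lemma tower_props:
  "E \<in> tower C E0 \<Longrightarrow> E \<in> brs C \<and> \<not> is_singleton_bracket T E \<and> butlast E \<noteq> [] \<and>
     (E = E0 \<or> butlast E \<in> tower C E0 \<and> length E0 < length E)"
proof (induction rule: tower.induct)
  case base
  then show ?case using E0_brs E0_not_singleton E0_butlast by simp
next
  case (step E E')
  have "E \<noteq> []" using step.IH brs_nonempty by blast
  moreover have "length E' = Suc (length E)"
    using step.hyps brs_nonempty by (metis append_butlast_last_id length_append_singleton)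
  ultimately show ?case using step is_singleton_butlast[of E'] by auto
qed

text \<open>The exception is genuine: the singleton brackets of the vertices in
  \<open>last E0\<close> lie strictly below \<open>E0\<close> and over the same truncation.\<close>

lemma tower_minimal:
  assumes "E \<in> tower C E0" "E \<noteq> E0" "A \<in> brs C" "butlast A = butlast E" "A \<sqsubseteq> E"
  shows "A = E"
  using assms by (cases rule: tower.cases) auto

lemma tower_cover:
  assumes "E \<in> tower C E0" "u \<in> last E" "v \<in> ch T u"
  shows "\<exists>E' \<in> tower C E0. butlast E' = E \<and> v \<in> last E'"
proof -
  have "E \<in> brs C" using tower_props assms(1) by blast
  then obtain E' where "E' \<in> brs C" "butlast E' = E" "v \<in> last E'"
    "\<And>A. A \<in> brs C \<Longrightarrow> butlast A = E \<Longrightarrow> A \<sqsubseteq> E' \<Longrightarrow> A = E'"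
    using minimal_over[OF _ assms(2,3)] by blast
  then show ?thesis using tower.step[OF assms(1)] by blast
qed

text \<open>A common vertex has a common parent, so the truncations meet and agree by induction. The
  two brackets are then nested over one truncation, and minimality of the larger one makes them
  equal. At the bottom, \<open>E0\<close> is the only element of its length.\<close>

lemma tower_disjoint:
  "E1 \<in> tower C E0 \<Longrightarrow> E2 \<in> tower C E0 \<Longrightarrow> length E1 = length E2 \<Longrightarrow> last E1 \<inter> last E2 \<noteq> {} \<Longrightarrow> E1 = E2"
proof (induction arbitrary: E2 rule: tower.induct)
  case base
  then show ?case using tower_props[of E2] by auto
next
  case (step E E')
  have E': "E' \<in> tower C E0" by (rule tower.step[OF step.hyps])
  note p1 = tower_props[OF E'] and p2 = tower_props[OF step.prems(1)]
  have "E' \<noteq> E0" using tower_props[OF step.hyps(1)] step.hyps(3) E0_over_singleton by auto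
  then have "length E0 < length E'" using p1 by blast
  then have E2: "E2 \<noteq> E0" "butlast E2 \<in> tower C E0" using p2 step.prems(2) by auto
  obtain v where v: "v \<in> last E'" "v \<in> last E2" using step.prems(3) by blast
  obtain u1 where u1: "u1 \<in> last (butlast E')" "v \<in> ch T u1"
    using pre_bracket_parent[of T E' v] pre_bracket p1 v by blast
  obtain u2 where u2: "u2 \<in> last (butlast E2)" "v \<in> ch T u2"
    using pre_bracket_parent[of T E2 v] pre_bracket p2 v by blast
  have "u1 = u2" by (rule parent_unique[OF u1(2) u2(2)])
  then have "last E \<inter> last (butlast E2) \<noteq> {}" using u1 u2 step.hyps(3) by blast
  moreover have "length E = length (butlast E2)" using step.hyps(3) step.prems(2) by auto
  ultimately have over: "butlast E' = butlast E2" using step.IH[OF E2(2)] step.hyps(3) by simp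
  have "E' \<sqsubseteq> E2 \<or> E2 \<sqsubseteq> E'" using nested[of E' E2] p1 p2 step.prems by blast
  then show ?case
    using tower_minimal[OF E' \<open>E' \<noteq> E0\<close>, of E2] tower_minimal[OF step.prems(1) E2(1), of E'] over p1 p2 by auto
qed

lemma tower_take:
  assumes "E \<in> tower C E0" "length E0 \<le> j"
  shows "take j E \<in> tower C E0"
  using assms
proof (induction rule: tower.induct)
  case (step E E')
  show ?case
  proof (cases "length E' \<le> j")
    case True
    then show ?thesis using tower.step[OF step.hyps] by simp
  next
    case False
    then have "take j E' = take j E" using step.hyps(3) by (auto simp: take_butlast)
    then show ?thesis using step by simp
  qed
qed (simp add: tower.base)

lemma take_tower: "E \<in> tower C E0 \<Longrightarrow> take (length E0) E = E0"
proof (induction rule: tower.induct)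
  case (step E E')
  have "length E0 \<le> length E" using tower_props[OF step.hyps(1)] by auto
  moreover have "length E' = Suc (length E)"
    using step.hyps brs_nonempty by (metis append_butlast_last_id length_append_singleton)
  ultimately have "take (length E0) E' = take (length E0) (butlast E')" by (simp add: take_butlast)
  then show ?case using step by simp
qed simp

text \<open>This is the bracketing to which the minimality of a collision will be applied.\<close>

lemma restrict_tower_bracketing:
  "bracketing T (restrict_brs C (tower C E0 \<union> {A. \<not> nontrivial T A}))"
proof (rule restrict_brs_bracketing)
  show "E \<in> brs C \<and> \<not> is_singleton_bracket T E \<and> butlast E \<noteq> [] \<and>
        (butlast E \<in> tower C E0 \<or> is_singleton_bracket T (butlast E))" if "E \<in> tower C E0" for E
    using tower_props[OF that] E0_over_singleton by auto
  show "E1 = E2" if "E1 \<in> tower C E0" "E2 \<in> tower C E0" "butlast E1 = butlast E2" "E1 \<sqsubseteq> E2" for E1 E2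
  proof (rule tower_disjoint[OF that(1,2)])
    have E1: "E1 \<in> brs C" using tower_props that(1) by blast
    show "length E1 = length E2" by (rule bsub_length[OF that(4)])
    show "last E1 \<inter> last E2 \<noteq> {}"
      using bsub_last[OF that(4)] brs_nonempty[OF E1] pre_bracket_last[OF pre_bracket[OF E1]] by blast
  qed
qed (rule tower_cover)

text \<open>Guarantees that the bracketing of the tower is not the minimum. If all tower elements
  were trivial, they would be maxima. By induction on the length every bracket over
  \<open>E0\<close> would be in the tower: it lies below a tower element that is both maximal and
  minimal over its truncation. This would apply to \<open>A\<close>, which is nontrivial.\<close>

lemma tower_nontrivial:
  assumes A: "A \<in> brs C" "nontrivial T A" "take (length E0) A = E0"
  shows "\<exists>N \<in> tower C E0. nontrivial T N"
proof (rule ccontr)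
  assume no: "\<not> (\<exists>N \<in> tower C E0. nontrivial T N)"
  have "A \<in> tower C E0" if "A \<in> brs C" "take (length E0) A = E0" for A
    using that
  proof (induction "length A" arbitrary: A rule: less_induct)
    case less
    show ?case
    proof (cases "length A \<le> length E0")
      case True
      then show ?thesis using less.prems by (simp add: tower.base)
    next
      case False
      then have ne: "butlast A \<noteq> []" using E0_butlast by (cases A rule: rev_cases; cases E0 rule: rev_cases) auto
      have "take (length E0) (butlast A) = E0" using less.prems False by (simp add: take_butlast)
      then have P: "butlast A \<in> tower C E0"
        using less.hyps[of "butlast A"] butlast_brs[OF less.prems(1) ne] brs_nonempty[OF less.prems(1)] by simp
      obtain v where v: "v \<in> last A" using pre_bracket_last[OF pre_bracket[OF less.prems(1)]] by blast
      obtain u where u: "u \<in> last (butlast A)" "v \<in> ch T u"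
        using pre_bracket_parent[OF pre_bracket[OF less.prems(1)] ne v] by blast
      obtain E where E: "E \<in> tower C E0" "butlast E = butlast A" using tower_cover[OF P u] by blast
      then have "is_max_bracket T E" using no tower_props[OF E(1)] by (auto simp: nontrivial_def)
      then have "A \<sqsubseteq> E"
        using bsub_is_max pre_bracket[OF less.prems(1)] length_over[OF less.prems(1)] tower_props[OF E(1)] E(2) by simp
      moreover have "E \<noteq> E0" using tower_props[OF P] E(2) E0_over_singleton by auto
      ultimately have "A = E" using tower_minimal[OF E(1)] less.prems(1) E(2) by simp
      then show ?thesis using E(1) by simp
    qed
  qed
  then show False using assms no by blast
qed

end

section \<open>Collisions consist of a tower and the trivial brackets\<close>

locale collision_tree =
  fixes T :: "'v plane_tree" and C
  assumes T: "rooted_plane_tree T" and C: "collision T C"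
begin

sublocale ptree T
  by (rule rooted_plane_tree_ptree[OF T])

sublocale bracketing T C
  using C is_bracketing_imp_bracketing[OF ptree_axioms] by (simp add: collision_def associahedron_def)

lemma associahedron_iff: "B \<in> associahedron T \<longleftrightarrow> bracketing T B"
  using is_bracketing_iff[OF ptree_axioms] by (simp add: associahedron_def)

lemma level_verts: "u \<in> level T k \<Longrightarrow> u \<in> verts T"
  using T unfolding rooted_plane_tree_def by (cases k) (auto simp: level_Suc ch_def)

lemma sib_total:
  assumes "u \<in> level T k" "x \<in> ch T u" "y \<in> ch T u" "x \<noteq> y"
  shows "(x, y) \<in> sib T u \<or> (y, x) \<in> sib T u"
  using T level_verts[OF assms(1)] assms(2-4)
  unfolding rooted_plane_tree_def strict_linear_order_on_def total_on_def by blast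

text \<open>Related singleton brackets lie over a common truncation, so they belong to siblings.
  Siblings are totally ordered, and asymmetry rules out the wrong direction. Thus singletons are
  ordered alike in every bracketing.\<close>

lemma singleton_less_sib:
  assumes less: "(A1, A2) \<in> less_rel C" and A: "is_singleton_bracket T A1" "is_singleton_bracket T A2"
  obtains k u u1 u2 where "u \<in> level T k" "(u1, u2) \<in> sib T u"
    "A1 = singleton_bracket T (Suc k) u1" "A2 = singleton_bracket T (Suc k) u2"
proof -
  have mem: "A1 \<in> brs C" "A2 \<in> brs C" using less less_brs by blast+
  have over: "butlast A1 = butlast A2" "last A1 \<inter> last A2 = {}" using less_over[OF less] by blast+
  have "is_singleton_bracket T (butlast A1)"
    by (rule is_singleton_butlast[OF A(1) less_butlast_nonempty[OF less]])
  then obtain k u where u: "u \<in> level T k" "butlast A1 = singleton_bracket T k u" "length (butlast A1) = Suc k"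
    by (rule is_singleton_bracketE)
  have len: "length A1 = Suc (Suc k)" "length A2 = Suc (Suc k)"
    using u(3) length_over[OF mem over(1)] by auto
  obtain u1 where u1: "u1 \<in> level T (Suc k)" "A1 = singleton_bracket T (Suc k) u1" "last A1 = {u1}"
    using A(1) len by (auto elim!: is_singleton_bracketE)
  obtain u2 where u2: "u2 \<in> level T (Suc k)" "A2 = singleton_bracket T (Suc k) u2" "last A2 = {u2}"
    using A(2) len by (auto elim!: is_singleton_bracketE)
  have ch: "u1 \<in> ch T u" "u2 \<in> ch T u"
    using last_over_singleton[OF pre_bracket[OF mem(1)] u(2,1)] last_over_singleton[OF pre_bracket[OF mem(2)] _ u(1)]
      over(1) u u1 u2 by auto
  have "u1 \<noteq> u2" using over u1 u2 by auto
  then have "(u1, u2) \<in> sib T u \<or> (u2, u1) \<in> sib T u" using sib_total[OF u(1) ch] by blast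
  moreover have "(u2, u1) \<notin> sib T u" using less_sib[OF u(1)] u1 u2 less_asym[OF less] by blast
  ultimately show thesis using that u(1) u1(2) u2(2) by blast
qed

lemma trivial_bracketing:
  "bracketing T (restrict_brs C {A. \<not> nontrivial T A})"
proof -
  have "bracketing T (restrict_brs C ({} \<union> {A. \<not> nontrivial T A}))"
    by (rule restrict_brs_bracketing) blast+
  then show ?thesis by simp
qed

text \<open>Trivial brackets occur in every bracketing, maxima are comparable to nothing, and the
  order of singletons is dictated by the siblings.\<close>

lemma trivial_is_min: "is_min_bracketing T (restrict_brs C {A. \<not> nontrivial T A})" (is "is_min_bracketing T ?M")
  unfolding is_min_bracketing_def associahedron_iff
proof (intro conjI ballI)
  show "bracketing T ?M" by (rule trivial_bracketing)
  fix B
  assume "B \<in> associahedron T"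
  then interpret B: bracketing T B by (simp add: associahedron_iff)
  have "brs ?M \<subseteq> brs B" using B.trivial_brs by (auto simp: restrict_brs_def)
  moreover have "(A1, A2) \<in> less_rel B" if "(A1, A2) \<in> less_rel ?M" for A1 A2
  proof -
    have less: "(A1, A2) \<in> less_rel C" "\<not> nontrivial T A1" "\<not> nontrivial T A2"
      using that by (auto simp: restrict_brs_def)
    then have "is_singleton_bracket T A1" "is_singleton_bracket T A2"
      using less_not_max[OF less(1)] by (auto simp: nontrivial_def)
    then obtain k u u1 u2 where "u \<in> level T k" "(u1, u2) \<in> sib T u"
      "A1 = singleton_bracket T (Suc k) u1" "A2 = singleton_bracket T (Suc k) u2"
      by (rule singleton_less_sib[OF less(1)])
    then show ?thesis using B.less_sib by simp
  qed
  ultimately show "bk_le ?M B"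
    using bracketing_bk_le_iff[OF trivial_bracketing B.bracketing_axioms] by auto
qed

lemma not_min_if_nontrivial:
  assumes "A \<in> brs B" "nontrivial T A"
  shows "\<not> is_min_bracketing T B"
proof
  assume "is_min_bracketing T B"
  then have "bk_le B (restrict_brs C {A. \<not> nontrivial T A})"
    using trivial_is_min by (simp add: is_min_bracketing_def)
  then show False using assms by (auto simp: bk_le_def restrict_brs_def)
qed

text \<open>Without nontrivial brackets, \<open>C\<close> would coincide with the minimum.\<close>

lemma ex_nontrivial: "\<exists>A \<in> brs C. nontrivial T A"
proof (rule ccontr)
  assume no: "\<not> (\<exists>A \<in> brs C. nontrivial T A)"
  then have "less_rel C \<inter> {A. \<not> nontrivial T A} \<times> {A. \<not> nontrivial T A} = less_rel C"
    and "brs C \<inter> {A. \<not> nontrivial T A} = brs C" using less_brs by blast+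
  then have "restrict_brs C {A. \<not> nontrivial T A} = C" by (simp add: restrict_brs_def)
  then show False using C trivial_is_min by (simp add: collision_def)
qed

lemma below_nontrivial_iff:
  "below_nontrivial T C E \<longleftrightarrow> (\<exists>A \<in> brs C. nontrivial T A \<and> E = take (length E) A)"
proof
  assume "below_nontrivial T C E"
  then obtain A l where A: "A \<in> brs C" "nontrivial T A" "E = take (length A - l) A"
    by (auto simp: below_nontrivial_def funpow_butlast)
  then have "E = take (length E) A" by (metis length_take min.cobounded2 min_def take_all_iff take_take)
  then show "\<exists>A \<in> brs C. nontrivial T A \<and> E = take (length E) A" using A by blast
next
  assume "\<exists>A \<in> brs C. nontrivial T A \<and> E = take (length E) A"
  then obtain A where A: "A \<in> brs C" "nontrivial T A" "E = take (length E) A" by blast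
  then have "length E \<le> length A" by (metis length_take min.cobounded1)
  then have "E = (butlast ^^ (length A - length E)) A" using A(3) by (simp add: funpow_butlast)
  then show "below_nontrivial T C E" using A unfolding below_nontrivial_def by blast
qed

text \<open>The shortest nonsingleton prefix of any nontrivial bracket of \<open>C\<close> is a
  fusion bracket.\<close>

lemma ex_fusion_bracket: "\<exists>E. is_fusion_bracket T C E"
proof -
  obtain A where A: "A \<in> brs C" "nontrivial T A" using ex_nontrivial by blast
  \<comment> \<open>The empty prefix is not a singleton bracket either, so \<open>j = 0\<close> has
    to be excluded by hand.\<close>
  define P where "P j \<longleftrightarrow> 0 < j \<and> \<not> is_singleton_bracket T (take j A)" for j
  have "P (length A)" using A brs_nonempty by (simp add: P_def nontrivial_def)
  then obtain j where j: "P j" and least: "\<And>i. i < j \<Longrightarrow> \<not> P i"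
    using ex_least_nat_le[of P "length A"] by (metis nat_less_le)
  have lenA: "j \<le> length A"
  proof (rule ccontr)
    assume "\<not> j \<le> length A"
    then show False using least[of "length A"] \<open>P (length A)\<close> by simp
  qed
  let ?E = "take j A"
  have E: "?E \<in> brs C" using take_brs[OF A(1)] j by (simp add: P_def)
  \<comment> \<open>The only 0-bracket is the singleton of the root. Hence the prefix one step
    shorter is nonempty and, by the choice of \<open>j\<close>, a singleton bracket.\<close>
  have "j \<noteq> Suc 0"
  proof
    assume "j = Suc 0"
    then have "length ?E = Suc 0" using lenA by simp
    then have "?E = singleton_bracket T 0 (root T)"
      using pre_bracket_length1[OF pre_bracket[OF E]] by simp
    then have "is_singleton_bracket T ?E" using is_singleton_bracketI[of "root T" 0] by simp
    then show False using j by (simp add: P_def)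
  qed
  then have "is_singleton_bracket T (take (j - 1) A)" using least[of "j - 1"] j by (auto simp: P_def)
  then have "is_singleton_bracket T (butlast ?E)" using lenA by (simp add: butlast_take)
  moreover have "below_nontrivial T C ?E" unfolding below_nontrivial_iff using A lenA by (intro bexI[of _ A]) simp_all
  ultimately show ?thesis using E j unfolding is_fusion_bracket_def P_def by blast
qed

text \<open>Here the atom property of \<open>C\<close> is used. The tower over \<open>E0\<close>
  together with the trivial brackets is a bracketing below \<open>C\<close>, and it is not the
  minimum by \<open>tower_nontrivial\<close>; so it is all of \<open>C\<close>. In particular every
  nontrivial bracket of \<open>C\<close> lies in the tower.\<close>

lemma fusion_structure:
  assumes E0: "is_fusion_bracket T C E0"
  shows "fused T C E0" "brs C \<subseteq> tower C E0 \<union> {A. \<not> nontrivial T A}"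
    "E \<in> tower C E0 \<longleftrightarrow> E \<in> brs C \<and> below_nontrivial T C E \<and> take (length E0) E = E0"
proof -
  interpret fused T C E0 by unfold_locales (use E0 in \<open>auto simp: is_fusion_bracket_def\<close>)
  show "fused T C E0" by (rule fused_axioms)
  let ?B = "restrict_brs C (tower C E0 \<union> {A. \<not> nontrivial T A})"
  obtain A where A: "A \<in> brs C" "nontrivial T A" "E0 = take (length E0) A"
    using E0 by (auto simp: is_fusion_bracket_def below_nontrivial_iff)
  obtain N where N: "N \<in> tower C E0" "nontrivial T N"
    using tower_nontrivial[OF A(1,2)] A(3) by auto
  have NC: "N \<in> brs C" using tower_props[OF N(1)] by blast
  have "N \<in> brs ?B" using N NC by (simp add: restrict_brs_def)
  then have "\<not> is_min_bracketing T ?B" using N(2) not_min_if_nontrivial by blast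
  moreover have "?B \<in> associahedron T" using restrict_tower_bracketing associahedron_iff by blast
  moreover have "bk_le ?B C" using less_brs by (auto simp: bk_le_def restrict_brs_def)
  ultimately have "?B = C" using C unfolding collision_def by blast
  then have "brs C = brs C \<inter> (tower C E0 \<union> {A. \<not> nontrivial T A})"
    by (metis bracketing.select_convs(1) restrict_brs_def)
  then show brsC: "brs C \<subseteq> tower C E0 \<union> {A. \<not> nontrivial T A}" by blast
  show "E \<in> tower C E0 \<longleftrightarrow> E \<in> brs C \<and> below_nontrivial T C E \<and> take (length E0) E = E0"
  proof
    assume E: "E \<in> tower C E0"
    note p = tower_props[OF E]
    have "below_nontrivial T C E"
    proof (cases "nontrivial T E")
      case True
      then show ?thesis unfolding below_nontrivial_iff using p by (intro bexI[of _ E]) simp_all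
    next
      case False
      \<comment> \<open>A tower element may happen to be a maximum and must still be a prefix of a
        nontrivial bracket. Maxima meet every bracket of their level, so disjointness in the tower
        compares it with \<open>N\<close>: either it is a prefix of \<open>N\<close>, or
        \<open>N\<close> is a proper prefix of it and thus itself a maximum.\<close>
      then have max: "is_max_bracket T E" using p by (simp add: nontrivial_def)
      have le: "length E0 \<le> length E" "length E0 \<le> length N" using p tower_props[OF N(1)] by auto
      have meet: "last A1 \<inter> last A2 \<noteq> {}"
        if "A1 \<in> brs C" "is_max_bracket T A2" "length A1 = length A2" for A1 A2
        using bsub_last[OF bsub_is_max[OF that(2) pre_bracket[OF that(1)] that(3)] brs_nonempty[OF that(1)]]
          pre_bracket_last[OF pre_bracket[OF that(1)]] by blast
      show ?thesis
      proof (cases "length E \<le> length N")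
        case True
        have "take (length E) N \<in> tower C E0" using tower_take[OF N(1) le(1)] .
        moreover have "length (take (length E) N) = length E" using True by simp
        ultimately have "take (length E) N = E"
          using tower_disjoint[OF _ E] meet[OF _ max] tower_props by blast
        then show ?thesis unfolding below_nontrivial_iff using N NC by (intro bexI[of _ N]) simp_all
      next
        case False
        have tk: "take (length N) E \<in> tower C E0" using tower_take[OF E le(2)] .
        have "0 < length N" using brs_nonempty[OF NC] by simp
        then have mx: "is_max_bracket T (take (length N) E)" using is_max_take[OF max] by blast
        moreover have "length N = length (take (length N) E)" using False by simp
        ultimately have "N = take (length N) E" using tower_disjoint[OF N(1) tk] meet[OF NC] by blast
        then show ?thesis using mx N(2) by (simp add: nontrivial_def)
      qed
    qed
    then show "E \<in> brs C \<and> below_nontrivial T C E \<and> take (length E0) E = E0" using p take_tower[OF E] by blast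
  next
    assume E: "E \<in> brs C \<and> below_nontrivial T C E \<and> take (length E0) E = E0"
    then obtain A' where A': "A' \<in> brs C" "nontrivial T A'" "E = take (length E) A'"
      by (auto simp: below_nontrivial_iff)
    then have "A' \<in> tower C E0" using brsC by blast
    moreover have "length E0 \<le> length E" using E by (metis length_take min.cobounded1)
    ultimately have "take (length E) A' \<in> tower C E0" by (rule tower_take)
    then show "E \<in> tower C E0" using A'(3) by simp
  qed
qed

text \<open>A second fusion bracket is a prefix of a nontrivial bracket, hence of a tower element.
  At length at least that of \<open>E0\<close> it is in the tower, where only \<open>E0\<close> lies
  over a singleton. If shorter, it is a prefix of the singleton bracket below
  \<open>E0\<close>.\<close>

lemma fusion_bracket_unique:
  assumes "is_fusion_bracket T C E0" "is_fusion_bracket T C E1"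
  shows "E1 = E0"
proof -
  interpret fused T C E0 by (rule fusion_structure(1)[OF assms(1)])
  have E1: "E1 \<in> brs C" "\<not> is_singleton_bracket T E1" "is_singleton_bracket T (butlast E1)"
    "below_nontrivial T C E1" using assms(2) by (auto simp: is_fusion_bracket_def)
  obtain A where A: "A \<in> brs C" "nontrivial T A" "E1 = take (length E1) A"
    using E1(4) by (auto simp: below_nontrivial_iff)
  have At: "A \<in> tower C E0" using fusion_structure(2)[OF assms(1)] A by blast
  show ?thesis
  proof (cases "length E0 \<le> length E1")
    case True
    then have "E1 \<in> tower C E0" using tower_take[OF At True] A(3) by simp
    then show ?thesis using tower_props[of E1] tower_props[of "butlast E1"] E1(3) by blast
  next
    case False
    then have "E1 = take (length E1) E0" using A(3) take_tower[OF At] by (metis min.absorb1 nat_le_linear take_take)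
    also have "\<dots> = take (length E1) (butlast E0)" using False by (simp add: take_butlast)
    finally have "E1 = take (length E1) (butlast E0)" .
    moreover have "0 < length E1" using brs_nonempty[OF E1(1)] by simp
    ultimately have "is_singleton_bracket T E1"
      using is_singleton_take[OF E0_over_singleton] by metis
    then show ?thesis using E1(2) by blast
  qed
qed

lemma fusion_bracket: "is_fusion_bracket T C (fusion_bracket T C)"
proof -
  obtain E0 where E0: "is_fusion_bracket T C E0" using ex_fusion_bracket by blast
  show ?thesis unfolding fusion_bracket_def
    by (rule theI[of _ E0]) (use E0 fusion_bracket_unique in blast)+
qed

abbreviation "E0 \<equiv> fusion_bracket T C"

sublocale fused T C E0
  by (rule fusion_structure(1)[OF fusion_bracket])

lemma essentials_eq_tower: "essentials T C = tower C E0"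
proof -
  have "(\<exists>j. (butlast ^^ j) E = E0) \<longleftrightarrow> take (length E0) E = E0" for E
  proof
    assume "\<exists>j. (butlast ^^ j) E = E0"
    then obtain j where "take (length E - j) E = E0" by (auto simp: funpow_butlast)
    then show "take (length E0) E = E0" by (metis length_take min.cobounded2 min_def take_all_iff take_take)
  next
    assume E: "take (length E0) E = E0"
    then have "length E0 \<le> length E" by (metis length_take min.cobounded1)
    then show "\<exists>j. (butlast ^^ j) E = E0"
      using E by (intro exI[of _ "length E - length E0"]) (simp add: funpow_butlast)
  qed
  then show ?thesis unfolding essentials_def using fusion_structure(3)[OF fusion_bracket] by blast
qed

lemma brs_collision: "brs C \<subseteq> essentials T C \<union> {A. \<not> nontrivial T A}"
  using fusion_structure(2)[OF fusion_bracket] essentials_eq_tower by simp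

end

section \<open>The quotient map of a collision\<close>

text \<open>Nothing lies strictly below a singleton bracket, so up to length \<open>n\<close> only
  the prefixes of \<open>E\<close> survive, one on each level and hence without comparabilities. The
  result does not mention \<open>P\<close>, which is what makes the extension of a family beyond the
  essential brackets unique.\<close>

lemma (in ptree) truncate_over_singleton:
  assumes E: "pre_bracket T E" and P: "bracketing (subtree T E) P"
    and sing: "is_singleton_bracket T (take n E)" and n: "n \<le> length E"
  shows "truncate_bracketing n P = \<lparr>brs = {A. \<exists>j. 0 < j \<and> j \<le> n \<and> A = take j E}, less_rel = {}\<rparr>"
proof -
  interpret bracket_subtree T E by unfold_locales (rule E)
  have eq: "A = take (length A) E \<and> A \<noteq> []" if A: "A \<in> brs P" "length A \<le> n" for A
  proof -
    have pre_A: "pre_bracket T A" "A \<sqsubseteq> take (length A) E"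
      using bracketing.pre_bracket[OF P A(1)] by (simp_all add: pre_bracket_subtree)
    have tk: "take (length A) E = take (length A) (take n E)" using A(2) by simp
    have "A \<noteq> []" using pre_A(1) pre_bracket_nonempty by blast
    then have "is_singleton_bracket T (take (length A) E)"
      unfolding tk by (intro is_singleton_take[OF sing]) simp
    then obtain k u where "u \<in> level T k" "take (length A) E = singleton_bracket T k u"
      by (rule is_singleton_bracketE)
    then show ?thesis using bsub_singleton[OF pre_A(1)] pre_A(2) \<open>A \<noteq> []\<close> by simp
  qed
  have mem: "take j E \<in> brs P" if "0 < j" "j \<le> n" for j
  proof -
    obtain i where i: "j = Suc i" using \<open>0 < j\<close> by (cases j) auto
    then have "i < length E" using that n by simp
    moreover have "level (subtree T E) i \<noteq> {}"
      using pre_bracket_nth[OF E calculation] calculation by (simp add: level_subtree)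
    ultimately show ?thesis using bracketing.max_brs[OF P, of i] i max_subtree[of i] by simp
  qed
  show ?thesis
  proof (rule bracketing_eqI)
    fix A
    show "A \<in> brs (truncate_bracketing n P) \<longleftrightarrow>
        A \<in> brs \<lparr>brs = {A. \<exists>j. 0 < j \<and> j \<le> n \<and> A = take j E}, less_rel = {}\<rparr>"
    proof
      assume "A \<in> brs (truncate_bracketing n P)"
      then have "A \<in> brs P" "length A \<le> n" by (simp_all add: brs_truncate)
      then have "A = take (length A) E" "0 < length A" "length A \<le> n" using eq by auto
      then show "A \<in> brs \<lparr>brs = {A. \<exists>j. 0 < j \<and> j \<le> n \<and> A = take j E}, less_rel = {}\<rparr>"
        unfolding bracketing.select_convs mem_Collect_eq by blast
    next
      assume "A \<in> brs \<lparr>brs = {A. \<exists>j. 0 < j \<and> j \<le> n \<and> A = take j E}, less_rel = {}\<rparr>"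
      then show "A \<in> brs (truncate_bracketing n P)" using mem by (auto simp: brs_truncate)
    qed
    fix A1 A2
    have "(A1, A2) \<notin> less_rel (truncate_bracketing n P)"
    proof
      assume "(A1, A2) \<in> less_rel (truncate_bracketing n P)"
      then have less: "(A1, A2) \<in> less_rel P" "length A1 \<le> n" "length A2 \<le> n" by (simp_all add: less_truncate)
      have "A1 \<in> brs P" "A2 \<in> brs P" using bracketing.less_brs[OF P] less by blast+
      moreover have "length A1 = length A2"
        using bracketing.length_over[OF P calculation] bracketing.less_over[OF P less(1)] by blast
      ultimately have "A1 = A2" using eq less by metis
      then show False using less(1) bracketing.less_irrefl[OF P] by simp
    qed
    then show "(A1, A2) \<in> less_rel (truncate_bracketing n P) \<longleftrightarrow>
        (A1, A2) \<in> less_rel \<lparr>brs = {A. \<exists>j. 0 < j \<and> j \<le> n \<and> A = take j E}, less_rel = {}\<rparr>" by simp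
  qed
qed

text \<open>The right-hand side does not depend on \<open>B\<close>: fibers over vertices that are
  not fused carry no information.\<close>

lemma (in bracketing) restrict_bracketing_singleton:
  assumes S: "is_singleton_bracket T S"
  shows "restrict_bracketing B S = \<lparr>brs = {A. \<exists>j. 0 < j \<and> j \<le> length S \<and> A = take j S}, less_rel = {}\<rparr>"
proof -
  have pre: "pre_bracket T S" by (rule is_singleton_pre_bracket[OF S])
  have "S \<in> brs B" using S trivial_brs by (simp add: nontrivial_def)
  then have P: "bracketing (subtree T S) (restrict_bracketing B S)" by (rule restrict_bracketing)
  have "truncate_bracketing (length S) (restrict_bracketing B S) = restrict_bracketing B S"
    by (rule bracketing.truncate_all[OF P]) (auto simp: brs_restrict_bracketing dest: bsub_take_length)
  then show ?thesis using truncate_over_singleton[OF pre P, of "length S"] S by simp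
qed

section \<open>Essential brackets and the quotient map\<close>

context collision_tree
begin

abbreviation "Es \<equiv> essentials T C"
abbreviation "R \<equiv> removed T C"
abbreviation "w \<equiv> fused_parent T C"
abbreviation "T' \<equiv> contract_tree T C"
text \<open>The level of the fused parent: \<open>E0\<close> is one longer than its level, and the
  parent lies one level above.\<close>

definition "k0 = length E0 - 2"

lemma essential:
  assumes "E \<in> Es"
  shows "E \<in> brs C" "\<not> is_singleton_bracket T E" "E = E0 \<or> butlast E \<in> Es \<and> length E0 < length E"
  using tower_props assms unfolding essentials_eq_tower by blast+

lemma E0_essential: "E0 \<in> Es"
  unfolding essentials_eq_tower by (rule tower.base)

lemma essential_disjoint:
  "E1 \<in> Es \<Longrightarrow> E2 \<in> Es \<Longrightarrow> length E1 = length E2 \<Longrightarrow> last E1 \<inter> last E2 \<noteq> {} \<Longrightarrow> E1 = E2"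
  unfolding essentials_eq_tower by (rule tower_disjoint)

lemma essential_level: "E \<in> Es \<Longrightarrow> last E \<subseteq> level T (length E - 1)"
  using pre_bracket_last_level[OF pre_bracket] essential(1) by blast

lemma essential_length: "E \<in> Es \<Longrightarrow> length E = Suc (length E - 1)"
  using brs_nonempty[of E] essential(1)[of E] by simp

lemma essential_unique:
  assumes "E1 \<in> Es" "E2 \<in> Es" "v \<in> last E1" "v \<in> last E2"
  shows "E1 = E2"
proof (rule essential_disjoint[OF assms(1,2)])
  have "length E1 - 1 = length E2 - 1"
    using essential_level assms level_unique by blast
  then show "length E1 = length E2" using essential_length assms(1,2) by metis
qed (use assms in blast)

lemma essential_last_nonempty: "E \<in> Es \<Longrightarrow> last E \<noteq> {}"
  using pre_bracket_last[OF pre_bracket] essential(1) by blast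

lemma fused_parent: "w \<in> level T k0" "butlast E0 = singleton_bracket T k0 w" "length E0 = Suc (Suc k0)"
proof -
  obtain k u where u: "u \<in> level T k" "butlast E0 = singleton_bracket T k u"
    "last (butlast E0) = {u}" "length (butlast E0) = Suc k"
    using E0_over_singleton by (rule is_singleton_bracketE)
  have "w = u" using u(3) by (simp add: fused_parent_def)
  moreover have k: "k0 = k" using u(4) by (simp add: k0_def)
  ultimately show "w \<in> level T k0" "butlast E0 = singleton_bracket T k0 w" using u by simp_all
  show "length E0 = Suc (Suc k0)" using u(4) k by simp
qed

lemma Suc_k0: "Suc k0 = length E0 - 1"
  using fused_parent(3) by simp

text \<open>Going down along arcs, \<open>tower_cover\<close> supplies an essential bracket through
  every child. In the other direction, parents taken inside essential brackets lead back to
  \<open>last E0\<close>.\<close>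

lemma removed_iff: "v \<in> R \<longleftrightarrow> (\<exists>E \<in> Es. v \<in> last E)"
proof
  assume "v \<in> R"
  then obtain x where x: "x \<in> last E0" "(x, v) \<in> (arcs T)\<^sup>*"
    by (auto simp: removed_def fused_children_def)
  from x(2) show "\<exists>E \<in> Es. v \<in> last E"
  proof (induction rule: rtrancl_induct)
    case base
    then show ?case using x E0_essential by blast
  next
    case (step y z)
    then obtain E where E: "E \<in> Es" "y \<in> last E" by blast
    have "z \<in> ch T y" using step by (simp add: ch_def)
    then show ?case using tower_cover[of E y z] E unfolding essentials_eq_tower by blast
  qed
next
  assume "\<exists>E \<in> Es. v \<in> last E"
  then obtain E where "E \<in> tower C E0" "v \<in> last E" unfolding essentials_eq_tower by blast
  then show "v \<in> R"
  proof (induction arbitrary: v rule: tower.induct)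
    case base
    then show ?case by (auto simp: removed_def fused_children_def)
  next
    case (step E E')
    have "butlast E' \<noteq> []" using step.hyps(1,3) tower_props brs_nonempty by blast
    then obtain u where u: "u \<in> last E" "v \<in> ch T u"
      using pre_bracket_parent[OF pre_bracket[OF step.hyps(2)] _ step.prems] step.hyps(3) by blast
    then show ?case using step.IH[OF u(1)]
      by (auto simp: removed_def ch_def intro: rtrancl_into_rtrancl)
  qed
qed

lemma fused_parent_not_removed: "w \<notin> R"
proof
  assume "w \<in> R"
  then obtain E where E: "E \<in> Es" "w \<in> last E" using removed_iff by blast
  then have "length E - 1 = k0" using essential_level[OF E(1)] level_unique fused_parent(1) by blast
  moreover have "length E0 \<le> length E" using essential(3)[OF E(1)] by auto
  ultimately show False using fused_parent(3) by simp
qed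

lemma essential_child:
  assumes "E \<in> Es" "u \<in> last E" "v \<in> ch T u"
  obtains E' where "E' \<in> Es" "butlast E' = E" "v \<in> last E'"
  using tower_cover[of E u v] assms unfolding essentials_eq_tower by blast

lemma essential_parent:
  assumes E: "E \<in> Es" and v: "v \<in> last E" and u: "v \<in> ch T u"
  shows "E = E0 \<and> u = w \<or> butlast E \<in> Es \<and> u \<in> last (butlast E)"
proof -
  have ne: "butlast E \<noteq> []"
    using tower_props E unfolding essentials_eq_tower by blast
  obtain u' where u': "u' \<in> last (butlast E)" "v \<in> ch T u'"
    using pre_bracket_parent[OF pre_bracket[OF essential(1)[OF E]] ne v] by blast
  have "u = u'" by (rule parent_unique[OF u u'(2)])
  then show ?thesis
    using essential(3)[OF E] u'(1) fused_parent(1,2) by (auto simp: last_singleton)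
qed

lemma E0_ch: "last E0 \<subseteq> ch T w"
  using last_over_singleton[OF pre_bracket[OF E0_brs]] fused_parent(1,2) by blast

lemma removed_child: "u \<in> R \<Longrightarrow> v \<in> ch T u \<Longrightarrow> v \<in> R"
  by (auto simp: removed_def ch_def intro: rtrancl_into_rtrancl)

lemma removed_child_of_kept:
  assumes "v \<in> ch T u" "u \<notin> R" "v \<in> R"
  shows "u = w" "v \<in> last E0"
proof -
  obtain E where E: "E \<in> Es" "v \<in> last E" using assms(3) removed_iff by blast
  have "\<not> (butlast E \<in> Es \<and> u \<in> last (butlast E))" using assms(2) removed_iff by blast
  then have "E = E0 \<and> u = w" using essential_parent[OF E assms(1)] by blast
  then show "u = w" "v \<in> last E0" using E by auto
qed

text \<open>The definite description is proper since essential brackets have disjoint last entries,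
  by \<open>essential_unique\<close>.\<close>

definition quot :: "'v \<Rightarrow> 'v + 'v bracket" where
  "quot v = (if v \<in> R then Inr (THE E. E \<in> Es \<and> v \<in> last E) else Inl v)"

lemma quot_kept: "v \<notin> R \<Longrightarrow> quot v = Inl v"
  by (simp add: quot_def)

lemma quot_essential:
  assumes "E \<in> Es" "v \<in> last E"
  shows "quot v = Inr E"
proof -
  have "(THE E. E \<in> Es \<and> v \<in> last E) = E"
    using assms essential_unique by (intro the_equality) blast+
  moreover have "v \<in> R" using assms removed_iff by blast
  ultimately show ?thesis by (simp add: quot_def)
qed

lemma quot_eq_Inr: 
  assumes "quot v = Inr E"
  shows "E \<in> Es" "v \<in> last E"
proof -
  have "v \<in> R" using assms by (auto simp: quot_def split: if_splits)
  then obtain E' where "E' \<in> Es" "v \<in> last E'" using removed_iff by blast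
  then show "E \<in> Es" "v \<in> last E" using quot_essential assms by auto
qed

lemma quot_eq_Inl: "quot v = Inl u \<Longrightarrow> v = u \<and> u \<notin> R"
  by (auto simp: quot_def split: if_splits)

lemma ch_contract_Inl: "u \<notin> R \<Longrightarrow>
    y \<in> ch T' (Inl u) \<longleftrightarrow> (\<exists>v. y = Inl v \<and> v \<in> ch T u \<and> v \<notin> R) \<or> y = Inr E0 \<and> u = w"
  by (auto simp: ch_def contract_tree_def)

lemma ch_contract_Inr: "y \<in> ch T' (Inr E) \<longleftrightarrow> (\<exists>E'. y = Inr E' \<and> E \<in> Es \<and> E' \<in> Es \<and> butlast E' = E)"
  by (auto simp: ch_def contract_tree_def)

text \<open>Each essential bracket is recovered from any vertex of its nonempty last entry.
  Finiteness is needed for the arcs of the contracted tree.\<close>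

lemma finite_essentials: "finite Es"
proof -
  let ?V = "insert (root T) (snd ` arcs T)"
  have "Es \<subseteq> (\<lambda>v. THE E. E \<in> Es \<and> v \<in> last E) ` ?V"
  proof
    fix E
    assume E: "E \<in> Es"
    then obtain v where v: "v \<in> last E" using essential_last_nonempty by blast
    have "E = (THE E. E \<in> Es \<and> v \<in> last E)"
    proof -
      have "v \<in> R" using removed_iff E v by blast
      then show ?thesis using quot_essential[OF E v] by (simp add: quot_def)
    qed
    moreover have "v \<in> ?V" using essential_level[OF E] v level_subset by blast
    ultimately show "E \<in> (\<lambda>v. THE E. E \<in> Es \<and> v \<in> last E) ` ?V" by blast
  qed
  then show ?thesis using finite_arcs by (meson finite_imageI finite_insert finite_subset)
qed

lemma quot_ch:
  assumes u: "u \<in> level T k" and v: "v \<in> ch T u"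
  shows "quot v \<in> ch T' (quot u)"
proof (cases "u \<in> R")
  case True
  then obtain E where E: "E \<in> Es" "u \<in> last E" using removed_iff by blast
  then obtain E' where E': "E' \<in> Es" "butlast E' = E" "v \<in> last E'" using essential_child v by blast
  then show ?thesis using E by (simp add: quot_essential ch_contract_Inr)
next
  case u: False
  show ?thesis
  proof (cases "v \<in> R")
    case True
    then have "u = w" "v \<in> last E0" using removed_child_of_kept[OF v u] by blast+
    then show ?thesis using u E0_essential by (simp add: quot_kept quot_essential ch_contract_Inl)
  next
    case False
    then show ?thesis using u v by (simp add: quot_kept ch_contract_Inl)
  qed
qed

text \<open>An arc between fused vertices lifts, but not necessarily from the given
  \<open>u\<close>: not every vertex of \<open>last E\<close> needs a child in
  \<open>last E'\<close>. Therefore another vertex \<open>u'\<close> of the same fiber is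
  allowed.\<close>

lemma quot_lift:
  assumes u: "u \<in> level T k" and y: "y \<in> ch T' (quot u)"
  obtains u' v where "u' \<in> level T k" "quot u' = quot u" "v \<in> ch T u'" "quot v = y"
proof (cases "u \<in> R")
  case True
  then obtain E where E: "E \<in> Es" "u \<in> last E" using removed_iff by blast
  then obtain E' where E': "y = Inr E'" "E' \<in> Es" "butlast E' = E"
    using y by (auto simp: quot_essential ch_contract_Inr)
  obtain v where v: "v \<in> last E'" using essential_last_nonempty E' by blast
  have "butlast E' \<noteq> []" using E(1) E'(3) essential(1) brs_nonempty by blast
  then obtain u' where u': "u' \<in> last E" "v \<in> ch T u'"
    using pre_bracket_parent[OF pre_bracket[OF essential(1)[OF E'(2)]] _ v] E'(3) by blast
  have "length E - 1 = k" using essential_level[OF E(1)] E(2) u level_unique by blast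
  then have "u' \<in> level T k" using essential_level[OF E(1)] u'(1) by blast
  then show thesis using that u' v E E' quot_essential by metis
next
  case False
  consider v where "y = Inl v" "v \<in> ch T u" "v \<notin> R" | "y = Inr E0" "u = w"
    using y False by (auto simp: quot_kept ch_contract_Inl)
  then show thesis
  proof cases
    case 1
    then show thesis using that[OF u] by (simp add: quot_kept)
  next
    case 2
    obtain v where v: "v \<in> last E0" using essential_last_nonempty E0_essential by blast
    then have "v \<in> ch T u" using 2 E0_ch by blast
    then show thesis using that[OF u refl] quot_essential[OF E0_essential v] 2 by simp
  qed
qed

lemma level_contract: "level T' k = quot ` level T k"
proof (induction k)
  case 0
  have "root T \<notin> R"
  proof
    assume "root T \<in> R"
    then obtain E where E: "E \<in> Es" "root T \<in> last E" using removed_iff by blast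
    then have "length E - 1 = 0" using essential_level level_unique[of "root T" _ 0] by fastforce
    moreover have "length E0 \<le> length E" using essential(3)[OF E(1)] by auto
    ultimately show False using fused_parent(3) by simp
  qed
  then show ?case by (simp add: quot_kept contract_tree_def)
next
  case (Suc k)
  show ?case
  proof (intro set_eqI iffI)
    fix y
    assume "y \<in> level T' (Suc k)"
    then obtain u where u: "u \<in> level T k" "y \<in> ch T' (quot u)" using Suc by (auto simp: level_Suc)
    then obtain u' v where "u' \<in> level T k" "v \<in> ch T u'" "quot v = y" using quot_lift by metis
    then show "y \<in> quot ` level T (Suc k)" using level_SucI by fast
  next
    fix y
    assume "y \<in> quot ` level T (Suc k)"
    then obtain u v where "u \<in> level T k" "v \<in> ch T u" "y = quot v" by (auto simp: level_Suc)
    then show "y \<in> level T' (Suc k)" using Suc quot_ch unfolding level_Suc by blast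
  qed
qed

lemma level_contract_cases:
  assumes "x \<in> level T' k"
  obtains (kept) u where "u \<in> level T k" "u \<notin> R" "x = Inl u"
  | (ess) E where "E \<in> Es" "length E = Suc k" "x = Inr E"
proof -
  obtain v where v: "v \<in> level T k" "x = quot v" using assms level_contract by blast
  show thesis
  proof (cases "v \<in> R")
    case True
    then obtain E where E: "E \<in> Es" "v \<in> last E" using removed_iff by blast
    have "length E - 1 = k" using essential_level[OF E(1)] E(2) v(1) level_unique by blast
    then have "length E = Suc k" using essential_length[OF E(1)] by simp
    then show thesis using ess E v quot_essential by simp
  next
    case False
    then show thesis using kept v quot_kept by simp
  qed
qed

lemma essential_level_contract: "E \<in> Es \<Longrightarrow> Inr E \<in> level T' (length E - 1)"
proof -
  assume E: "E \<in> Es"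
  then obtain v where v: "v \<in> last E" using essential_last_nonempty by blast
  then have "v \<in> level T (length E - 1)" using essential_level[OF E] by blast
  then show "Inr E \<in> level T' (length E - 1)"
    unfolding level_contract using quot_essential[OF E v] by (metis imageI)
qed

lemma kept_level_contract: "u \<in> level T k \<Longrightarrow> u \<notin> R \<Longrightarrow> Inl u \<in> level T' k"
  unfolding level_contract using quot_kept[of u] by (metis imageI)

lemma sib_contract: "sib T' = contract_sib T C"
  by (simp add: contract_tree_def)

lemma ptree_contract: "ptree T'"
proof
  have "arcs T' \<subseteq> map_prod Inl Inl ` arcs T \<union> {(Inl w, Inr E0)} \<union> Inr ` Es \<times> Inr ` Es"
    by (auto simp: contract_tree_def)
  moreover have "finite (map_prod Inl Inl ` arcs T \<union> {(Inl w, Inr E0)} \<union> Inr ` Es \<times> Inr ` Es)"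
    using finite_arcs finite_essentials by simp
  ultimately show "finite (arcs T')" by (rule finite_subset)
  show "root T' \<notin> ch T' u" for u
    using root_no_parent by (auto simp: ch_def contract_tree_def)
  \<comment> \<open>Otherwise \<open>Inr E0\<close> would have \<open>Inr (butlast E0)\<close> as a
    second parent besides \<open>Inl w\<close>.\<close>
  have not_E0: "butlast E0 \<notin> Es" using essential(2) E0_over_singleton by blast
  show "u = u'" if v: "v \<in> ch T' u" "v \<in> ch T' u'" for u u' v
  proof (cases v)
    case (Inl x)
    then obtain a b where "u = Inl a" "u' = Inl b" "x \<in> ch T a" "x \<in> ch T b"
      using v by (auto simp: ch_def contract_tree_def)
    then show ?thesis using parent_unique by blast
  next
    case (Inr E)
    have "p = (if E = E0 then Inl w else Inr (butlast E))" if "v \<in> ch T' p" for p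
      using that Inr not_E0 by (auto simp: ch_def contract_tree_def)
    from this[OF v(1)] this[OF v(2)] show ?thesis by simp
  qed
  show "sib T' x \<subseteq> ch T' x \<times> ch T' x" if "x \<in> level T' k" for x k
    using that
  proof (cases rule: level_contract_cases)
    case (kept u)
    show ?thesis
      using sib_ch[OF kept(1)] kept(2,3)
      by (auto simp: sib_contract contract_sib_def ch_contract_Inl split: if_splits)
  next
    case (ess E)
    then show ?thesis by (auto simp: sib_contract contract_sib_def ch_contract_Inr)
  qed
qed

text \<open>\<open>less_mono\<close> used in reverse: the two essential brackets are disjoint and
  hence comparable, and the wrong direction would descend to the singleton brackets of
  \<open>a\<close> and \<open>b\<close>, against their order as siblings.\<close>

lemma essential_less_of_sib:
  assumes u: "u \<in> level T k" and s: "(a, b) \<in> sib T u"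
    and E: "E1 \<in> Es" "E2 \<in> Es" "butlast E1 = butlast E2" "E1 \<noteq> E2" "a \<in> last E1" "b \<in> last E2"
  shows "(E1, E2) \<in> less_rel C"
proof -
  have ab: "a \<in> ch T u" "b \<in> ch T u" using sib_ch[OF u] s by blast+
  then have l: "a \<in> level T (Suc k)" "b \<in> level T (Suc k)" using level_SucI[OF u] by blast+
  let ?s = "singleton_bracket T (Suc k)"
  have less: "(?s a, ?s b) \<in> less_rel C" by (rule less_sib[OF u s])
  have len: "length E1 - 1 = Suc k" "length E2 - 1 = Suc k"
    using essential_level E l level_unique by blast+
  have sub: "?s a \<sqsubseteq> E1" "?s b \<sqsubseteq> E2"
    using singleton_bsub[OF pre_bracket[OF essential(1)[OF E(1)]] E(5)]
      singleton_bsub[OF pre_bracket[OF essential(1)[OF E(2)]] E(6)] len by simp_all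
  have "length E1 = length E2" using length_over essential(1) E by blast
  then have "last E1 \<inter> last E2 = {}" using essential_disjoint[OF E(1,2)] E(4) by blast
  then have "(E1, E2) \<in> less_rel C \<or> (E2, E1) \<in> less_rel C"
    using less_total essential(1) E by blast
  moreover have "(E2, E1) \<notin> less_rel C"
  proof
    assume "(E2, E1) \<in> less_rel C"
    then have "(?s b, ?s a) \<in> less_rel C"
      using less_mono[OF _ singleton_brs[OF l(2)] singleton_brs[OF l(1)] _ sub(2,1)] u ab
      by (simp add: butlast_singleton)
    then show False using less_asym[OF less] by blast
  qed
  ultimately show ?thesis by blast
qed

lemma quot_sib:
  assumes u: "u \<in> level T k" and s: "(a, b) \<in> sib T u"
  shows "quot a = quot b \<or> (quot a, quot b) \<in> sib T' (quot u)"
proof -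
  have ab: "a \<in> ch T u" "b \<in> ch T u" using sib_ch[OF u] s by blast+
  show ?thesis
  proof (cases "u \<in> R")
    case True
    then obtain E where E: "E \<in> Es" "u \<in> last E" using removed_iff by blast
    obtain E1 where E1: "E1 \<in> Es" "butlast E1 = E" "a \<in> last E1" using essential_child[OF E ab(1)] by blast
    obtain E2 where E2: "E2 \<in> Es" "butlast E2 = E" "b \<in> last E2" using essential_child[OF E ab(2)] by blast
    have "E1 \<noteq> E2 \<Longrightarrow> (E1, E2) \<in> less_rel C"
      using essential_less_of_sib[OF u s E1(1) E2(1)] E1 E2 by simp
    then show ?thesis
      using E E1 E2 by (auto simp: quot_essential sib_contract contract_sib_def)
  next
    case False
    have "quot a = Inl a \<and> a \<notin> R \<or> quot a = Inr E0 \<and> u = w \<and> a \<in> last E0"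
      using quot_kept removed_child_of_kept[OF ab(1) False] quot_essential[OF E0_essential] by blast
    moreover have "quot b = Inl b \<and> b \<notin> R \<or> quot b = Inr E0 \<and> u = w \<and> b \<in> last E0"
      using quot_kept removed_child_of_kept[OF ab(2) False] quot_essential[OF E0_essential] by blast
    ultimately show ?thesis
      using s quot_kept[OF False] by (auto simp: sib_contract contract_sib_def fused_children_def)
  qed
qed

sublocale tree_map T T' quot
proof (intro tree_map.intro tree_map_axioms.intro)
  show "ptree T" by (rule ptree_axioms)
  show "ptree T'" by (rule ptree_contract)
  show "level T' k = quot ` level T k" for k by (rule level_contract)
  show "quot (root T) = root T'"
    using level_contract[of 0] by simp
qed (rule quot_ch quot_sib; assumption)+

section \<open>Fibers of the quotient map\<close>

lemma fiber_Suc: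
  assumes "x \<in> level T' k" "y \<in> ch T' x"
  shows "fiber (Suc k) y = fiber k x @ [{v \<in> level T (Suc k). quot v = y}]"
proof -
  have "y \<in> level T' (Suc k)" using assms by (rule level_SucI)
  moreover have "fiber (Suc k) y \<noteq> []" by (simp flip: length_greater_0_conv)
  ultimately show ?thesis
    using append_butlast_last_id[of "fiber (Suc k) y"]
    unfolding butlast_fiber[OF assms] last_fiber[OF \<open>y \<in> level T' (Suc k)\<close>] by simp
qed

text \<open>Descendants of removed vertices are removed, so a kept vertex has only kept ancestors,
  each of which is its own sole preimage.\<close>

lemma fiber_kept: "u \<in> level T k \<Longrightarrow> u \<notin> R \<Longrightarrow> fiber k (Inl u) = singleton_bracket T k u"
proof (induction k arbitrary: u)
  case 0
  have single: "A = [last A]" if "length A = Suc 0" for A :: "'v bracket"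
    using that by (cases A) auto
  have "fiber 0 (Inl u) = [last (fiber 0 (Inl u))]" by (rule single) simp
  moreover have "last (fiber 0 (Inl u)) = {v \<in> level T 0. quot v = Inl u}"
    by (rule last_fiber) (use 0 kept_level_contract in blast)
  moreover have "\<dots> = {u}" using 0 quot_eq_Inl quot_kept by auto
  ultimately show ?case using 0 by simp
next
  case (Suc k)
  obtain p where p: "p \<in> level T k" "u \<in> ch T p" using Suc.prems by (auto simp: level_Suc)
  then have pR: "p \<notin> R" using Suc.prems removed_child by blast
  have "Inl p \<in> level T' k" "Inl u \<in> ch T' (Inl p)"
    using p pR Suc.prems kept_level_contract ch_contract_Inl by blast+
  then have "fiber (Suc k) (Inl u) = fiber k (Inl p) @ [{v \<in> level T (Suc k). quot v = Inl u}]"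
    by (rule fiber_Suc)
  moreover have "{v \<in> level T (Suc k). quot v = Inl u} = {u}"
    using Suc.prems quot_eq_Inl quot_kept by auto
  ultimately show ?case using Suc.IH[OF p(1) pR] p by (simp add: singleton_Suc)
qed

lemma essential_preimage:
  assumes "E \<in> Es"
  shows "{v \<in> level T (length E - 1). quot v = Inr E} = last E"
  using essential_level[OF assms] quot_essential[OF assms] quot_eq_Inr(2) by blast

text \<open>The prefix up to the fused parent is the path of kept vertices leading to it; from
  \<open>E0\<close> on, the entries are the last entries of the truncations of \<open>E\<close>.
  This links the fibers to the index set of the fiber product.\<close>

lemma fiber_essential: "E \<in> Es \<Longrightarrow> fiber (length E - 1) (Inr E) = E"
  unfolding essentials_eq_tower
proof (induction rule: tower.induct)
  case base
  have "Inl w \<in> level T' k0" "Inr E0 \<in> ch T' (Inl w)"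
    using fused_parent(1) fused_parent_not_removed kept_level_contract ch_contract_Inl by blast+
  then have "fiber (length E0 - 1) (Inr E0) = fiber k0 (Inl w) @ [{v \<in> level T (length E0 - 1). quot v = Inr E0}]"
    unfolding Suc_k0[symmetric] by (rule fiber_Suc)
  also have "\<dots> = butlast E0 @ [last E0]"
    unfolding essential_preimage[OF E0_essential] fused_parent(2)
      fiber_kept[OF fused_parent(1) fused_parent_not_removed] ..
  also have "\<dots> = E0" using brs_nonempty[OF E0_brs] by simp
 finally show ?case .
next
  case (step E E')
  have E: "E \<in> Es" and E': "E' \<in> Es"
    unfolding essentials_eq_tower using step.hyps tower.step by blast+
  have len: "length E' = Suc (length E)" "length E = Suc (length E - 1)"
    using step.hyps(3) essential_length[OF E'] essential_length[OF E] by (cases E' rule: rev_cases; simp)+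
  have "Inr E \<in> level T' (length E - 1)" "Inr E' \<in> ch T' (Inr E)"
    using essential_level_contract E E' step.hyps(3) ch_contract_Inr by blast+
  then have "fiber (Suc (length E - 1)) (Inr E') =
      fiber (length E - 1) (Inr E) @ [{v \<in> level T (Suc (length E - 1)). quot v = Inr E'}]"
    by (rule fiber_Suc)
  also have "\<dots> = butlast E' @ [last E']"
    using step.IH step.hyps(3) essential_preimage[OF E'] len by simp
  also have "\<dots> = E'" using brs_nonempty[OF step.hyps(2)] by simp
  finally show ?case using len by simp
qed

lemma fiber_cases:
  assumes "x \<in> level T' k"
  obtains (kept) u where "u \<in> level T k" "u \<notin> R" "x = Inl u" "fiber k x = singleton_bracket T k u"
  | (ess) E where "E \<in> Es" "length E = Suc k" "x = Inr E" "fiber k x = E"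
  using assms
proof (cases rule: level_contract_cases)
  case (kept u)
  then show thesis using that(1) fiber_kept by blast
next
  case (ess E)
  then show thesis using that(2) fiber_essential[of E] by simp
qed

text \<open>The order in \<open>C\<close> descends from \<open>E0\<close> to the singleton bracket
  of \<open>z\<close>; as both orders are total here, each direction determines the other. Since
  \<open>z\<close> is arbitrary, the choice of a fused child in \<open>contract_sib\<close> is
  immaterial.\<close>

lemma E0_less_sibling:
  assumes x: "x \<in> ch T w" "x \<notin> R" and z: "z \<in> last E0"
  shows "(singleton_bracket T (Suc k0) x, E0) \<in> less_rel C \<longleftrightarrow> (x, z) \<in> sib T w"
    and "(E0, singleton_bracket T (Suc k0) x) \<in> less_rel C \<longleftrightarrow> (z, x) \<in> sib T w"
proof -
  let ?s = "singleton_bracket T (Suc k0)"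
  have zc: "z \<in> ch T w" using E0_ch z by blast
  have l: "x \<in> level T (Suc k0)" "z \<in> level T (Suc k0)"
    using level_SucI[OF fused_parent(1)] x zc by blast+
  have brs: "?s x \<in> brs C" "?s z \<in> brs C" using singleton_brs l by blast+
  have over: "butlast (?s x) = butlast E0" "butlast (?s z) = butlast E0"
    using fused_parent(1,2) x zc by (simp_all add: butlast_singleton)
  have sub: "?s z \<sqsubseteq> E0" using singleton_bsub[OF pre_bracket[OF E0_brs] z] fused_parent(3) by simp
  have "x \<notin> last E0" using x(2) removed_iff E0_essential by blast
  then have "last (?s x) \<inter> last E0 = {}" using l by (simp add: last_singleton)
  then have total: "(?s x, E0) \<in> less_rel C \<or> (E0, ?s x) \<in> less_rel C"
    using less_total[OF brs(1) E0_brs over(1)] by blast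
  have "x \<noteq> z" using \<open>x \<notin> last E0\<close> z by blast
  then have sib: "(x, z) \<in> sib T w \<or> (z, x) \<in> sib T w" using sib_total[OF fused_parent(1) x(1) zc] by blast
  have sx: "(x, z) \<in> sib T w \<Longrightarrow> (?s x, ?s z) \<in> less_rel C"
    and sz: "(z, x) \<in> sib T w \<Longrightarrow> (?s z, ?s x) \<in> less_rel C"
    using less_sib[OF fused_parent(1)] by blast+
  have mx: "(?s x, E0) \<in> less_rel C \<Longrightarrow> (?s x, ?s z) \<in> less_rel C"
    using less_mono[OF _ brs] over sub by simp
  have mz: "(E0, ?s x) \<in> less_rel C \<Longrightarrow> (?s z, ?s x) \<in> less_rel C"
    using less_mono[OF _ brs(2,1)] over sub by simp
  note asym = less_asym[of "?s x" "?s z"] less_asym[of "?s x" E0]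
  show "(?s x, E0) \<in> less_rel C \<longleftrightarrow> (x, z) \<in> sib T w"
    using total sib sx sz mx mz asym by blast
  show "(E0, ?s x) \<in> less_rel C \<longleftrightarrow> (z, x) \<in> sib T w"
    using total sib sx sz mx mz asym by blast
qed

text \<open>Shows that \<open>C\<close> itself orders its fibers as T/C does, a property inherited
  by everything above \<open>C\<close>.\<close>

lemma collision_fiber_less:
  assumes x: "x \<in> level T' k" and s: "(x1, x2) \<in> sib T' x"
  shows "(fiber (Suc k) x1, fiber (Suc k) x2) \<in> less_rel C"
  using x
proof (cases rule: level_contract_cases)
  case (ess E)
  then obtain E1 E2 where E: "x1 = Inr E1" "x2 = Inr E2" "E1 \<in> Es" "E2 \<in> Es" "butlast E1 = E"
    "butlast E2 = E" "(E1, E2) \<in> less_rel C"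
    using s by (auto simp: sib_contract contract_sib_def)
  have "length E1 - 1 = Suc k" "length E2 - 1 = Suc k"
    using arg_cong[OF E(5), of length] arg_cong[OF E(6), of length] ess(2) by simp_all
  then show ?thesis using E fiber_essential[of E1] fiber_essential[of E2] by simp
next
  case (kept u)
  have sib_u: "sib T u \<subseteq> ch T u \<times> ch T u" by (rule sib_ch[OF kept(1)])
  have fib: "fiber (Suc k) (Inl a) = singleton_bracket T (Suc k) a" if "a \<in> ch T u" "a \<notin> R" for a
    using fiber_kept level_SucI[OF kept(1)] that by blast
  have E0: "k = k0 \<and> fiber (Suc k0) (Inr E0) = E0" if "u = w"
  proof -
    have "k = k0" using kept(1) that fused_parent(1) level_unique by blast
    then show ?thesis using fiber_essential[OF E0_essential] fused_parent(3) by simp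
  qed
  consider (both) a b where "x1 = Inl a" "x2 = Inl b" "(a, b) \<in> sib T u" "a \<notin> R" "b \<notin> R"
    | (right) a z where "u = w" "x1 = Inl a" "x2 = Inr E0" "a \<notin> R" "z \<in> last E0" "(a, z) \<in> sib T u"
    | (left) b z where "u = w" "x1 = Inr E0" "x2 = Inl b" "b \<notin> R" "z \<in> last E0" "(z, b) \<in> sib T u"
    using s kept by (auto simp: sib_contract contract_sib_def fused_children_def split: if_splits)
  then show ?thesis
  proof cases
    case both
    then have "a \<in> ch T u" "b \<in> ch T u" using sib_u by blast+
    then show ?thesis using both fib less_sib[OF kept(1) both(3)] by simp
  next
    case right
    then have "a \<in> ch T u" using sib_u by blast
    then show ?thesis using E0_less_sibling(1)[of a z] right fib E0[OF right(1)] by simp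
  next
    case left
    then have "b \<in> ch T u" using sib_u by blast
    then show ?thesis using E0_less_sibling(2)[of b z] left fib E0[OF left(1)] by simp
  qed
qed

section \<open>The facet as the set of fibered bracketings\<close>

lemma facet_iff: "B \<in> facet T C \<longleftrightarrow> fibered_bracketing T T' quot B"
proof
  assume "B \<in> facet T C"
  then have B: "bracketing T B" and le: "bk_le C B" by (auto simp: facet_def associahedron_iff)
  show "fibered_bracketing T T' quot B"
  proof (intro fibered_bracketing.intro fibered_bracketing_axioms.intro)
    show "tree_map T T' quot" by (rule tree_map_axioms)
    show "bracketing T B" by (rule B)
    show "fiber k x \<in> brs B" if "x \<in> level T' k" for k x
      using that
    proof (cases rule: fiber_cases)
      case (kept u)
      then show ?thesis using bracketing.singleton_brs[OF B] by simp
    next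
      case (ess E)
      then show ?thesis using essential(1)[of E] le by (auto simp: bk_le_def)
    qed
    show "(fiber (Suc k) x1, fiber (Suc k) x2) \<in> less_rel B"
      if "x \<in> level T' k" "(x1, x2) \<in> sib T' x" for k x x1 x2
      using collision_fiber_less[OF that] le by (auto simp: bk_le_def)
  qed
next
  assume "fibered_bracketing T T' quot B"
  then interpret B: fibered_bracketing T T' quot B .
  have brs: "brs C \<subseteq> brs B"
  proof
    fix A
    assume "A \<in> brs C"
    then consider "A \<in> Es" | "\<not> nontrivial T A" using brs_collision by blast
    then show "A \<in> brs B"
    proof cases
      case 1
      then show ?thesis using B.fiber_brs[OF essential_level_contract[OF 1]] fiber_essential by simp
    next
      case 2
      then show ?thesis by (rule B.trivial_brs)
    qed
  qed
  \<comment> \<open>An essential bracket other than \<open>E0\<close> lies over an essential, hence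
    nonsingleton, bracket. So only \<open>E0\<close> can share its truncation with a singleton
    bracket, which then belongs to a kept child of the fused parent.\<close>
  have mixed: "A1 = E0 \<and> (\<exists>x. x \<in> ch T w \<and> x \<notin> R \<and> A2 = singleton_bracket T (Suc k0) x)"
    if A: "A1 \<in> Es" "is_singleton_bracket T A2" and over: "butlast A1 = butlast A2" "last A1 \<inter> last A2 = {}" for A1 A2
  proof -
    have ne: "butlast A2 \<noteq> []" using tower_props A(1) over(1) unfolding essentials_eq_tower by metis
    then have "is_singleton_bracket T (butlast A1)" using is_singleton_butlast[OF A(2)] over(1) by simp
    then have A1: "A1 = E0" using essential(2,3) A(1) by blast
    have A2C: "A2 \<in> brs C" using trivial_brs A(2) by (simp add: nontrivial_def)
    have len: "length A2 = Suc (Suc k0)" using length_over[OF A2C E0_brs] over(1) A1 fused_parent(3) by simp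
    obtain k x where x: "x \<in> level T k" "A2 = singleton_bracket T k x" "last A2 = {x}" "length A2 = Suc k"
      using A(2) by (rule is_singleton_bracketE)
    have "x \<in> ch T w"
      using last_over_singleton[OF pre_bracket[OF A2C] _ fused_parent(1)] over(1) A1 fused_parent(2) x(3) by simp
    moreover have "x \<notin> last E0" using over(2) A1 x(3) by simp
    then have "x \<notin> R" using removed_child_of_kept(2)[OF calculation fused_parent_not_removed] by blast
    ultimately show ?thesis using A1 x len by auto
  qed
  have E0_fiber: "fiber (Suc k0) (Inr E0) = E0" using fiber_essential[OF E0_essential] fused_parent(3) by simp
  have w_level: "Inl w \<in> level T' k0"
    by (rule kept_level_contract[OF fused_parent(1) fused_parent_not_removed])
  have less: "(A1, A2) \<in> less_rel B" if less: "(A1, A2) \<in> less_rel C" for A1 A2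
  proof -
    have mem: "A1 \<in> brs C" "A2 \<in> brs C" using less less_brs by blast+
    have over: "butlast A1 = butlast A2" "last A1 \<inter> last A2 = {}" using less_over[OF less] by blast+
    have "A1 \<in> Es \<or> is_singleton_bracket T A1" "A2 \<in> Es \<or> is_singleton_bracket T A2"
      using mem brs_collision less_not_max[OF less] unfolding nontrivial_def by blast+
    then consider (ss) "is_singleton_bracket T A1" "is_singleton_bracket T A2"
      | (ee) "A1 \<in> Es" "A2 \<in> Es" | (es) "A1 \<in> Es" "is_singleton_bracket T A2"
      | (se) "is_singleton_bracket T A1" "A2 \<in> Es" by blast
    then show ?thesis
    proof cases
      case ss
      obtain k u u1 u2 where "u \<in> level T k" "(u1, u2) \<in> sib T u"
        "A1 = singleton_bracket T (Suc k) u1" "A2 = singleton_bracket T (Suc k) u2"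
        by (rule singleton_less_sib[OF less ss])
      then show ?thesis using B.less_sib by simp
    next
      case ee
      \<comment> \<open>Otherwise both brackets would equal \<open>E0\<close>, against
        irreflexivity.\<close>
      have "butlast A1 \<in> Es"
      proof (rule ccontr)
        assume "butlast A1 \<notin> Es"
        then have "A1 = E0" "A2 = E0" using essential(3)[OF ee(1)] essential(3)[OF ee(2)] over(1) by auto
        then show False using less less_irrefl by simp
      qed
      moreover have "(Inr A1, Inr A2) \<in> sib T' (Inr (butlast A1))"
        using ee less over(1) by (simp add: sib_contract contract_sib_def)
      ultimately have lB: "(fiber (Suc (length (butlast A1) - 1)) (Inr A1), fiber (Suc (length (butlast A1) - 1)) (Inr A2)) \<in> less_rel B"
        using B.fiber_less essential_level_contract by blast
      have "length A1 = length A2" using length_over[OF mem over(1)] .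
      moreover have "Suc (length (butlast A1) - 1) = length A1 - 1"
        using essential_length[OF \<open>butlast A1 \<in> Es\<close>] by simp
      ultimately show ?thesis using lB fiber_essential[OF ee(1)] fiber_essential[OF ee(2)] by simp
    next
      case es
      then obtain x where x: "A1 = E0" "x \<in> ch T w" "x \<notin> R" "A2 = singleton_bracket T (Suc k0) x"
        using mixed over by blast
      obtain z where z: "z \<in> last E0" using essential_last_nonempty[OF E0_essential] by blast
      have "(z, x) \<in> sib T w" using E0_less_sibling(2)[OF x(2,3) z] less x by simp
      then have "(Inr E0, Inl x) \<in> sib T' (Inl w)"
        using x z by (auto simp: sib_contract contract_sib_def fused_children_def)
      then have "(fiber (Suc k0) (Inr E0), fiber (Suc k0) (Inl x)) \<in> less_rel B"
        by (rule B.fiber_less[OF w_level])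
      then show ?thesis using E0_fiber x fiber_kept[OF level_SucI[OF fused_parent(1) x(2)] x(3)] by simp
    next
      case se
      then obtain x where x: "A2 = E0" "x \<in> ch T w" "x \<notin> R" "A1 = singleton_bracket T (Suc k0) x"
        using mixed[OF se(2,1) over(1)[symmetric]] over(2) by (simp add: Int_commute) blast
      obtain z where z: "z \<in> last E0" using essential_last_nonempty[OF E0_essential] by blast
      have "(x, z) \<in> sib T w" using E0_less_sibling(1)[OF x(2,3) z] less x by simp
      then have "(Inl x, Inr E0) \<in> sib T' (Inl w)"
        using x z by (auto simp: sib_contract contract_sib_def fused_children_def)
      then have "(fiber (Suc k0) (Inl x), fiber (Suc k0) (Inr E0)) \<in> less_rel B"
        by (rule B.fiber_less[OF w_level])
      then show ?thesis using E0_fiber x fiber_kept[OF level_SucI[OF fused_parent(1) x(2)] x(3)] by simp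
    qed
  qed
  have "bk_le C B"
    using bracketing_bk_le_iff[OF bracketing_axioms B.bracketing_axioms] brs less by auto
  then show "B \<in> facet T C" using B.bracketing_axioms by (simp add: facet_def associahedron_iff)
qed

end

section \<open>The canonical map and its inverse\<close>

context collision_tree
begin

text \<open>The image of \<open>A\<close> contains the vertex of \<open>E\<close>, hence the
  singleton bracket of that vertex, whose preimage is \<open>E\<close>.\<close>

lemma essential_bsub_saturated:
  assumes A: "pre_bracket T A" "A \<in> saturated" and E: "E \<in> Es" "length E = length A" "last E \<inter> last A \<noteq> {}"
  shows "E \<sqsubseteq> A"
proof -
  obtain v where v: "v \<in> last E" "v \<in> last A" using E(3) by blast
  have "A \<noteq> []" using A(1) pre_bracket_nonempty by blast
  then have "Inr E \<in> last (push A)" using v quot_essential[OF E(1)] by (force simp: last_push)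
  then have "singleton_bracket T' (length E - 1) (Inr E) \<sqsubseteq> push A"
    using cod.singleton_bsub[OF pre_bracket_push[OF A(1)]] E(2) by simp
  then have "fiber (length E - 1) (Inr E) \<sqsubseteq> pull (push A)" by (rule pull_mono)
  then show ?thesis using fiber_essential[OF E(1)] A(2) by (simp add: saturated_def)
qed

text \<open>An unsaturated bracket lies properly inside a fiber. A fiber over a kept vertex is a
  singleton bracket and leaves no room; any other fiber is an essential bracket that meets
  \<open>A\<close>, so a contractible \<open>A\<close> would contain it.\<close>

lemma contractible_iff:
  assumes B: "B \<in> facet T C" and A: "A \<in> brs B"
  shows "A \<in> contractible T C \<longleftrightarrow> A \<in> saturated"
proof
  interpret B: fibered_bracketing T T' quot B using B by (simp add: facet_iff)
  note pre = B.pre_bracket[OF A]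
  show "A \<in> saturated \<Longrightarrow> A \<in> contractible T C"
    unfolding contractible_def using essential_bsub_saturated[OF pre] by blast
  assume con: "A \<in> contractible T C"
  show "A \<in> saturated"
  proof (rule ccontr)
    assume not_sat: "A \<notin> saturated"
    then obtain x where x: "x \<in> level T' (length A - 1)" "push A = singleton_bracket T' (length A - 1) x"
      using B.saturated_or_in_fiber[OF A] by blast
    have le: "A \<sqsubseteq> fiber (length A - 1) x" using bsub_fiber_iff[OF x(1) pre] x(2) by simp
    have "A = fiber (length A - 1) x"
      using x(1)
    proof (cases rule: fiber_cases)
      case (kept u)
      then show ?thesis using bsub_singleton[OF pre kept(1)] le by simp
    next
      case (ess E)
      have "last A \<subseteq> last E" using bsub_last[OF le] B.brs_nonempty[OF A] ess(4) by simp
      then have "last E \<inter> last A \<noteq> {}" using pre_bracket_last[OF pre] by blast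
      moreover have "length E = length A" using bsub_length[OF le] ess by simp
      ultimately have "E \<sqsubseteq> A" using con ess(1) by (auto simp: contractible_def)
      then show ?thesis using le ess(4) by (auto intro: bsub_antisym)
    qed
    then show False using not_sat x(2) by (simp add: saturated_def)
  qed
qed

text \<open>Entry \<open>i\<close> depends on the prefix of length \<open>Suc i\<close>, and
  prefixes of saturated brackets are saturated. So an essential bracket of that length meeting the
  prefix is contained in it.\<close>

lemma contract_bracket_eq_push:
  assumes A: "pre_bracket T A" "A \<in> saturated"
  shows "contract_bracket T C A = push A"
proof (rule nth_equalityI)
  fix i
  assume "i < length (contract_bracket T C A)"
  then have i: "i < length A" by (simp add: contract_bracket_def)
  have last: "last (take (Suc i) A) = A ! i" using i by (simp add: take_Suc_conv_app_nth)
  have len: "length (take (Suc i) A) = Suc i" using i by simp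
  have "pull (push (take (Suc i) A)) = take (Suc i) (pull (push A))"
    by (simp add: push_def pull_def take_map)
  then have sat: "take (Suc i) A \<in> saturated" using A(2) by (simp add: saturated_def)
  have pre: "pre_bracket T (take (Suc i) A)"
    unfolding pre_bracket_iff
    using pre_bracket_nth[OF A(1)] pre_bracket_step[OF A(1)] last i by auto
  have "Inl ` (A ! i - R) \<union> Inr ` {E \<in> Es. E \<sqsubseteq> take (Suc i) A} = quot ` (A ! i)"
  proof (intro set_eqI iffI)
    fix y
    assume "y \<in> Inl ` (A ! i - R) \<union> Inr ` {E \<in> Es. E \<sqsubseteq> take (Suc i) A}"
    then consider v where "y = Inl v" "v \<in> A ! i" "v \<notin> R"
      | E where "y = Inr E" "E \<in> Es" "E \<sqsubseteq> take (Suc i) A" by blast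
    then show "y \<in> quot ` (A ! i)"
    proof cases
      case 1
      then show ?thesis using quot_kept by (metis imageI)
    next
      case 2
      obtain v where v: "v \<in> last E" using essential_last_nonempty[OF 2(2)] by blast
      then have "v \<in> A ! i"
        using bsub_last[OF 2(3) brs_nonempty[OF essential(1)[OF 2(2)]]] last by auto
      then show ?thesis using 2 quot_essential[OF 2(2) v] by (metis imageI)
    qed
  next
    fix y
    assume "y \<in> quot ` (A ! i)"
    then obtain v where v: "v \<in> A ! i" "y = quot v" by blast
    show "y \<in> Inl ` (A ! i - R) \<union> Inr ` {E \<in> Es. E \<sqsubseteq> take (Suc i) A}"
    proof (cases "v \<in> R")
      case True
      then obtain E where E: "E \<in> Es" "v \<in> last E" using removed_iff by blast
      have "v \<in> level T i" using v pre_bracket_nth[OF A(1) i] by blast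
      then have "length E - 1 = i" using essential_level[OF E(1)] E(2) level_unique by blast
      then have "length E = length (take (Suc i) A)" using essential_length[OF E(1)] len by simp
      then have "E \<sqsubseteq> take (Suc i) A"
        using essential_bsub_saturated[OF pre sat E(1)] E(2) v(1) last by auto
      then show ?thesis using v(2) E quot_essential by auto
    qed (use v quot_kept in auto)
  qed
  then show "contract_bracket T C A ! i = push A ! i"
    using i by (simp add: contract_bracket_def push_def)
qed (simp add: contract_bracket_def)

lemma contract_bracketing_eq_push:
  assumes B: "B \<in> facet T C"
  shows "contract_bracketing T C B = push_bracketing B"
proof -
  interpret B: fibered_bracketing T T' quot B using B by (simp add: facet_iff)
  have eq: "contract_bracket T C A = push A" if "A \<in> brs B \<inter> saturated" for A
    using that contract_bracket_eq_push B.pre_bracket by blast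
  have "brs B \<inter> contractible T C = brs B \<inter> saturated" using contractible_iff[OF B] by blast
  moreover have "less_rel B \<inter> contractible T C \<times> contractible T C = less_rel B \<inter> saturated \<times> saturated"
    using contractible_iff[OF B] B.less_brs by blast
  moreover have "contract_bracket T C ` (brs B \<inter> saturated) = push ` (brs B \<inter> saturated)"
    using eq by (rule image_cong[OF refl])
  moreover have "map_prod (contract_bracket T C) (contract_bracket T C) ` (less_rel B \<inter> saturated \<times> saturated) =
      map_prod push push ` (less_rel B \<inter> saturated \<times> saturated)"
    using B.less_brs eq by (intro image_cong refl) auto
  ultimately show ?thesis
    by (simp add: contract_bracketing_def push_bracketing_def restrict_brs_def Let_def)
qed

lemma canonical_map_eq:
  "B \<in> facet T C \<Longrightarrow> canonical_map T C B = (push_bracketing B, \<lambda>A \<in> Es. restrict_bracketing B A)"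
  by (simp add: canonical_map_def contract_bracketing_eq_push)

lemma associahedron_contract_iff: "D \<in> associahedron T' \<longleftrightarrow> bracketing T' D"
  using is_bracketing_iff[OF ptree_contract] by (simp add: associahedron_def)

lemma associahedron_subtree_iff:
  assumes "pre_bracket T E"
  shows "P \<in> associahedron (subtree T E) \<longleftrightarrow> bracketing (subtree T E) P"
proof -
  interpret bracket_subtree T E by unfold_locales (rule assms)
  show ?thesis using is_bracketing_iff[OF sub.ptree_axioms] by (simp add: associahedron_def)
qed

lemma essential_pre: "E \<in> Es \<Longrightarrow> pre_bracket T E"
  by (rule pre_bracket[OF essential(1)])

lemma canonical_map_into:
  assumes B: "B \<in> facet T C"
  shows "canonical_map T C B \<in> associahedron T' \<times> fiber_product T C"
proof -
  interpret B: fibered_bracketing T T' quot B using B by (simp add: facet_iff)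
  have brs: "E \<in> brs B" if "E \<in> Es" for E
    using B.fiber_brs[OF essential_level_contract[OF that]] fiber_essential[OF that] by simp
  have "(\<lambda>A \<in> Es. restrict_bracketing B A) \<in> fiber_product T C"
    unfolding fiber_product_def
  proof (intro CollectI conjI ballI)
    show "(\<lambda>A \<in> Es. restrict_bracketing B A) \<in> (\<Pi>\<^sub>E A \<in> Es. associahedron (subtree T A))"
    proof (rule PiE_I)
      fix A
      assume A: "A \<in> Es"
      then have "bracketing (subtree T A) (restrict_bracketing B A)" by (intro B.restrict_bracketing brs)
      then show "(\<lambda>A \<in> Es. restrict_bracketing B A) A \<in> associahedron (subtree T A)"
        using A associahedron_subtree_iff[OF essential_pre[OF A]] by simp
    qed simp
    fix A
    assume A: "A \<in> Es - {E0}"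
    then have "butlast A \<in> Es" "A \<noteq> []" using essential(3)[of A] brs_nonempty[OF essential(1)[of A]] by auto
    then show "truncate_bracketing (length A - 1) ((\<lambda>A \<in> Es. restrict_bracketing B A) A) =
        (\<lambda>A \<in> Es. restrict_bracketing B A) (butlast A)"
      using A truncate_restrict_bracketing[of A B] by simp
  qed
  then show ?thesis
    using B.push_bracketing by (simp add: canonical_map_eq[OF B] associahedron_contract_iff)
qed

text \<open>The criterion for fibered bracketings ranges over all fibers. Those over kept vertices
  are singleton brackets, where any two restrictions agree, so only the essential brackets
  remain.\<close>

lemma canonical_map_le_iff:
  assumes B1: "B1 \<in> facet T C" and B2: "B2 \<in> facet T C"
  shows "bk_le B1 B2 \<longleftrightarrow>
    prod_le bk_le (fiber_product_le T C) (canonical_map T C B1) (canonical_map T C B2)"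
proof -
  interpret B1: fibered_bracketing T T' quot B1 using B1 by (simp add: facet_iff)
  interpret B2: fibered_bracketing T T' quot B2 using B2 by (simp add: facet_iff)
  have "(\<forall>k. \<forall>x \<in> level T' k. bk_le (restrict_bracketing B1 (fiber k x)) (restrict_bracketing B2 (fiber k x)))
      \<longleftrightarrow> (\<forall>E \<in> Es. bk_le (restrict_bracketing B1 E) (restrict_bracketing B2 E))" (is "?L \<longleftrightarrow> ?R")
  proof
    assume L: ?L
    show ?R
    proof
      fix E
      assume E: "E \<in> Es"
      show "bk_le (restrict_bracketing B1 E) (restrict_bracketing B2 E)"
        using L[rule_format, OF essential_level_contract[OF E]] fiber_essential[OF E] by simp
    qed
  next
    assume R: ?R
    show ?L
    proof (intro allI ballI)
      fix k x
      assume "x \<in> level T' k"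
      then show "bk_le (restrict_bracketing B1 (fiber k x)) (restrict_bracketing B2 (fiber k x))"
      proof (cases rule: fiber_cases)
        case (kept u)
        then show ?thesis
          using B1.restrict_bracketing_singleton[of "fiber k x"] B2.restrict_bracketing_singleton[of "fiber k x"]
            is_singleton_bracketI[OF kept(1)] by (simp add: bk_le_def)
      next
        case (ess E)
        then show ?thesis using R by simp
      qed
    qed
  qed
  then show ?thesis
    using fibered_bk_le_iff[OF B1.fibered_bracketing_axioms B2.fibered_bracketing_axioms]
    by (simp add: prod_le_def fiber_product_le_def canonical_map_eq B1 B2)
qed

lemma canonical_map_onto:
  assumes D: "D \<in> associahedron T'" and F_prod: "F \<in> fiber_product T C"
  shows "\<exists>B \<in> facet T C. canonical_map T C B = (D, F)"
proof -
  \<comment> \<open>Fibers over kept vertices are singleton brackets, with only one bracketing of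
    their subtrees; restricting \<open>C\<close> is a convenient way to name it.\<close>
  define F' where "F' A = (if A \<in> Es then F A else restrict_bracketing C A)" for A
  have FE: "bracketing (subtree T E) (F E)" if "E \<in> Es" for E
    using F_prod that associahedron_subtree_iff[OF essential_pre[OF that]] by (auto simp: fiber_product_def)
  have not_Es: "singleton_bracket T k u \<notin> Es" if "u \<in> level T k" for k u
    using essential(2) that by blast
  have trunc: "truncate_bracketing (Suc k) (F' (fiber (Suc k) y)) = F' (fiber k x)"
    if x: "x \<in> level T' k" and y: "y \<in> ch T' x" for k x y
  proof -
    have y_level: "y \<in> level T' (Suc k)" using x y by (rule level_SucI)
    have but: "butlast (fiber (Suc k) y) = fiber k x" by (rule butlast_fiber[OF x y])
    from y_level show ?thesis
    proof (cases rule: fiber_cases)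
      case (kept v)
      have "x = Inl u \<and> u \<in> level T k \<and> u \<notin> R \<and> fiber k x = singleton_bracket T k u" if "x = Inl u" for u
        using x that by (cases rule: fiber_cases) simp_all
      moreover obtain u where "x = Inl u" using y kept(3) by (auto simp: ch_def contract_tree_def)
      ultimately have u: "u \<in> level T k" "fiber k x = singleton_bracket T k u" by blast+
      have "truncate_bracketing (Suc k) (restrict_bracketing C (fiber (Suc k) y)) =
          restrict_bracketing C (fiber k x)"
        using truncate_restrict_bracketing[of "fiber (Suc k) y" C] but by (simp flip: length_greater_0_conv)
      then show ?thesis using not_Es kept(1,4) u by (simp add: F'_def)
    next
      case (ess E)
      show ?thesis
      \<comment> \<open>The fiber product imposes nothing on the arc from the fused parent to the
        vertex of \<open>E0\<close>. Compatibility holds there because the truncation of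
        \<open>E0\<close> is a singleton bracket, which determines the truncated bracketing.\<close>
      proof (cases "E = E0")
        case True
        have k: "k = k0" using ess(2) True fused_parent(3) by simp
        have E0_fib: "fiber (Suc k) y = E0" and w_fib: "fiber k x = singleton_bracket T k0 w"
          using ess(4) True but fused_parent(2) by auto
        have take: "take (Suc k0) E0 = singleton_bracket T k0 w"
          using fused_parent(2,3) by (simp add: butlast_conv_take)
        have sing: "is_singleton_bracket T (singleton_bracket T k0 w)"
          using fused_parent(1) by blast
        have "truncate_bracketing (Suc k0) (F E0) =
            \<lparr>brs = {A. \<exists>j. 0 < j \<and> j \<le> Suc k0 \<and> A = take j E0}, less_rel = {}\<rparr>"
          using truncate_over_singleton[OF essential_pre[OF E0_essential] FE[OF E0_essential], of "Suc k0"]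
            take sing fused_parent(3) by simp
        moreover have "take j E0 = take j (singleton_bracket T k0 w)" if "j \<le> Suc k0" for j
          using that unfolding take[symmetric] by simp
        then have "{A. \<exists>j. 0 < j \<and> j \<le> Suc k0 \<and> A = take j E0} =
            {A. \<exists>j. 0 < j \<and> j \<le> Suc k0 \<and> A = take j (singleton_bracket T k0 w)}" by auto
        ultimately have "truncate_bracketing (Suc k0) (F E0) = restrict_bracketing C (singleton_bracket T k0 w)"
          using restrict_bracketing_singleton[OF sing] by simp
        then show ?thesis
          using E0_fib w_fib k E0_essential not_Es[OF fused_parent(1)] by (simp add: F'_def)
      next
        case False
        then have P: "butlast E \<in> Es" using essential(3)[OF ess(1)] by blast
        have "truncate_bracketing (length E - 1) (F E) = F (butlast E)"
          using F_prod ess(1) False by (auto simp: fiber_product_def)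
        then show ?thesis using ess but P by (simp add: F'_def)
      qed
    qed
  qed
  interpret gluing T T' quot D F'
  proof (intro gluing.intro gluing_axioms.intro)
    show "tree_map T T' quot" by (rule tree_map_axioms)
    show "bracketing T' D" using D by (simp add: associahedron_contract_iff)
    show "bracketing (subtree T (fiber k x)) (F' (fiber k x))" if "x \<in> level T' k" for k x
      using that
    proof (cases rule: fiber_cases)
      case (kept u)
      then show ?thesis
        using restrict_bracketing[OF singleton_brs[OF kept(1)]] not_Es[OF kept(1)] by (simp add: F'_def)
    next
      case (ess E)
      then show ?thesis using FE by (simp add: F'_def)
    qed
  qed (rule trunc)
  have G: "glued \<in> facet T C" using fibered_glued by (simp add: facet_iff)
  have "(\<lambda>A \<in> Es. restrict_bracketing glued A) = F"
  proof
    fix A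
    show "(\<lambda>A \<in> Es. restrict_bracketing glued A) A = F A"
    proof (cases "A \<in> Es")
      case True
      then have "restrict_bracketing glued A = F' A"
        using restrict_glued[OF essential_level_contract[OF True]] fiber_essential[OF True] by simp
      then show ?thesis using True by (simp add: F'_def)
    next
      case False
      \<comment> \<open>Outside the index set both functions take the value
        \<open>undefined\<close>, as members of the fiber product are extensional.\<close>
      then show ?thesis using F_prod by (auto simp: fiber_product_def PiE_def extensional_def)
    qed
  qed
  then have "canonical_map T C glued = (D, F)"
    by (simp add: canonical_map_eq[OF G] push_bracketing_glued)
  then show ?thesis using G by blast
qed

lemma canonical_map_iso:
  "poset_iso (facet T C) bk_le (associahedron T' \<times> fiber_product T C)
     (prod_le bk_le (fiber_product_le T C)) (canonical_map T C)"
proof -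
  \<comment> \<open>Injectivity comes from the order: the map reflects it, and bracketings below
    each other are equal.\<close>
  have "inj_on (canonical_map T C) (facet T C)"
  proof (rule inj_onI)
    fix B1 B2
    assume B: "B1 \<in> facet T C" "B2 \<in> facet T C" "canonical_map T C B1 = canonical_map T C B2"
    have br: "bracketing T B1" "bracketing T B2" using B by (simp_all add: facet_def associahedron_iff)
    have refl: "bk_le B1 B1" using bracketing_bk_le_iff[OF br(1) br(1)] by simp
    then have "bk_le B1 B2" "bk_le B2 B1"
      using canonical_map_le_iff[OF B(1,1)] canonical_map_le_iff[OF B(1,2)] canonical_map_le_iff[OF B(2,1)] B(3)
      by simp_all
    then have "brs B1 = brs B2" "less_rel B1 = less_rel B2"
      using bracketing_bk_le_iff[OF br] bracketing_bk_le_iff[OF br(2,1)] by auto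
    then show "B1 = B2" by simp
  qed
  moreover have "canonical_map T C ` facet T C = associahedron T' \<times> fiber_product T C"
    using canonical_map_into canonical_map_onto by (force simp: image_iff)
  ultimately show ?thesis
    using canonical_map_le_iff by (simp add: poset_iso_def bij_betw_def)
qed

end

theorem lemma7p20:
  fixes T :: "'v plane_tree" and C :: "'v bracketing"
  assumes "rooted_plane_tree T" and "1 \<le> depth T" and "\<not> is_path T"
    and "collision T C"
  shows "poset_iso
    (facet T C) bk_le
    (associahedron (contract_tree T C) \<times> fiber_product T C) (prod_le bk_le (fiber_product_le T C))
    (canonical_map T C)"
proof -
  interpret collision_tree T C by unfold_locales (fact assms)+
  show ?thesis by (rule canonical_map_iso)
qed

end
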